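(* Let $d\ge 1$ and $p\ge 1$ be integers and let $\gamma>0$. Let a rank-$1$ lattice with generating vector $\boldsymbol z\in\mathbb Z^d$ and modulus $n$ be given, together with the time-dependent Schrödinger equation on $\mathbb T^d$ $$\mathrm i\,\gamma\,\frac{\partial u}{\partial t}(\boldsymbol x,t)=-\frac{\gamma^2}{2}\,\Delta u(\boldsymbol x,t)+v(\boldsymbol x)\,u(\boldsymbol x,t),\qquad u(\boldsymbol x,0)=g(\boldsymbol x),$$ with potential $v\in E_\alpha(\mathbb T^d)$, $\alpha>2p+1/2$, and initial condition $g\in E_\beta(\mathbb T^d)$, $\beta\ge 2$. Let $D=\frac{\gamma}{2}D_n$ and $W=\frac1\gamma W_n$, with the $n\times n$ matrices $D_n$ and $W_n$ as defined in the context. Suppose that the anti-aliasing set $\mathcal A(\boldsymbol z,n)=\{\boldsymbol h_\xi\in\mathbb Z^d:\boldsymbol h_\xi\cdot\boldsymbol z\equiv\xi\pmod n\text{ for }\xi=0,\ldots,n-1\}$, with full cardinality $n$, is chosen such that it has minimal $\ell_2$ norm, i.e., for every $\xi=0,\dots,n-1$, $$\|\boldsymbol h_\xi\|_2=\min_{\boldsymbol h'\in A(\boldsymbol z,n,\xi)}\|\boldsymbol h'\|_2,\qquad A(\boldsymbol z,n,\xi):=\{\boldsymbol h\in\mathbb Z^d:\boldsymbol h\cdot\boldsymbol z\equiv\xi\pmod n\}.$$ Then: (1) ($p$-th commutator bound) For all $\boldsymbol y\in\mathbb R^n$, $$\|\mathrm{ad}_D^p(W)\,\boldsymbol y\|_2\le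 c\,\|(D+I)^p\,\boldsymbol y\|_2,$$ where $c$ is a constant independent of $n$ and $\boldsymbol y$. (2) (Total error bound) Let $\widehat{\boldsymbol u}_t$ be the solution at time $t$ of the space-discretized equation, and let $\widehat{\boldsymbol u}_a^m$ be its approximation after $m$ steps of size $\Delta t$, with $m\Delta t=t$, of an exponential splitting of order $p$ started from $\widehat{\boldsymbol u}_a^0$ (both as defined in the context). Then $$\|\widehat{\boldsymbol u}_t-\widehat{\boldsymbol u}_a^m\|_2\le C\,\|\widehat{\boldsymbol u}_0-\widehat{\boldsymbol u}_a^0\|_2+C'\,(\Delta t)^p\,\|(D+I)^p\,\widehat{\boldsymbol u}_0\|_2,$$ where the constants $C,C'$ depend on $t$ but not on $m$ or $\Delta t$.
   Context: **Korobov space.** $\mathbb T^d\simeq[0,1]^d$ is the $d$-dimensional torus. For $f\in L_2(\mathbb T^d)$, $\widehat f(\boldsymbol h)$, $\boldsymbol h\in\mathbb Z^d$, denotes the Fourier coefficients with respect to $\exp(2\pi\mathrm i\,\boldsymbol h\cdot\boldsymbol x)$. For smoothness $\alpha\ge 1/2$, $$E_\alpha(\mathbb T^d)=\Big\{f\in L_2(\mathbb T^d):\|f\|_{E_\alpha(\mathbb T^d)}^2:=\sum_{\boldsymbol h\in\mathbb Z^d}|\widehat f(\boldsymbol h)|^2\,r_\alpha^2(\boldsymbol h)<\infty\Big\},\qquad r_\alpha^2(\boldsymbol h)=\prod_{j=1}^d\max(|h_j|^{2\alpha},1).$$ For $\alpha>1/2$ such functions have absolutely summable Fourier coefficients, and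 are identified with their continuous representatives (so point values make sense). **Rank-1 lattice.** The rank-$1$ lattice point set with modulus $n$ and generating vector $\boldsymbol z$ is $\Lambda(\boldsymbol z,n)=\{\boldsymbol p_k:=\boldsymbol z k/n \bmod 1: k=0,\dots,n-1\}$; here its number of points is $n$. **Anti-aliasing set.** A set $\mathcal A(\boldsymbol z,n)\subset\mathbb Z^d$ is an anti-aliasing set for $\Lambda(\boldsymbol z,n)$ if $\boldsymbol z\cdot\boldsymbol h\not\equiv\boldsymbol z\cdot\boldsymbol h'\pmod n$ for all distinct $\boldsymbol h,\boldsymbol h'\in\mathcal A(\boldsymbol z,n)$. It has full cardinality if $|\mathcal A(\boldsymbol z,n)|=n$; then its elements are labelled $\boldsymbol h_\xi$, $\xi=0,\dots,n-1$, with $\boldsymbol h_\xi\cdot\boldsymbol z\equiv\xi\pmod n$. **Matrices.** $$D_n=\mathrm{diag}\big((4\pi^2\|\boldsymbol h_\xi\|_2^2)_{\xi=0,\dots,n-1}\big),\quad V_n=\mathrm{diag}\big((v(\boldsymbol p_k))_{k=0,\dots,n-1}\big),\quad F_n=\Big(\tfrac1{\sqrt n}\exp(-2\pi\mathrm i\,\xi\xi'/n)\Big)_{\xi,\xi'=0,\dots,n-1},$$ and $W_n=F_nV_nF_n^{-1}$. Equivalently, $W_n$ is the circulant matrix with $(\xi,\xi')$ entry $$w_{\xi,\xi'}=\sum_{\boldsymbol h\in\mathbb Z^d,\ \boldsymbol h\cdot\boldsymbol z\equiv\xi-\xi'\ (\mathrm{mod}\ n)}\widehat v(\boldsymbol h).$$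 $I$ is the $n\times n$ identity matrix and $\|\cdot\|_2$ is the Euclidean norm of a vector. **Commutators.** $[A,B]=AB-BA$, $\mathrm{ad}_A^0(B)=B$, and $\mathrm{ad}_A^p(B)=[A,\mathrm{ad}_A^{p-1}(B)]$ for $p\ge1$. **Space-discretized equation.** $\widehat{\boldsymbol u}_t\in\mathbb C^n$ is the solution of $$\mathrm i\,\gamma\,\widehat{\boldsymbol u}_t'=\tfrac12\gamma^2D_n\widehat{\boldsymbol u}_t+W_n\widehat{\boldsymbol u}_t,\qquad \widehat{\boldsymbol u}_0=(\widehat g_a(\boldsymbol h_0),\dots,\widehat g_a(\boldsymbol h_{n-1})),\qquad \widehat g_a(\boldsymbol h)=\frac1n\sum_{\boldsymbol p\in\Lambda(\boldsymbol z,n)}g(\boldsymbol p)\exp(-2\pi\mathrm i\,\boldsymbol h\cdot\boldsymbol p),$$ that is, $\widehat{\boldsymbol u}_t=\mathrm e^{-\mathrm i Wt-\mathrm i Dt}\,\widehat{\boldsymbol u}_0$. **Exponential splitting.** An exponential splitting with $s$ stages and coefficients $a_1,\dots,a_s$, $b_1,\dots,b_s$, for an equation $y'(t)=(A+B)y(t)$, approximates $$y(t+\Delta t)\approx \mathrm e^{b_1B\Delta t}\,\mathrm e^{a_1A\Delta t}\cdots\mathrm e^{b_sB\Delta t}\,\mathrm e^{a_sA\Delta t}\,y(t).$$ It has order $p$ if its coefficients are such that $$\big\|\mathrm e^{b_1B\Delta t}\mathrm e^{a_1A\Delta t}\cdots\mathrm e^{b_sB\Delta t}\mathrm e^{a_sA\Delta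 t}\,y(t)-\mathrm e^{(A+B)\Delta t}y(t)\big\|\le C\,(\Delta t)^{p+1}$$ with $C$ independent of $\Delta t$. Applied to the space-discretized equation with a splitting of order $p$, the approximations are defined, from a starting vector $\widehat{\boldsymbol u}_a^0\in\mathbb C^n$, by $$\widehat{\boldsymbol u}_a^{k+1}=\mathrm e^{-\mathrm i b_1W\Delta t}\,\mathrm e^{-\mathrm i a_1D\Delta t}\cdots\mathrm e^{-\mathrm i b_sW\Delta t}\,\mathrm e^{-\mathrm i a_sD\Delta t}\,\widehat{\boldsymbol u}_a^k,\qquad k=0,1,\dots,m-1.$$ *)

theory Defs
  imports "HOL-Analysis.Analysis" "HOL-Number_Theory.Cong" "Jordan_Normal_Form.Gauss_Jordan_Elimination"
begin

(* The frequency dimension d is the fixed index type 'd (d = CARD('d)).  The modulus n varies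
   inside statements about constants that do not depend on n, so n x n matrices and vectors of
   length n are those of Jordan_Normal_Form.  Both libraries have a type of vectors; the
   Jordan_Normal_Form notions are written with a qualifier where the names clash. *)

subsection \<open>Korobov spaces on the torus\<close>

definition rvec :: "int ^ 'd \<Rightarrow> real ^ 'd" where
  "rvec h = (\<chi> j. real_of_int (vec_nth h j))"

(* functions on the torus are functions on R^d of period 1 in each coordinate *)
definition torus_periodic :: "(real ^ 'd \<Rightarrow> complex) \<Rightarrow> bool" where
  "torus_periodic f \<longleftrightarrow> (\<forall>x k. f (x + rvec k) = f x)"

definition torus_L2 :: "(real ^ 'd \<Rightarrow> complex) set" where
  "torus_L2 = {f. torus_periodic f \<and> f \<in> borel_measurable lebesgue \<and>
                  set_integrable lebesgue (cbox 0 1) (\<lambda>x. (cmod (f x))\<^sup>2)}"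

definition fourier_coeff :: "(real ^ 'd \<Rightarrow> complex) \<Rightarrow> int ^ 'd \<Rightarrow> complex" where
  "fourier_coeff f h =
     (LINT x:cbox 0 1|lebesgue. f x * exp (- 2 * pi * \<i> * complex_of_real (inner (rvec h) x)))"

definition korobov_weight :: "real \<Rightarrow> int ^ 'd \<Rightarrow> real" where
  "korobov_weight \<alpha> h = (\<Prod>j\<in>UNIV. max (\<bar>real_of_int (vec_nth h j)\<bar> powr (2 * \<alpha>)) 1)"

definition korobov_space :: "real \<Rightarrow> (real ^ 'd \<Rightarrow> complex) set" where
  "korobov_space \<alpha> = {f \<in> torus_L2.
     (\<lambda>h. (cmod (fourier_coeff f h))\<^sup>2 * korobov_weight \<alpha> h) summable_on UNIV}"

(* For \<alpha> > 1/2 every class in the Korobov space has exactly one continuous representative;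
   this is the set of these representatives. *)
definition korobov_cont :: "real \<Rightarrow> (real ^ 'd \<Rightarrow> complex) set" where
  "korobov_cont \<alpha> = {f \<in> korobov_space \<alpha>. continuous_on UNIV f}"

subsection \<open>Rank-1 lattices and anti-aliasing sets\<close>

definition idot :: "int ^ 'd \<Rightarrow> int ^ 'd \<Rightarrow> int" where
  "idot z h = (\<Sum>j\<in>UNIV. vec_nth z j * vec_nth h j)"

definition lattice_point :: "int ^ 'd \<Rightarrow> nat \<Rightarrow> nat \<Rightarrow> real ^ 'd" where
  "lattice_point z n k = (\<chi> j. frac (real_of_int (vec_nth z j) * real k / real n))"

definition rank1_lattice :: "int ^ 'd \<Rightarrow> nat \<Rightarrow> (real ^ 'd) set" where
  "rank1_lattice z n = lattice_point z n ` {..<n}"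

definition alias_class :: "int ^ 'd \<Rightarrow> nat \<Rightarrow> nat \<Rightarrow> (int ^ 'd) set" where
  "alias_class z n \<xi> = {h. [idot h z = int \<xi>] (mod int n)}"

definition anti_aliasing :: "int ^ 'd \<Rightarrow> nat \<Rightarrow> (int ^ 'd) set \<Rightarrow> bool" where
  "anti_aliasing z n A \<longleftrightarrow>
     (\<forall>h\<in>A. \<forall>h'\<in>A. h \<noteq> h' \<longrightarrow> \<not> [idot z h = idot z h'] (mod int n))"

(* h is the labelling of the elements of A by residues *)
definition full_anti_aliasing ::
    "int ^ 'd \<Rightarrow> nat \<Rightarrow> (int ^ 'd) set \<Rightarrow> (nat \<Rightarrow> int ^ 'd) \<Rightarrow> bool" where
  "full_anti_aliasing z n A h \<longleftrightarrow> anti_aliasing z n A \<and> finite A \<and> card A = n \<and>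
     A = h ` {..<n} \<and> (\<forall>\<xi><n. [idot (h \<xi>) z = int \<xi>] (mod int n))"

definition minimal_anti_aliasing ::
    "int ^ 'd \<Rightarrow> nat \<Rightarrow> (int ^ 'd) set \<Rightarrow> (nat \<Rightarrow> int ^ 'd) \<Rightarrow> bool" where
  "minimal_anti_aliasing z n A h \<longleftrightarrow> full_anti_aliasing z n A h \<and>
     (\<forall>\<xi><n. \<forall>h'\<in>alias_class z n \<xi>. norm (rvec (h \<xi>)) \<le> norm (rvec h'))"

subsection \<open>Matrices\<close>

definition vnorm :: "complex Matrix.vec \<Rightarrow> real" where
  "vnorm y = sqrt (\<Sum>i<dim_vec y. (cmod (vec_index y i))\<^sup>2)"

definition mat_exp :: "complex Matrix.mat \<Rightarrow> complex Matrix.mat" where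
  "mat_exp A = Matrix.mat (dim_row A) (dim_row A)
     (\<lambda>(i, j). \<Sum>k. (A ^\<^sub>m k) $$ (i, j) / fact k)"

definition commutator :: "complex Matrix.mat \<Rightarrow> complex Matrix.mat \<Rightarrow> complex Matrix.mat" where
  "commutator A B = A * B - B * A"

primrec ad :: "complex Matrix.mat \<Rightarrow> nat \<Rightarrow> complex Matrix.mat \<Rightarrow> complex Matrix.mat" where
  "ad A 0 B = B"
| "ad A (Suc p) B = commutator A (ad A p B)"

definition D_mat :: "nat \<Rightarrow> (nat \<Rightarrow> int ^ 'd) \<Rightarrow> complex Matrix.mat" where
  "D_mat n h = mat_diag n (\<lambda>\<xi>. complex_of_real (4 * pi\<^sup>2 * (norm (rvec (h \<xi>)))\<^sup>2))"

definition V_mat :: "nat \<Rightarrow> int ^ 'd \<Rightarrow> (real ^ 'd \<Rightarrow> complex) \<Rightarrow> complex Matrix.mat" where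
  "V_mat n z v = mat_diag n (\<lambda>k. v (lattice_point z n k))"

definition F_mat :: "nat \<Rightarrow> complex Matrix.mat" where
  "F_mat n = Matrix.mat n n
     (\<lambda>(\<xi>, \<xi>'). exp (- 2 * pi * \<i> * of_nat \<xi> * of_nat \<xi>' / of_nat n) / complex_of_real (sqrt (real n)))"

(* the Fourier matrix is invertible for n > 0, so "the" is applied to a proper value *)
definition W_mat :: "nat \<Rightarrow> int ^ 'd \<Rightarrow> (real ^ 'd \<Rightarrow> complex) \<Rightarrow> complex Matrix.mat" where
  "W_mat n z v = F_mat n * V_mat n z v * the (mat_inverse (F_mat n))"

definition scaled_D :: "real \<Rightarrow> nat \<Rightarrow> (nat \<Rightarrow> int ^ 'd) \<Rightarrow> complex Matrix.mat" where
  "scaled_D \<gamma> n h = complex_of_real (\<gamma> / 2) \<cdot>\<^sub>m D_mat n h"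

definition scaled_W :: "real \<Rightarrow> nat \<Rightarrow> int ^ 'd \<Rightarrow> (real ^ 'd \<Rightarrow> complex) \<Rightarrow> complex Matrix.mat" where
  "scaled_W \<gamma> n z v = complex_of_real (1 / \<gamma>) \<cdot>\<^sub>m W_mat n z v"

subsection \<open>The space-discretized equation\<close>

definition lattice_coeff ::
    "int ^ 'd \<Rightarrow> nat \<Rightarrow> (real ^ 'd \<Rightarrow> complex) \<Rightarrow> int ^ 'd \<Rightarrow> complex" where
  "lattice_coeff z n g h = (1 / of_nat n) *
     (\<Sum>x\<in>rank1_lattice z n. g x * exp (- 2 * pi * \<i> * complex_of_real (inner (rvec h) x)))"

definition initial_vec ::
    "int ^ 'd \<Rightarrow> nat \<Rightarrow> (nat \<Rightarrow> int ^ 'd) \<Rightarrow> (real ^ 'd \<Rightarrow> complex) \<Rightarrow> complex Matrix.vec" where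
  "initial_vec z n h g = Matrix.vec n (\<lambda>\<xi>. lattice_coeff z n g (h \<xi>))"

definition discretized_solution ::
    "real \<Rightarrow> int ^ 'd \<Rightarrow> nat \<Rightarrow> (nat \<Rightarrow> int ^ 'd) \<Rightarrow> (real ^ 'd \<Rightarrow> complex) \<Rightarrow> (real ^ 'd \<Rightarrow> complex)
      \<Rightarrow> (real \<Rightarrow> complex Matrix.vec) \<Rightarrow> bool" where
  "discretized_solution \<gamma> z n h v g u \<longleftrightarrow>
     u 0 = initial_vec z n h g \<and>
     (\<forall>t\<ge>0. u t \<in> carrier_vec n \<and>
        (\<exists>u'\<in>carrier_vec n.
           (\<forall>\<xi><n. ((\<lambda>s. vec_index (u s) \<xi>) has_vector_derivative vec_index u' \<xi>)
                    (at t within {0..})) \<and>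
           (\<i> * complex_of_real \<gamma>) \<cdot>\<^sub>v u' =
             complex_of_real (\<gamma>\<^sup>2 / 2) \<cdot>\<^sub>v (D_mat n h *\<^sub>v u t) + W_mat n z v *\<^sub>v u t))"

subsection \<open>Exponential splittings\<close>

(* exp(b_1 B dt) exp(a_1 A dt) ... exp(b_s B dt) exp(a_s A dt), with a and b read at 1, ..., s *)
primrec splitting ::
    "nat \<Rightarrow> (nat \<Rightarrow> real) \<Rightarrow> (nat \<Rightarrow> real) \<Rightarrow> complex Matrix.mat \<Rightarrow> complex Matrix.mat \<Rightarrow> real
      \<Rightarrow> complex Matrix.mat" where
  "splitting 0 a b A B dt = 1\<^sub>m (dim_row A)"
| "splitting (Suc s) a b A B dt = splitting s a b A B dt *
     (mat_exp (complex_of_real (b (Suc s) * dt) \<cdot>\<^sub>m B) *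
      mat_exp (complex_of_real (a (Suc s) * dt) \<cdot>\<^sub>m A))"

(* The order is a property of the coefficients alone: the local error estimate holds, as dt
   tends to 0 from above, for all square matrices A, B and all starting vectors y. *)
definition splitting_order ::
    "nat \<Rightarrow> (nat \<Rightarrow> real) \<Rightarrow> (nat \<Rightarrow> real) \<Rightarrow> nat \<Rightarrow> bool" where
  "splitting_order s a b p \<longleftrightarrow>
     (\<forall>N. \<forall>A\<in>carrier_mat N N. \<forall>B\<in>carrier_mat N N. \<forall>y\<in>carrier_vec N.
        \<exists>C. \<forall>\<^sub>F dt in at_right 0.
          vnorm (splitting s a b A B dt *\<^sub>v y - mat_exp (complex_of_real dt \<cdot>\<^sub>m (A + B)) *\<^sub>v y)
            \<le> C * dt ^ (p + 1))"

definition splitting_approx ::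
    "nat \<Rightarrow> (nat \<Rightarrow> real) \<Rightarrow> (nat \<Rightarrow> real) \<Rightarrow> complex Matrix.mat \<Rightarrow> complex Matrix.mat \<Rightarrow> real
      \<Rightarrow> complex Matrix.vec \<Rightarrow> nat \<Rightarrow> complex Matrix.vec" where
  "splitting_approx s a b D W dt ua0 k =
     ((\<lambda>w. splitting s a b ((- \<i>) \<cdot>\<^sub>m D) ((- \<i>) \<cdot>\<^sub>m W) dt *\<^sub>v w) ^^ k) ua0"

end

theory Submission
  imports Defs "HOL-Library.Function_Algebras"
begin

text \<open>Let d_i be the diagonal entries of D and call the Euclidean norm of (D + I)^l y the level-l norm of
y. All constants must be independent of n although D is unbounded in n, so two facts about D and W
that hold uniformly carry the proof.

First, the entry W_ij is the sum of the Fourier coefficients of v over the frequencies k congruent to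
i - j (W_mat_aliasing, from fourier_inversion). If k is such a frequency, then h_j + k is a
candidate for h_i, and minimality of the anti-aliasing set gives
1 + d_i \<le> K (1 + |k|^2) (1 + d_j), see kinetic_comparison. So weights of i and j can be traded
for a weight of k, and \<alpha> > 2p + 1/2 is what makes the sum of |v^(k)| (1 + |k|^2)^p finite.
Schur's test then bounds W on the levels 0, ..., p, and it bounds the p-th commutator, whose entries
are (d_i - d_j)^p W_ij, from level p to level 0 (uniform_potential_bounds). The latter is the first
claim.

For the second claim the local error of one step of length \<tau> has to be at most a constant times
\<tau>^(p + 1) times the level-p norm. The order of the splitting says this only for fixed matrices
and small \<tau>, with a constant that depends on the matrices. It does imply that the Taylor
coefficients of the error of degree at most p vanish, for any two given matrices. This is used after
D has been cut off at frequency 1/\<tau>. The cut-off \<tau>D has norm at most 1, so the Taylor series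
of the error can be summed at \<tau>. Each remaining coefficient is a sum of words in D and W of
length m > p. The words in D alone cancel, because the order condition forces
a_1 + ... + a_s = 1. In the other words p letters are absorbed by the levels, and one letter W
supplies the missing power of \<tau> (taylor_pair, low_frequency_error).

It remains to undo the cut-off, which by itself would cost only \<tau>^p. Splitting and exact flow have
the same free evolution exp(-i\<tau>D), both before and after the cut-off, so it suffices to treat the
differences to the free evolution. Changing the cut-off in these leaves products with one factor
of size \<tau> from W and one of size \<tau>^p from the frequencies above 1/\<tau>. For the splitting
this is a calculation with products (trunc_quad), for the exact flow it follows from the energy
estimate (flow_truncation_error). Since D generates rotations and W is bounded, the local errors
add up to the global one (splitting_global_error).\<close>

section \<open>Matrices as arrays and weighted norms\<close>

text \<open>Sums and differences of arrays must stay intact as terms: matrix identities are proved from the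
laws of addition, and only the entrywise steps use f + g pointwise.\<close>

declare plus_fun_apply [simp del] zero_fun_apply [simp del] minus_apply [simp del]
lemmas fun_arith = plus_fun_apply zero_fun_apply minus_apply

text \<open>The size n varies under the constants to be found, so an n x n matrix is an array of which only the
entries below n matter. Unlike matrices with a carrier, arrays form an abelian group outright.\<close>

type_synonym cmatrix = "nat \<Rightarrow> nat \<Rightarrow> complex"

definition mapp :: "nat \<Rightarrow> cmatrix \<Rightarrow> (nat \<Rightarrow> complex) \<Rightarrow> nat \<Rightarrow> complex" where
  "mapp n M y = (\<lambda>i. \<Sum>j<n. M i j * y j)"

definition mmul :: "nat \<Rightarrow> cmatrix \<Rightarrow> cmatrix \<Rightarrow> cmatrix" where
  "mmul n A B = (\<lambda>i j. \<Sum>k<n. A i k * B k j)"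

definition diagm :: "(nat \<Rightarrow> complex) \<Rightarrow> cmatrix" where
  "diagm f = (\<lambda>i j. if i = j then f i else 0)"

definition scalem :: "complex \<Rightarrow> cmatrix \<Rightarrow> cmatrix" where
  "scalem c M = (\<lambda>i j. c * M i j)"

text \<open>With d the diagonal of D, level l of this scale of norms is the Euclidean norm of (D + I)^l y; the
level counts the powers of D that y can absorb.\<close>

definition wnorm :: "nat \<Rightarrow> (nat \<Rightarrow> real) \<Rightarrow> nat \<Rightarrow> (nat \<Rightarrow> complex) \<Rightarrow> real" where
  "wnorm n d l y = L2_set (\<lambda>i. (1 + d i) ^ l * cmod (y i)) {..<n}"

definition op_bound :: "nat \<Rightarrow> (nat \<Rightarrow> real) \<Rightarrow> nat \<Rightarrow> nat \<Rightarrow> real \<Rightarrow> cmatrix \<Rightarrow> bool" where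
  "op_bound n d l j c M \<longleftrightarrow> 0 \<le> c \<and> (\<forall>y. wnorm n d l (mapp n M y) \<le> c * wnorm n d j y)"

primrec mpow :: "nat \<Rightarrow> cmatrix \<Rightarrow> nat \<Rightarrow> cmatrix" where
  "mpow n M 0 = diagm (\<lambda>_. 1)"
| "mpow n M (Suc k) = mmul n M (mpow n M k)"

lemma mapp_mmul: "mapp n (mmul n A B) y = mapp n A (mapp n B y)"
proof
  fix i
  have "mapp n (mmul n A B) y i = (\<Sum>j<n. \<Sum>k<n. A i k * B k j * y j)"
    by (simp add: mapp_def mmul_def sum_distrib_right)
  also have "\<dots> = (\<Sum>k<n. \<Sum>j<n. A i k * B k j * y j)" by (rule sum.swap)
  finally show "mapp n (mmul n A B) y i = mapp n A (mapp n B y) i"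
    by (simp add: mapp_def sum_distrib_left mult.assoc)
qed

lemma mapp_diagm: "i < n \<Longrightarrow> mapp n (diagm f) y i = f i * y i"
  by (simp add: mapp_def diagm_def if_distrib [of "\<lambda>x. x * _"] cong: if_cong)

lemma mapp_add: "mapp n (A + B) y = mapp n A y + mapp n B y"
  by (simp add: mapp_def fun_eq_iff fun_arith distrib_right sum.distrib)
lemma mapp_diff: "mapp n (A - B) y = mapp n A y - mapp n B y"
  by (simp add: mapp_def fun_eq_iff fun_arith left_diff_distrib sum_subtractf)
lemma mapp_scalem: "mapp n (scalem c A) y = (\<lambda>i. c * mapp n A y i)"
  by (simp add: mapp_def scalem_def fun_eq_iff fun_arith sum_distrib_left mult.assoc)
lemma mapp_vdiff: "mapp n A (x - y) = mapp n A x - mapp n A y"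
  by (simp add: mapp_def fun_eq_iff fun_arith right_diff_distrib sum_subtractf)
lemma mmul_add_left: "mmul n (A + B) C = mmul n A C + mmul n B C"
  by (simp add: mmul_def fun_eq_iff fun_arith distrib_right sum.distrib)
lemma mmul_add_right: "mmul n C (A + B) = mmul n C A + mmul n C B"
  by (simp add: mmul_def fun_eq_iff fun_arith distrib_left sum.distrib)
lemma mmul_diff_left: "mmul n (A - B) C = mmul n A C - mmul n B C"
  by (simp add: mmul_def fun_eq_iff fun_arith left_diff_distrib sum_subtractf)
lemma mmul_diff_right: "mmul n C (A - B) = mmul n C A - mmul n C B"
  by (simp add: mmul_def fun_eq_iff fun_arith right_diff_distrib sum_subtractf)
lemmas mmul_algebra = mmul_add_left mmul_add_right mmul_diff_left mmul_diff_right

lemma sum_fun_apply: "(\<Sum>k\<in>K. f k) i = (\<Sum>k\<in>K. f k i)" for f :: "'a \<Rightarrow> 'b \<Rightarrow> 'c::comm_monoid_add"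
  by (induction K rule: infinite_finite_induct) (auto simp: fun_arith)

lemma wnorm_nonneg [simp]: "0 \<le> wnorm n d l y"
  by (simp add: wnorm_def)

lemma wnorm_cong: "(\<And>i. i < n \<Longrightarrow> y i = z i) \<Longrightarrow> wnorm n d l y = wnorm n d l z"
  unfolding wnorm_def by (rule L2_set_cong) auto

lemma op_bound_cong:
  assumes "\<And>i j. i < n \<Longrightarrow> j < n \<Longrightarrow> M i j = M' i j"
  shows "op_bound n d l j c M \<longleftrightarrow> op_bound n d l j c M'"
proof -
  have "wnorm n d l (mapp n M y) = wnorm n d l (mapp n M' y)" for y
    by (rule wnorm_cong) (auto simp: mapp_def assms)
  then show ?thesis by (simp add: op_bound_def)
qed

lemma op_bound_D: "op_bound n d l j c M \<Longrightarrow> wnorm n d l (mapp n M y) \<le> c * wnorm n d j y"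
  by (simp add: op_bound_def)

lemma op_bound_mmul: "op_bound n d l q c A \<Longrightarrow> op_bound n d q j c' B \<Longrightarrow> op_bound n d l j (c * c') (mmul n A B)"
  unfolding op_bound_def mapp_mmul
  by (auto intro!: mult_nonneg_nonneg)
     (metis mult.assoc mult_left_mono order_trans)

locale weighted =
  fixes n :: nat and d :: "nat \<Rightarrow> real"
  assumes d_nonneg: "0 \<le> d i"
begin

lemma wnorm_mono_term:
  assumes "\<And>i. i < n \<Longrightarrow> (1 + d i) ^ l * cmod (y i) \<le> c * ((1 + d i) ^ j * cmod (z i))" "0 \<le> c"
  shows "wnorm n d l y \<le> c * wnorm n d j z"
proof -
  have "wnorm n d l y \<le> L2_set (\<lambda>i. c * ((1 + d i) ^ j * cmod (z i))) {..<n}"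
    unfolding wnorm_def by (rule L2_set_mono) (use assms d_nonneg in auto)
  also have "\<dots> = c * wnorm n d j z"
    unfolding wnorm_def using assms by (simp add: L2_set_right_distrib)
  finally show ?thesis .
qed

lemma wnorm_triangle: "wnorm n d l (y + z) \<le> wnorm n d l y + wnorm n d l z"
proof -
  have "wnorm n d l (y + z) \<le> L2_set (\<lambda>i. (1 + d i) ^ l * cmod (y i) + (1 + d i) ^ l * cmod (z i)) {..<n}"
    unfolding wnorm_def
    by (rule L2_set_mono)
      (use d_nonneg in \<open>auto simp: fun_arith intro!: mult_left_mono norm_triangle_ineq simp flip: distrib_left\<close>)
  also have "\<dots> \<le> wnorm n d l y + wnorm n d l z"
    unfolding wnorm_def by (rule L2_set_triangle_ineq)
  finally show ?thesis .
qed

lemma wnorm_minus: "wnorm n d l (- y) = wnorm n d l y"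
  by (simp add: wnorm_def)

lemma wnorm_diff: "wnorm n d l (y - z) \<le> wnorm n d l y + wnorm n d l z"
  using wnorm_triangle[of l y "- z"] by (simp add: wnorm_minus)

lemma wnorm_zero [simp]: "wnorm n d l 0 = 0"
  by (simp add: wnorm_def L2_set_def fun_arith)

lemma wnorm_sum: "wnorm n d l (\<Sum>k\<in>K. f k) \<le> (\<Sum>k\<in>K. wnorm n d l (f k))"
proof (induction K rule: infinite_finite_induct)
  case (insert x F)
  show ?case using wnorm_triangle[of l "f x" "sum f F"] insert(3)
    unfolding sum.insert[OF insert(1,2)] by linarith
qed (simp_all add: wnorm_def L2_set_def fun_arith)

lemma wnorm_scale: "wnorm n d l (\<lambda>i. c * y i) = cmod c * wnorm n d l y"
  unfolding wnorm_def by (subst L2_set_right_distrib) (auto simp: norm_mult mult_ac)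

lemma wnorm_mono: "l \<le> j \<Longrightarrow> wnorm n d l y \<le> wnorm n d j y"
  unfolding wnorm_def
  by (rule L2_set_mono) (use d_nonneg in \<open>auto intro!: mult_right_mono power_increasing\<close>)

lemma component_le_wnorm: "i < n \<Longrightarrow> cmod (y i) \<le> wnorm n d l y"
proof -
  assume i: "i < n"
  have "1 * cmod (y i) \<le> (1 + d i) ^ l * cmod (y i)"
    by (rule mult_right_mono) (use d_nonneg in auto)
  also have "\<dots> \<le> wnorm n d l y"
    unfolding wnorm_def
    by (rule member_le_L2_set[of "{..<n}" i "\<lambda>i. (1 + d i) ^ l * cmod (y i)"]) (use i in auto)
  finally show ?thesis by simp
qed

lemma op_bound_mono:
  assumes "op_bound n d l j c M" "c \<le> c'" "l' \<le> l" "j \<le> j'"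
  shows "op_bound n d l' j' c' M"
proof -
  have c: "0 \<le> c" using assms by (simp add: op_bound_def)
  have "wnorm n d l' (mapp n M y) \<le> c' * wnorm n d j' y" for y
  proof -
    have "wnorm n d l' (mapp n M y) \<le> wnorm n d l (mapp n M y)" using assms by (intro wnorm_mono)
    also have "\<dots> \<le> c * wnorm n d j y" using assms by (simp add: op_bound_def)
    also have "\<dots> \<le> c' * wnorm n d j' y"
      using assms c by (intro mult_mono wnorm_mono) auto
    finally show ?thesis .
  qed
  with assms c show ?thesis by (auto simp: op_bound_def)
qed

lemma op_bound_add: "op_bound n d l j c A \<Longrightarrow> op_bound n d l j c' B \<Longrightarrow> op_bound n d l j (c + c') (A + B)"
  unfolding op_bound_def mapp_add distrib_right
  by (auto intro: order_trans[OF wnorm_triangle] add_mono)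

lemma op_bound_diff: "op_bound n d l j c A \<Longrightarrow> op_bound n d l j c' B \<Longrightarrow> op_bound n d l j (c + c') (A - B)"
  unfolding op_bound_def mapp_diff distrib_right
  by (auto intro: order_trans[OF wnorm_diff] add_mono)

lemma op_bound_scalem: "op_bound n d l j c A \<Longrightarrow> op_bound n d l j (cmod a * c) (scalem a A)"
  unfolding op_bound_def mapp_scalem wnorm_scale by (auto simp: mult.assoc intro: mult_left_mono)

lemma op_bound_sum: 
  assumes "\<And>k. k \<in> K \<Longrightarrow> op_bound n d l j (c k) (A k)"
  shows "op_bound n d l j (\<Sum>k\<in>K. c k) (\<Sum>k\<in>K. A k)"
  using assms
proof (induction K rule: infinite_finite_induct)
  case (insert x F)
  show ?case unfolding sum.insert[OF insert(1,2)] by (rule op_bound_add) (use insert in auto)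
qed (simp_all add: fun_arith op_bound_def mapp_def wnorm_def L2_set_def)

lemma op_bound_zero: "0 \<le> c \<Longrightarrow> op_bound n d l j c 0"
  by (auto simp: fun_arith op_bound_def mapp_def wnorm_def L2_set_def intro!: mult_nonneg_nonneg sum_nonneg)

lemma op_bound_diagm:
  assumes "\<And>i. i < n \<Longrightarrow> (1 + d i) ^ l * cmod (f i) \<le> c * (1 + d i) ^ j" "0 \<le> c"
  shows "op_bound n d l j c (diagm f)"
  unfolding op_bound_def
proof (intro conjI allI)
  fix y
  show "wnorm n d l (mapp n (diagm f) y) \<le> c * wnorm n d j y"
  proof (rule wnorm_mono_term)
    fix i assume i: "i < n"
    show "(1 + d i) ^ l * cmod (mapp n (diagm f) y i) \<le> c * ((1 + d i) ^ j * cmod (y i))"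
      using mult_right_mono[OF assms(1)[OF i], of "cmod (y i)"] i
      by (simp add: mapp_diagm norm_mult mult.assoc)
  qed fact
qed fact

lemma op_bound_exists: "\<exists>c. op_bound n d 0 0 c M"
proof -
  define c where "c = (\<Sum>j<n. wnorm n d 0 (\<lambda>i. M i j))"
  have "wnorm n d 0 (mapp n M y) \<le> c * wnorm n d 0 y" for y
  proof -
    have "wnorm n d 0 (mapp n M y) = wnorm n d 0 (\<Sum>j<n. (\<lambda>i. y j * M i j))"
      by (rule wnorm_cong) (simp add: mapp_def sum_fun_apply mult.commute)
    also have "\<dots> \<le> (\<Sum>j<n. wnorm n d 0 (\<lambda>i. y j * M i j))" by (rule wnorm_sum)
    also have "\<dots> \<le> (\<Sum>j<n. wnorm n d 0 (\<lambda>i. M i j) * wnorm n d 0 y)"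
      by (intro sum_mono) (auto simp: wnorm_scale mult.commute intro!: mult_right_mono component_le_wnorm)
    finally show ?thesis by (simp add: c_def sum_distrib_right)
  qed
  moreover have "0 \<le> c" by (simp add: c_def sum_nonneg)
  ultimately show ?thesis by (auto simp: op_bound_def)
qed

lemma entry_le_op_bound:
  assumes "op_bound n d 0 0 c M" "i < n" "j < n"
  shows "cmod (M i j) \<le> c"
proof -
  define y where "y = (\<lambda>k. if k = j then 1 else 0 :: complex)"
  have "mapp n M y i = M i j" using assms by (simp add: mapp_def y_def if_distrib cong: if_cong)
  then have "cmod (M i j) \<le> wnorm n d 0 (mapp n M y)"
    using component_le_wnorm[OF assms(2), of "mapp n M y" 0] by simp
  also have "\<dots> \<le> c * wnorm n d 0 y" using assms by (simp add: op_bound_def)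
  also have "wnorm n d 0 y = 1"
  proof -
    have "wnorm n d 0 y = sqrt (\<Sum>i<n. if i = j then 1 else 0)"
      unfolding wnorm_def L2_set_def y_def by (intro arg_cong[of _ _ sqrt] sum.cong) auto
    with assms show ?thesis by simp
  qed
  finally show ?thesis by simp
qed

text \<open>The norm is continuous in its finitely many components, so bounds pass from the partial sums to the
limit. This is how bounds on Taylor coefficients become bounds on matrix functions.\<close>

lemma wnorm_sums_le:
  assumes sums: "\<And>i. i < n \<Longrightarrow> (\<lambda>m. f m i) sums F i"
    and le: "\<And>m. wnorm n d l (f m) \<le> k m" and k: "summable k"
  shows "wnorm n d l F \<le> suminf k"
proof -
  have k0: "0 \<le> k m" for m using le[of m] wnorm_nonneg[of n d l "f m"] by linarith
  have "(\<lambda>N. wnorm n d l (\<lambda>i. \<Sum>m<N. f m i)) \<longlonglongrightarrow> wnorm n d l F"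
    unfolding wnorm_def L2_set_def
    by (intro tendsto_intros) (use sums in \<open>auto simp: sums_def\<close>)
  moreover have "wnorm n d l (\<lambda>i. \<Sum>m<N. f m i) \<le> suminf k" for N
  proof -
    have "wnorm n d l (\<lambda>i. \<Sum>m<N. f m i) = wnorm n d l (\<Sum>m<N. f m)"
      by (rule wnorm_cong) (simp add: sum_fun_apply)
    also have "\<dots> \<le> (\<Sum>m<N. wnorm n d l (f m))" by (rule wnorm_sum)
    also have "\<dots> \<le> (\<Sum>m<N. k m)" by (intro sum_mono le)
    also have "\<dots> \<le> suminf k" using k k0 by (intro sum_le_suminf) auto
    finally show ?thesis .
  qed
  ultimately show ?thesis by (intro LIMSEQ_le_const2) auto
qed

lemma op_bound_sums:
  assumes sums: "\<And>i j. i < n \<Longrightarrow> j < n \<Longrightarrow> (\<lambda>m. c m i j) sums M i j"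
    and le: "\<And>m. op_bound n d l q (k m) (c m)" and k: "k sums K"
  shows "op_bound n d l q K M"
  unfolding op_bound_def
proof (intro conjI allI)
  show "0 \<le> K" using k le by (auto simp: op_bound_def intro: sums_le[OF _ sums_zero k])
  fix y
  have "wnorm n d l (mapp n M y) \<le> (\<Sum>m. k m * wnorm n d q y)"
  proof (rule wnorm_sums_le)
    show "(\<lambda>m. mapp n (c m) y i) sums mapp n M y i" if "i < n" for i
      unfolding mapp_def using that by (intro sums_sum sums_mult2 sums) auto
    show "wnorm n d l (mapp n (c m) y) \<le> k m * wnorm n d q y" for m
      using le by (simp add: op_bound_def)
    show "summable (\<lambda>m. k m * wnorm n d q y)"
      using k by (intro summable_mult2) (auto simp: sums_iff)
  qed
  also have "\<dots> = K * wnorm n d q y"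
    using k by (simp add: sums_iff suminf_mult2[symmetric])
  finally show "wnorm n d l (mapp n M y) \<le> K * wnorm n d q y" .
qed

end

section \<open>Power series of matrices\<close>

text \<open>An entire matrix function of a real variable, given by its Taylor coefficients.\<close>

definition mat_series :: "nat \<Rightarrow> (real \<Rightarrow> cmatrix) \<Rightarrow> (nat \<Rightarrow> cmatrix) \<Rightarrow> bool" where
  "mat_series n F c \<longleftrightarrow> (\<forall>\<sigma> i j. i < n \<longrightarrow> j < n \<longrightarrow> (\<lambda>m. c m i j * of_real \<sigma> ^ m) sums F \<sigma> i j)"

definition mat_conv :: "nat \<Rightarrow> (nat \<Rightarrow> cmatrix) \<Rightarrow> (nat \<Rightarrow> cmatrix) \<Rightarrow> nat \<Rightarrow> cmatrix" where
  "mat_conv n c c' m = (\<Sum>k\<le>m. mmul n (c k) (c' (m - k)))"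

definition exp_coeff :: "nat \<Rightarrow> cmatrix \<Rightarrow> nat \<Rightarrow> cmatrix" where
  "exp_coeff n M m = scalem (1 / fact m) (mpow n M m)"

definition mexp :: "nat \<Rightarrow> cmatrix \<Rightarrow> real \<Rightarrow> cmatrix" where
  "mexp n M \<sigma> = (\<lambda>i j. \<Sum>m. exp_coeff n M m i j * of_real \<sigma> ^ m)"

lemma powser_real_summable:
  fixes c :: "nat \<Rightarrow> complex"
  assumes "\<And>\<sigma>::real. summable (\<lambda>m. c m * of_real \<sigma> ^ m)"
  shows "summable (\<lambda>m. norm (c m * z ^ m))"
proof (rule powser_insidea)
  show "summable (\<lambda>m. c m * of_real (norm z + 1) ^ m)" by (rule assms)
  show "norm z < norm (complex_of_real (norm z + 1))" by (simp del: of_real_add)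
qed

lemma mat_seriesD: "mat_series n F c \<Longrightarrow> i < n \<Longrightarrow> j < n \<Longrightarrow> (\<lambda>m. c m i j * of_real \<sigma> ^ m) sums F \<sigma> i j"
  by (simp add: mat_series_def)

lemma mat_series_summable: "mat_series n F c \<Longrightarrow> i < n \<Longrightarrow> j < n \<Longrightarrow> summable (\<lambda>m. norm (c m i j * z ^ m))"
  by (rule powser_real_summable) (auto dest: mat_seriesD sums_summable)

lemma mat_series_conv:
  assumes F: "mat_series n F c" and G: "mat_series n G c'"
  shows "mat_series n (\<lambda>\<sigma>. mmul n (F \<sigma>) (G \<sigma>)) (mat_conv n c c')"
  unfolding mat_series_def
proof (intro allI impI)
  fix \<sigma> :: real and i j assume i: "i < n" and j: "j < n"
  let ?s = "complex_of_real \<sigma>"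
  have "(\<lambda>m. \<Sum>k\<le>m. (c k i l * ?s ^ k) * (c' (m - k) l j * ?s ^ (m - k))) sums (F \<sigma> i l * G \<sigma> l j)"
    if l: "l < n" for l
    using Cauchy_product_sums[OF mat_series_summable[OF F i l, of ?s] mat_series_summable[OF G l j, of ?s]]
      mat_seriesD[OF F i l, of \<sigma>] mat_seriesD[OF G l j, of \<sigma>] by (simp add: sums_iff)
  then have "(\<lambda>m. \<Sum>l<n. \<Sum>k\<le>m. (c k i l * ?s ^ k) * (c' (m - k) l j * ?s ^ (m - k)))
      sums (\<Sum>l<n. F \<sigma> i l * G \<sigma> l j)"
    by (intro sums_sum) auto
  moreover have "(\<Sum>l<n. \<Sum>k\<le>m. (c k i l * ?s ^ k) * (c' (m - k) l j * ?s ^ (m - k)))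
      = mat_conv n c c' m i j * ?s ^ m" for m
  proof -
    have "(\<Sum>l<n. \<Sum>k\<le>m. (c k i l * ?s ^ k) * (c' (m - k) l j * ?s ^ (m - k)))
       = (\<Sum>l<n. \<Sum>k\<le>m. c k i l * c' (m - k) l j * ?s ^ m)"
      by (intro sum.cong refl) (simp add: mult_ac flip: power_add)
    also have "\<dots> = (\<Sum>k\<le>m. \<Sum>l<n. c k i l * c' (m - k) l j * ?s ^ m)" by (rule sum.swap)
    also have "\<dots> = mat_conv n c c' m i j * ?s ^ m"
      by (simp add: mat_conv_def mmul_def sum_fun_apply sum_distrib_right)
    finally show ?thesis .
  qed
  ultimately show "(\<lambda>m. mat_conv n c c' m i j * ?s ^ m) sums mmul n (F \<sigma>) (G \<sigma>) i j"
    by (simp add: mmul_def)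
qed

lemma mat_series_diff: "mat_series n F c \<Longrightarrow> mat_series n G c' \<Longrightarrow> mat_series n (\<lambda>\<sigma>. F \<sigma> - G \<sigma>) (\<lambda>m. c m - c' m)"
  by (auto simp: mat_series_def fun_arith left_diff_distrib intro!: sums_diff)

lemma mat_series_const: "mat_series n (\<lambda>_. M) (\<lambda>m. if m = 0 then M else 0)"
  unfolding mat_series_def
proof (intro allI impI)
  fix \<sigma> :: real and i j
  show "(\<lambda>m. (if m = 0 then M else 0) i j * of_real \<sigma> ^ m) sums M i j"
    using sums_single[of 0 "\<lambda>m. M i j * of_real \<sigma> ^ m"]
    by (simp add: fun_arith if_distrib[of "\<lambda>x. x i j * _"] cong: if_cong)
qed

lemma (in weighted) op_bound_one: "op_bound n d l l 1 (diagm (\<lambda>_. 1))"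
  by (rule op_bound_diagm) auto

lemma (in weighted) op_bound_mpow: "op_bound n d l l c M \<Longrightarrow> op_bound n d l l (c ^ m) (mpow n M m)"
  by (induction m) (auto intro: op_bound_one op_bound_mmul)

lemma mat_series_mexp: "mat_series n (mexp n M) (exp_coeff n M)"
  unfolding mat_series_def
proof (intro allI impI)
  fix \<sigma> :: real and i j assume i: "i < n" and j: "j < n"
  interpret weighted n "\<lambda>_. 0" by unfold_locales simp
  obtain c where c: "op_bound n (\<lambda>_. 0) 0 0 c M" using op_bound_exists by blast
  have "summable (\<lambda>m. exp_coeff n M m i j * of_real \<sigma> ^ m)"
  proof (rule summable_comparison_test')
    show "summable (\<lambda>m. inverse (fact m) * (c * \<bar>\<sigma>\<bar>) ^ m)" by (rule summable_exp)
    fix m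
    have "cmod (mpow n M m i j) \<le> c ^ m"
      by (rule entry_le_op_bound[OF op_bound_mpow[OF c] i j])
    then have "cmod (mpow n M m i j) * \<bar>\<sigma>\<bar> ^ m / fact m \<le> c ^ m * \<bar>\<sigma>\<bar> ^ m / fact m"
      by (intro divide_right_mono mult_right_mono) auto
    then show "norm (exp_coeff n M m i j * of_real \<sigma> ^ m) \<le> inverse (fact m) * (c * \<bar>\<sigma>\<bar>) ^ m"
      by (simp add: exp_coeff_def scalem_def norm_mult norm_divide norm_power power_mult_distrib field_simps)
  qed
  then show "(\<lambda>m. exp_coeff n M m i j * of_real \<sigma> ^ m) sums mexp n M \<sigma> i j"
    by (simp add: mexp_def summable_sums)
qed

lemma diagm_apply: "diagm f i j = (if i = j then f i else 0)"
  by (simp add: diagm_def)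

lemma mpow_diagm: "i < n \<Longrightarrow> j < n \<Longrightarrow> mpow n (diagm f) m i j = diagm (\<lambda>i. f i ^ m) i j"
proof (induction m arbitrary: i j)
  case (Suc m)
  have "mpow n (diagm f) (Suc m) i j = (\<Sum>k<n. diagm f i k * diagm (\<lambda>i. f i ^ m) k j)"
    using Suc by (simp add: mmul_def)
  also have "\<dots> = (\<Sum>k<n. if k = i then f i * diagm (\<lambda>i. f i ^ m) i j else 0)"
    by (rule sum.cong) (auto simp: diagm_def)
  finally show ?case using Suc.prems by (simp add: diagm_def)
qed auto

lemma mexp_diagm: "i < n \<Longrightarrow> j < n \<Longrightarrow> mexp n (diagm f) \<sigma> i j = diagm (\<lambda>i. exp (of_real \<sigma> * f i)) i j"
proof -
  assume ij: "i < n" "j < n"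
  have "(\<lambda>m. exp_coeff n (diagm f) m i j * of_real \<sigma> ^ m) sums diagm (\<lambda>i. exp (of_real \<sigma> * f i)) i j"
  proof (cases "i = j")
    case True
    have "(\<lambda>m. (of_real \<sigma> * f i) ^ m /\<^sub>R fact m) sums exp (of_real \<sigma> * f i)" by (rule exp_converges)
    with True ij show ?thesis
      by (simp add: exp_coeff_def scalem_def mpow_diagm diagm_apply scaleR_conv_of_real field_simps)
  next
    case False
    with ij show ?thesis by (simp add: exp_coeff_def scalem_def mpow_diagm diagm_apply)
  qed
  then show ?thesis by (simp add: mexp_def sums_iff)
qed

text \<open>Removing the first m terms, which vanish by induction, leaves a factor \<sigma>^m times a series
that tends to c m, whereas the bound makes it tend to 0. This is the only way in which the order of
a splitting is used: it speaks about fixed matrices and \<sigma> tending to 0, and so says that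
Taylor coefficients vanish.\<close>

lemma powser_coeff_zero:
  fixes c :: "nat \<Rightarrow> complex" and f :: "real \<Rightarrow> complex"
  assumes sums: "\<And>\<sigma>. (\<lambda>m. c m * of_real \<sigma> ^ m) sums f \<sigma>"
    and small: "\<forall>\<^sub>F \<sigma> in at_right 0. norm (f \<sigma>) \<le> C * \<sigma> ^ (p + 1)"
  shows "m \<le> p \<Longrightarrow> c m = 0"
proof (induction m rule: less_induct)
  case (less m)
  define g where "g = (\<lambda>z. \<Sum>k. c (k + m) * z ^ k)"
  have sm: "summable (\<lambda>k. c k * z ^ k)" for z
    by (rule summable_norm_cancel, rule powser_real_summable) (use sums in \<open>auto simp: sums_iff\<close>)
  have smm: "summable (\<lambda>k. c (k + m) * z ^ k)" for z
  proof (cases "z = 0")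
    case False
    have "summable (\<lambda>k. c (k + m) * z ^ (k + m) * inverse (z ^ m))"
      by (intro summable_mult2) (use sm[of z] in \<open>subst summable_iff_shift[of "\<lambda>k. c k * z ^ k" m]\<close>)
    with False show ?thesis by (simp add: power_add field_simps)
  qed simp
  have "(g \<longlongrightarrow> c (0 + m)) (at 0)"
    by (rule powser_limit_0[where s = 1]) (use smm in \<open>auto simp: g_def summable_sums\<close>)
  then have lim: "((\<lambda>\<sigma>::real. g (of_real \<sigma>)) \<longlongrightarrow> c m) (at_right 0)"
  proof -
    have "filterlim complex_of_real (at 0) (at_right 0)"
      by (auto simp: filterlim_at eventually_at_filter intro!: tendsto_eq_intros)
    with \<open>(g \<longlongrightarrow> c (0 + m)) (at 0)\<close> show ?thesis by (simp add: filterlim_compose)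
  qed
  have fg: "f \<sigma> = of_real \<sigma> ^ m * g (of_real \<sigma>)" for \<sigma>
  proof -
    have "f \<sigma> = (\<Sum>k. c (k + m) * of_real \<sigma> ^ (k + m)) + (\<Sum>k<m. c k * of_real \<sigma> ^ k)"
      using sums[of \<sigma>] suminf_split_initial_segment[OF sm[of "of_real \<sigma>"], of m] by (simp add: sums_iff)
    also have "(\<Sum>k<m. c k * of_real \<sigma> ^ k) = 0"
      using less by (intro sum.neutral) auto
    also have "(\<Sum>k. c (k + m) * of_real \<sigma> ^ (k + m)) = (\<Sum>k. of_real \<sigma> ^ m * (c (k + m) * of_real \<sigma> ^ k))"
      by (simp add: power_add mult_ac)
    also have "\<dots> = of_real \<sigma> ^ m * g (of_real \<sigma>)"
      unfolding g_def by (rule suminf_mult[OF smm])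
    finally show ?thesis by simp
  qed
  have "\<forall>\<^sub>F \<sigma> in at_right 0. norm (g (of_real \<sigma>)) \<le> C * \<sigma> ^ (p + 1 - m)"
    using small eventually_at_right_less[of "0::real"]
  proof eventually_elim
    case (elim \<sigma>)
    have "\<sigma> ^ m * norm (g (of_real \<sigma>)) \<le> \<sigma> ^ m * (C * \<sigma> ^ (p + 1 - m))"
      using elim less.prems by (simp add: fg norm_mult norm_power power_add[symmetric] mult_ac)
    then show ?case using elim by simp
  qed
  moreover have "((\<lambda>\<sigma>::real. C * \<sigma> ^ (p + 1 - m)) \<longlongrightarrow> C * 0 ^ (p + 1 - m)) (at_right 0)"
    by (intro tendsto_intros)
  then have "((\<lambda>\<sigma>::real. C * \<sigma> ^ (p + 1 - m)) \<longlongrightarrow> 0) (at_right 0)"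
    using less.prems by (simp add: power_0_left)
  ultimately have "((\<lambda>\<sigma>::real. g (of_real \<sigma>)) \<longlongrightarrow> 0) (at_right 0)"
    by (rule Lim_null_comparison)
  from tendsto_unique[OF _ this lim] show "c m = 0" by simp
qed

section \<open>Taylor coefficients on low frequencies\<close>

text \<open>P and E are the Taylor coefficients of a product of exponentials and of the same product without
the potential. The pair records how many powers of \<tau> the i-th coefficient is worth on low
frequencies, where D is at most 1/\<tau> in norm. Each factor D can either be absorbed by one level
of the norm, or be bounded by 1/\<tau>; the second choice costs one power of \<tau> against the
\<tau>^i that accompanies the coefficient, the first does not. Hence the gain \<tau>^(j - l) when
j - l levels are spent. In P i - E i the words in D alone cancel, so a bounded factor W occurs as
well, and one further power is gained. The constant K is of the order of
1/\<tau>, so K^i \<tau>^i / i! is summable, and factors of this form reproduce themselves under products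
by the binomial theorem.\<close>

definition taylor_pair ::
  "nat \<Rightarrow> (nat \<Rightarrow> real) \<Rightarrow> nat \<Rightarrow> real \<Rightarrow> real \<Rightarrow> (nat \<Rightarrow> cmatrix) \<Rightarrow> (nat \<Rightarrow> cmatrix) \<Rightarrow> bool" where
  "taylor_pair n d p \<tau> K P E \<longleftrightarrow> 0 \<le> K \<and> 0 < \<tau> \<and> P 0 = E 0 \<and>
     (\<forall>i l j. l \<le> j \<longrightarrow> j \<le> p \<longrightarrow> j \<le> l + i \<longrightarrow>
        op_bound n d l j (K ^ i / fact i * \<tau> ^ (j - l)) (P i) \<and>
        op_bound n d l j (K ^ i / fact i * \<tau> ^ (j - l)) (E i)) \<and>
     (\<forall>i l j. l \<le> j \<longrightarrow> j \<le> p \<longrightarrow> j + 1 \<le> l + i \<longrightarrow>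
        op_bound n d l j (K ^ i / fact i * \<tau> ^ (j - l + 1)) (P i - E i))"

text \<open>The binomial theorem in the form in which it combines the constants of two factors.\<close>

lemma exp_coeff_convolution:
  fixes K K' :: real
  shows "(\<Sum>k\<le>i. K ^ k / fact k * (K' ^ (i - k) / fact (i - k))) = (K + K') ^ i / fact i"
  using exp_series_add_commuting[of K K' i] by (simp add: field_simps)

lemma mat_conv_diff:
  "mat_conv n P P' i - mat_conv n E E' i
     = (\<Sum>k\<le>i. mmul n (P k - E k) (P' (i - k))) + (\<Sum>k\<le>i. mmul n (E k) (P' (i - k) - E' (i - k)))"
  unfolding mat_conv_def mmul_algebra by (simp add: fun_eq_iff fun_arith sum_fun_apply sum_subtractf)

context weighted
begin

lemma mat_conv_bound:
  assumes "\<And>k. k \<le> i \<Longrightarrow> op_bound n d l j (c k * g) (mmul n (A k) (B (i - k)))"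
  shows "op_bound n d l j ((\<Sum>k\<le>i. c k) * g) (\<Sum>k\<le>i. mmul n (A k) (B (i - k)))"
  unfolding sum_distrib_right by (rule op_bound_sum) (use assms in auto)

text \<open>Write P P' - E E' = (P - E) P' + E (P' - E'). In each term of the convolution the levels are split
at an intermediate level chosen as large as the left factor allows; the extra power of \<tau> comes
from the factor that is a difference. The doubling of K accounts for the two summands.\<close>

lemma taylor_pair_conv:
  assumes 1: "taylor_pair n d p \<tau> K P E" and 2: "taylor_pair n d p \<tau> K' P' E'"
  shows "taylor_pair n d p \<tau> (2 * (K + K')) (mat_conv n P P') (mat_conv n E E')"
proof -
  have K: "0 \<le> K" "0 \<le> K'" "0 < \<tau>" and zero: "P 0 = E 0" "P' 0 = E' 0"
    using 1 2 by (auto simp: taylor_pair_def)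
  have bd: "op_bound n d l j (K ^ i / fact i * \<tau> ^ (j - l)) (P i)"
      "op_bound n d l j (K ^ i / fact i * \<tau> ^ (j - l)) (E i)"
      "op_bound n d l j (K' ^ i / fact i * \<tau> ^ (j - l)) (P' i)"
      "op_bound n d l j (K' ^ i / fact i * \<tau> ^ (j - l)) (E' i)"
    if "l \<le> j" "j \<le> p" "j \<le> l + i" for i l j
    using 1 2 that unfolding taylor_pair_def by blast+
  have bdiff: "op_bound n d l j (K ^ i / fact i * \<tau> ^ (j - l + 1)) (P i - E i)"
      "op_bound n d l j (K' ^ i / fact i * \<tau> ^ (j - l + 1)) (P' i - E' i)"
    if "l \<le> j" "j \<le> p" "j + 1 \<le> l + i" for i l j
    using 1 2 that unfolding taylor_pair_def by blast+
  define w where "w = (\<lambda>i k. K ^ k / fact k * (K' ^ (i - k) / fact (i - k)))"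
  have w_sum: "(\<Sum>k\<le>i. w i k) = (K + K') ^ i / fact i" for i
    unfolding w_def by (rule exp_coeff_convolution)
  have w0: "0 \<le> w i k" for i k using K by (auto simp: w_def)
  have prod: "op_bound n d l j (w i k * \<tau> ^ r) (mmul n A B)"
    if "op_bound n d l q (K ^ k / fact k * \<tau> ^ r1) A" "op_bound n d q j (K' ^ (i - k) / fact (i - k) * \<tau> ^ r2) B"
      "r1 + r2 = r" for i k l q j r1 r2 r A B
  proof -
    have "w i k * \<tau> ^ r = K ^ k / fact k * \<tau> ^ r1 * (K' ^ (i - k) / fact (i - k) * \<tau> ^ r2)"
      by (simp add: w_def power_add flip: that(3))
    then show ?thesis using op_bound_mmul[OF that(1,2)] by simp
  qed
  have main: "op_bound n d l j ((K + K') ^ i / fact i * \<tau> ^ (j - l)) (mat_conv n Q Q' i)"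
    if l: "l \<le> j" "j \<le> p" "j \<le> l + i" and Q: "Q = P \<or> Q = E" "Q' = P' \<or> Q' = E'" for i l j Q Q'
    unfolding mat_conv_def w_sum[symmetric]
  proof (rule mat_conv_bound)
    fix k assume k: "k \<le> i"
    show "op_bound n d l j (w i k * \<tau> ^ (j - l)) (mmul n (Q k) (Q' (i - k)))"
    proof (rule prod[where q = "min j (l + k)"])
      show "op_bound n d l (min j (l + k)) (K ^ k / fact k * \<tau> ^ (min j (l + k) - l)) (Q k)"
        using Q(1) by (elim disjE; simp only:) (rule bd; use l in auto)+
      show "op_bound n d (min j (l + k)) j (K' ^ (i - k) / fact (i - k) * \<tau> ^ (j - min j (l + k))) (Q' (i - k))"
        using Q(2) by (elim disjE; simp only:) (rule bd; use l k in auto)+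
    qed (use l in auto)
  qed
  have diff: "op_bound n d l j ((2 * (K + K')) ^ i / fact i * \<tau> ^ (j - l + 1)) (mat_conv n P P' i - mat_conv n E E' i)"
    if l: "l \<le> j" "j \<le> p" "j + 1 \<le> l + i" for i l j
  proof (rule op_bound_mono)
    have c0: "0 \<le> w i k * \<tau> ^ (j - l + 1)" for k using w0 K by auto
    show "op_bound n d l j ((\<Sum>k\<le>i. w i k) * \<tau> ^ (j - l + 1) + (\<Sum>k\<le>i. w i k) * \<tau> ^ (j - l + 1))
        (mat_conv n P P' i - mat_conv n E E' i)"
      unfolding mat_conv_diff
    proof (intro op_bound_add mat_conv_bound)
      fix k assume k: "k \<le> i"
      show "op_bound n d l j (w i k * \<tau> ^ (j - l + 1)) (mmul n (P k - E k) (P' (i - k)))"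
      proof (cases "k = 0")
        case True
        then have "mmul n (P k - E k) (P' (i - k)) = 0" by (simp add: zero mmul_def fun_eq_iff fun_arith)
        then show ?thesis using c0 by (simp add: op_bound_zero)
      next
        case False
        show ?thesis
        proof (rule prod[where q = "min j (l + k - 1)"])
          show "op_bound n d l (min j (l + k - 1)) (K ^ k / fact k * \<tau> ^ (min j (l + k - 1) - l + 1)) (P k - E k)"
            by (rule bdiff) (use l False in auto)
          show "op_bound n d (min j (l + k - 1)) j
              (K' ^ (i - k) / fact (i - k) * \<tau> ^ (j - min j (l + k - 1))) (P' (i - k))"
            by (rule bd) (use l k False in auto)
        qed (use l False in auto)
      qed
      show "op_bound n d l j (w i k * \<tau> ^ (j - l + 1)) (mmul n (E k) (P' (i - k) - E' (i - k)))"
      proof (cases "i = k")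
        case True
        then have "mmul n (E k) (P' (i - k) - E' (i - k)) = 0" by (simp add: zero mmul_def fun_eq_iff fun_arith)
        then show ?thesis using c0 by (simp add: op_bound_zero)
      next
        case False
        show ?thesis
        proof (rule prod[where q = "min j (l + k)"])
          show "op_bound n d l (min j (l + k)) (K ^ k / fact k * \<tau> ^ (min j (l + k) - l)) (E k)"
            by (rule bd) (use l in auto)
          show "op_bound n d (min j (l + k)) j
              (K' ^ (i - k) / fact (i - k) * \<tau> ^ (j - min j (l + k) + 1)) (P' (i - k) - E' (i - k))"
            by (rule bdiff) (use l k False in auto)
        qed (use l in auto)
      qed
    qed
    have "2 * (K + K') ^ i \<le> (2 * (K + K')) ^ i"
    proof -
      have "(2::real) ^ 1 \<le> 2 ^ i" using l by (intro power_increasing) auto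
      then show ?thesis unfolding power_mult_distrib using K by (intro mult_right_mono) auto
    qed
    then have "2 * (K + K') ^ i * (\<tau> ^ (j - l + 1) / fact i) \<le> (2 * (K + K')) ^ i * (\<tau> ^ (j - l + 1) / fact i)"
      using K by (intro mult_right_mono) auto
    then show "(\<Sum>k\<le>i. w i k) * \<tau> ^ (j - l + 1) + (\<Sum>k\<le>i. w i k) * \<tau> ^ (j - l + 1)
        \<le> (2 * (K + K')) ^ i / fact i * \<tau> ^ (j - l + 1)"
      by (simp add: w_sum mult_ac)
  qed auto
  have weak: "(K + K') ^ i / fact i * \<tau> ^ r \<le> (2 * (K + K')) ^ i / fact i * \<tau> ^ r" for i r
    using K by (intro mult_right_mono divide_right_mono power_mono) auto
  show ?thesis
    unfolding taylor_pair_def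
  proof (intro conjI allI impI)
    fix i l j :: nat assume l: "l \<le> j" "j \<le> p" "j \<le> l + i"
    show "op_bound n d l j ((2 * (K + K')) ^ i / fact i * \<tau> ^ (j - l)) (mat_conv n P P' i)"
      by (rule op_bound_mono[OF main[OF l] weak]) auto
    show "op_bound n d l j ((2 * (K + K')) ^ i / fact i * \<tau> ^ (j - l)) (mat_conv n E E' i)"
      by (rule op_bound_mono[OF main[OF l] weak]) auto
  qed (use K diff in \<open>auto simp: mat_conv_def zero\<close>)
qed

text \<open>The i-th power is a sum of words of length i in X and B. A letter X lowers the level by one at cost
a, or keeps it at cost a/\<tau>; a letter B keeps the level at cost \<beta>, and since \<tau> is at
most t it can be charged as if it lowered the level. A word of (X + B)^i - X^i contains some B, which
is charged at its true cost, and this is the additional power of \<tau>.\<close>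

lemma mpow_pair:
  assumes X: "\<And>l. l \<le> p \<Longrightarrow> op_bound n d l l (a / \<tau>) X" "\<And>l. l < p \<Longrightarrow> op_bound n d l (Suc l) a X"
    and B: "\<And>l. l \<le> p \<Longrightarrow> op_bound n d l l \<beta> B" and \<tau>: "0 < \<tau>" "\<tau> \<le> t" and a: "0 \<le> a" "0 \<le> \<beta>"
  defines "k \<equiv> (a + \<beta> * (1 + t)) / \<tau>"
  shows "l \<le> j \<Longrightarrow> j \<le> p \<Longrightarrow> j \<le> l + i \<Longrightarrow> op_bound n d l j (k ^ i * \<tau> ^ (j - l)) (mpow n (X + B) i)"
    and "l \<le> j \<Longrightarrow> j \<le> p \<Longrightarrow> j + 1 \<le> l + i \<Longrightarrow>
      op_bound n d l j (k ^ i * \<tau> ^ (j - l + 1)) (mpow n (X + B) i - mpow n X i)"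
proof -
  have X1: "op_bound n d l q (a / \<tau> * \<tau> ^ (q - l)) X" if "l \<le> q" "q \<le> Suc l" "q \<le> p" for l q
  proof (cases "q = l")
    case False
    then have "q = Suc l" using that by auto
    with X(2)[of l] that \<tau> show ?thesis by simp
  qed (use X that in auto)
  have XB: "op_bound n d l q (k * \<tau> ^ (q - l)) (X + B)" if "l \<le> q" "q \<le> Suc l" "q \<le> p" for l q
  proof (rule op_bound_mono)
    show "op_bound n d l q (a / \<tau> * \<tau> ^ (q - l) + \<beta>) (X + B)"
      using that by (intro op_bound_add X1 op_bound_mono[OF B[of l]]) auto
    have "\<beta> * (\<tau> / \<tau> ^ (q - l)) \<le> \<beta> * (1 + t)"
      using that \<tau> a by (intro mult_left_mono) (cases "q = l", auto simp: le_Suc_eq)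
    then have "\<beta> \<le> \<beta> * (1 + t) / \<tau> * \<tau> ^ (q - l)"
      using \<tau> by (simp add: field_simps)
    then show "a / \<tau> * \<tau> ^ (q - l) + \<beta> \<le> k * \<tau> ^ (q - l)"
      unfolding k_def add_divide_distrib distrib_right by simp
  qed auto
  have k0: "0 \<le> k" using a \<tau> by (auto simp: k_def)
  show main: "l \<le> j \<Longrightarrow> j \<le> p \<Longrightarrow> j \<le> l + i \<Longrightarrow> op_bound n d l j (k ^ i * \<tau> ^ (j - l)) (mpow n (X + B) i)" for l j i
  proof (induction i arbitrary: l j)
    case 0
    then show ?case by (auto intro: op_bound_one)
  next
    case (Suc i)
    define q where "q = min j (Suc l)"
    have "op_bound n d l j (k * \<tau> ^ (q - l) * (k ^ i * \<tau> ^ (j - q))) (mpow n (X + B) (Suc i))"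
      unfolding mpow.simps by (rule op_bound_mmul[OF XB Suc.IH]) (use Suc.prems in \<open>auto simp: q_def\<close>)
    moreover have "k * \<tau> ^ (q - l) * (k ^ i * \<tau> ^ (j - q)) = k ^ Suc i * \<tau> ^ (q - l + (j - q))"
      by (simp add: power_add)
    moreover have "q - l + (j - q) = j - l" using Suc.prems by (auto simp: q_def)
    ultimately show ?case by (simp only:)
  qed
  show "l \<le> j \<Longrightarrow> j \<le> p \<Longrightarrow> j + 1 \<le> l + i \<Longrightarrow>
      op_bound n d l j (k ^ i * \<tau> ^ (j - l + 1)) (mpow n (X + B) i - mpow n X i)"
  proof (induction i arbitrary: l j)
    case (Suc i)
    have eq: "mpow n (X + B) (Suc i) - mpow n X (Suc i)
        = mmul n X (mpow n (X + B) i - mpow n X i) + mmul n B (mpow n (X + B) i)"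
      by (simp add: mmul_algebra fun_eq_iff fun_arith)
    have 1: "op_bound n d l j (a / \<tau> * k ^ i * \<tau> ^ (j - l + 1)) (mmul n X (mpow n (X + B) i - mpow n X i))"
    proof (cases "i = 0")
      case True
      then have "mmul n X (mpow n (X + B) i - mpow n X i) = 0" by (simp add: mmul_def fun_eq_iff fun_arith)
      then show ?thesis using a k0 \<tau> by (simp add: op_bound_zero)
    next
      case False
      define q where "q = min j (Suc l)"
      have "op_bound n d l j (a / \<tau> * \<tau> ^ (q - l) * (k ^ i * \<tau> ^ (j - q + 1)))
          (mmul n X (mpow n (X + B) i - mpow n X i))"
        by (rule op_bound_mmul[OF X1 Suc.IH]) (use Suc.prems False in \<open>auto simp: q_def\<close>)
      moreover have "a / \<tau> * \<tau> ^ (q - l) * (k ^ i * \<tau> ^ (j - q + 1)) = a / \<tau> * k ^ i * \<tau> ^ (q - l + (j - q + 1))"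
        by (simp add: power_add)
      moreover have "q - l + (j - q + 1) = j - l + 1" using Suc.prems by (auto simp: q_def)
      ultimately show ?thesis by (simp only:)
    qed
    have 2: "op_bound n d l j (\<beta> * (k ^ i * \<tau> ^ (j - l))) (mmul n B (mpow n (X + B) i))"
      using Suc.prems by (intro op_bound_mmul[OF B main]) auto
    have "\<beta> / \<tau> \<le> \<beta> * (1 + t) / \<tau>"
      using a \<tau> by (intro divide_right_mono) (auto simp: field_simps)
    then have "(a / \<tau> + \<beta> / \<tau>) * (k ^ i * \<tau> ^ (j - l + 1)) \<le> k * (k ^ i * \<tau> ^ (j - l + 1))"
      using k0 \<tau> by (intro mult_right_mono) (auto simp: k_def add_divide_distrib)
    then have "a / \<tau> * k ^ i * \<tau> ^ (j - l + 1) + \<beta> * (k ^ i * \<tau> ^ (j - l)) \<le> k ^ Suc i * \<tau> ^ (j - l + 1)"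
      using \<tau> by (simp add: algebra_simps)
    then show ?case unfolding eq by (rule op_bound_mono[OF op_bound_add[OF 1 2]]) auto
  qed simp
qed

lemma taylor_pair_exp_coeff:
  assumes X: "\<And>l. l \<le> p \<Longrightarrow> op_bound n d l l (a / \<tau>) X" "\<And>l. l < p \<Longrightarrow> op_bound n d l (Suc l) a X"
    and B: "\<And>l. l \<le> p \<Longrightarrow> op_bound n d l l \<beta> B" and \<tau>: "0 < \<tau>" "\<tau> \<le> t" and a: "0 \<le> a" "0 \<le> \<beta>"
  shows "taylor_pair n d p \<tau> ((a + \<beta> * (1 + t)) / \<tau>) (exp_coeff n (X + B)) (exp_coeff n X)"
proof -
  have zero: "op_bound n d l l \<beta> 0" for l using a by (simp add: op_bound_zero)
  note 1 = mpow_pair[where p = p, OF X B \<tau> a, simplified]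
    and 2 = mpow_pair(1)[where p = p, OF X zero \<tau> a, simplified]
  have sc: "op_bound n d l j (K / fact i * r) (scalem (1 / fact i) M)" if "op_bound n d l j (K * r) M" for l j i K r M
    using op_bound_scalem[OF that, of "1 / fact i"] by (simp add: norm_divide)
  have diff: "exp_coeff n (X + B) i - exp_coeff n X i = scalem (1 / fact i) (mpow n (X + B) i - mpow n X i)" for i
    by (simp add: exp_coeff_def scalem_def fun_eq_iff fun_arith right_diff_distrib diff_divide_distrib)
  show ?thesis
    unfolding taylor_pair_def diff
  proof (intro conjI allI impI)
    show "exp_coeff n (X + B) 0 = exp_coeff n X 0" by (simp add: exp_coeff_def)
    show "0 \<le> (a + \<beta> * (1 + t)) / \<tau>" "0 < \<tau>" using \<tau> a by auto
  next
    fix i l j :: nat assume l: "l \<le> j" "j \<le> p" "j \<le> l + i"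
    show "op_bound n d l j (((a + \<beta> * (1 + t)) / \<tau>) ^ i / fact i * \<tau> ^ (j - l)) (exp_coeff n (X + B) i)"
      "op_bound n d l j (((a + \<beta> * (1 + t)) / \<tau>) ^ i / fact i * \<tau> ^ (j - l)) (exp_coeff n X i)"
      unfolding exp_coeff_def by (rule sc; use 1(1)[OF l] 2[OF l] in simp)+
  next
    fix i l j :: nat assume l: "l \<le> j" "j \<le> p" "j + 1 \<le> l + i"
    show "op_bound n d l j (((a + \<beta> * (1 + t)) / \<tau>) ^ i / fact i * \<tau> ^ (j - l + 1))
        (scalem (1 / fact i) (mpow n (X + B) i - mpow n X i))"
      by (rule sc) (use 1(2)[of l j i] l in simp)
  qed
qed

end

section \<open>Splittings on low frequencies\<close>

primrec msplit :: "nat \<Rightarrow> nat \<Rightarrow> (nat \<Rightarrow> real) \<Rightarrow> (nat \<Rightarrow> real) \<Rightarrow> cmatrix \<Rightarrow> cmatrix \<Rightarrow> real \<Rightarrow> cmatrix" where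
  "msplit n 0 a b A B \<sigma> = diagm (\<lambda>_. 1)"
| "msplit n (Suc s) a b A B \<sigma> = mmul n (msplit n s a b A B \<sigma>)
     (mmul n (mexp n (scalem (b (Suc s)) B) \<sigma>) (mexp n (scalem (a (Suc s)) A) \<sigma>))"

text \<open>The Taylor coefficients of msplit. With B = 0 they belong to the free evolution, so that both
components of a taylor_pair are instances.\<close>

primrec split_coeff :: "nat \<Rightarrow> nat \<Rightarrow> (nat \<Rightarrow> real) \<Rightarrow> (nat \<Rightarrow> real) \<Rightarrow> cmatrix \<Rightarrow> cmatrix \<Rightarrow> nat \<Rightarrow> cmatrix" where
  "split_coeff n 0 a b A B = (\<lambda>m. if m = 0 then diagm (\<lambda>_. 1) else 0)"
| "split_coeff n (Suc s) a b A B = mat_conv n (split_coeff n s a b A B)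
     (mat_conv n (exp_coeff n (scalem (b (Suc s)) B)) (exp_coeff n (scalem (a (Suc s)) A)))"

lemma scalem_zero [simp]: "scalem c 0 = 0"
  by (simp add: scalem_def fun_eq_iff fun_arith)

lemma mat_series_msplit: "mat_series n (msplit n s a b A B) (split_coeff n s a b A B)"
  by (induction s) (simp_all add: mat_series_const mat_series_conv mat_series_mexp)

lemma mexp_zero:
  assumes "i < n" "j < n"
  shows "mexp n 0 \<sigma> i j = diagm (\<lambda>_. 1) i j"
proof -
  have "diagm (\<lambda>_. 0) = 0" by (simp add: fun_eq_iff fun_arith diagm_def)
  with mexp_diagm[OF assms, of "\<lambda>_. 0" \<sigma>] show ?thesis by (simp only: mult_zero_right exp_zero)
qed

lemma mmul_cong:
  assumes "\<And>i j. i < n \<Longrightarrow> j < n \<Longrightarrow> A i j = A' i j" "\<And>i j. i < n \<Longrightarrow> j < n \<Longrightarrow> B i j = B' i j"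
    "i < n" "j < n"
  shows "mmul n A B i j = mmul n A' B' i j"
  using assms by (auto simp: mmul_def intro!: sum.cong)

lemma mmul_diagm: "i < n \<Longrightarrow> j < n \<Longrightarrow> mmul n (diagm f) (diagm g) i j = diagm (\<lambda>i. f i * g i) i j"
proof -
  assume ij: "i < n" "j < n"
  have "mmul n (diagm f) (diagm g) i j = (\<Sum>k<n. if k = i then f i * diagm g i j else 0)"
    unfolding mmul_def by (rule sum.cong) (auto simp: diagm_apply)
  with ij show ?thesis by (simp add: diagm_apply)
qed

lemma scalem_diagm: "scalem c (diagm f) = diagm (\<lambda>i. c * f i)"
  by (simp add: scalem_def diagm_def fun_eq_iff)

lemma msplit_diagm:
  "i < n \<Longrightarrow> j < n \<Longrightarrow>
    msplit n s a b (diagm x) 0 \<sigma> i j = diagm (\<lambda>i. exp (of_real (\<sigma> * (\<Sum>k=1..s. a k)) * x i)) i j"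
proof (induction s arbitrary: i j)
  case (Suc s)
  have 1: "mmul n (mexp n 0 \<sigma>) (mexp n (scalem (a (Suc s)) (diagm x)) \<sigma>) i j
      = diagm (\<lambda>i. exp (of_real \<sigma> * (a (Suc s) * x i))) i j" if "i < n" "j < n" for i j
    using that mmul_diagm[OF that, of "\<lambda>_. 1" "\<lambda>i. exp (of_real \<sigma> * (a (Suc s) * x i))"]
    by (subst mmul_cong[OF mexp_zero]) (auto simp: scalem_diagm mexp_diagm)
  have "msplit n (Suc s) a b (diagm x) 0 \<sigma> i j
      = mmul n (diagm (\<lambda>i. exp (of_real (\<sigma> * (\<Sum>k=1..s. a k)) * x i)))
         (diagm (\<lambda>i. exp (of_real \<sigma> * (a (Suc s) * x i)))) i j"
    unfolding msplit.simps scalem_zero by (rule mmul_cong) (use Suc 1 in auto)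
  also have "\<dots> = diagm (\<lambda>i. exp (of_real (\<sigma> * (\<Sum>k=1..Suc s. a k)) * x i)) i j"
  proof -
    define S where "S = (\<Sum>k=1..s. a k)"
    have "(\<Sum>k=1..Suc s. a k) = S + a (Suc s)" by (simp add: S_def)
    then have "exp (of_real (\<sigma> * (\<Sum>k=1..Suc s. a k)) * x i)
        = exp (of_real (\<sigma> * S) * x i) * exp (of_real \<sigma> * (a (Suc s) * x i))" for i
      by (simp add: exp_add[symmetric] algebra_simps)
    then show ?thesis
      using Suc.prems by (simp only: mmul_diagm S_def[symmetric])
  qed
  finally show ?case .
qed simp

lemma taylor_pair_split_coeff:
  assumes \<beta>: "0 \<le> \<beta>" and t: "0 \<le> t"
  shows "\<exists>K\<ge>0. \<forall>n d X B \<tau>. weighted d \<longrightarrow> (\<forall>l\<le>p. op_bound n d l l (1 / \<tau>) X) \<longrightarrow>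
    (\<forall>l<p. op_bound n d l (Suc l) 1 X) \<longrightarrow> (\<forall>l\<le>p. op_bound n d l l \<beta> B) \<longrightarrow> 0 < \<tau> \<longrightarrow> \<tau> \<le> t \<longrightarrow>
    taylor_pair n d p \<tau> (K / \<tau>) (split_coeff n s a b X B) (split_coeff n s a b X 0)"
proof (induction s)
  case 0
  show ?case
  proof (intro exI[of _ 0] conjI allI impI)
    fix n :: nat and d :: "nat \<Rightarrow> real" and X B :: cmatrix and \<tau> :: real
    assume "weighted d" and \<tau>: "0 < \<tau>"
    then interpret weighted n d by simp
    show "taylor_pair n d p \<tau> (0 / \<tau>) (split_coeff n 0 a b X B) (split_coeff n 0 a b X 0)"
      using \<tau> by (auto simp: taylor_pair_def op_bound_zero intro: op_bound_mono[OF op_bound_one])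
  qed simp
next
  case (Suc s)
  then obtain K where K: "0 \<le> K" and IH: "\<And>n d X B \<tau>. weighted d \<Longrightarrow> (\<forall>l\<le>p. op_bound n d l l (1 / \<tau>) X) \<Longrightarrow>
    (\<forall>l<p. op_bound n d l (Suc l) 1 X) \<Longrightarrow> (\<forall>l\<le>p. op_bound n d l l \<beta> B) \<Longrightarrow> 0 < \<tau> \<Longrightarrow> \<tau> \<le> t \<Longrightarrow>
    taylor_pair n d p \<tau> (K / \<tau>) (split_coeff n s a b X B) (split_coeff n s a b X 0)" by blast
  define kb where "kb = \<bar>b (Suc s)\<bar> * \<beta> * (1 + t)"
  define ka where "ka = \<bar>a (Suc s)\<bar>"
  have k0: "0 \<le> kb" "0 \<le> ka" using \<beta> t by (auto simp: ka_def kb_def)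
  show ?case
  proof (intro exI[of _ "2 * (K + 2 * (kb + ka))"] conjI allI impI)
    fix n :: nat and d :: "nat \<Rightarrow> real" and X B :: cmatrix and \<tau> :: real
    assume w: "weighted d" and X: "\<forall>l\<le>p. op_bound n d l l (1 / \<tau>) X" "\<forall>l<p. op_bound n d l (Suc l) 1 X"
      and B: "\<forall>l\<le>p. op_bound n d l l \<beta> B" and \<tau>: "0 < \<tau>" "\<tau> \<le> t"
    interpret weighted n d by fact
    have "taylor_pair n d p \<tau> ((0 + \<bar>b (Suc s)\<bar> * \<beta> * (1 + t)) / \<tau>)
        (exp_coeff n (0 + scalem (b (Suc s)) B)) (exp_coeff n 0)"
      using B \<tau> \<beta> op_bound_scalem[of _ _ \<beta> B "b (Suc s)"]
      by (intro taylor_pair_exp_coeff) (auto simp: op_bound_zero)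
    then have 1: "taylor_pair n d p \<tau> (kb / \<tau>) (exp_coeff n (scalem (b (Suc s)) B)) (exp_coeff n (scalem (b (Suc s)) 0))"
      by (simp add: kb_def)
    have "taylor_pair n d p \<tau> ((ka + 0 * (1 + t)) / \<tau>)
        (exp_coeff n (scalem (a (Suc s)) X + 0)) (exp_coeff n (scalem (a (Suc s)) X))"
      using X \<tau> op_bound_scalem[of _ _ 1 X "a (Suc s)"] op_bound_scalem[of _ _ "1 / \<tau>" X "a (Suc s)"]
      by (intro taylor_pair_exp_coeff) (auto simp: op_bound_zero ka_def)
    then have 2: "taylor_pair n d p \<tau> (ka / \<tau>) (exp_coeff n (scalem (a (Suc s)) X)) (exp_coeff n (scalem (a (Suc s)) X))"
      by simp
    have "taylor_pair n d p \<tau> (2 * (K / \<tau> + 2 * (kb / \<tau> + ka / \<tau>))) (split_coeff n (Suc s) a b X B) (split_coeff n (Suc s) a b X 0)"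
      unfolding split_coeff.simps
      by (intro taylor_pair_conv 1 2 IH w X B \<tau>)
    then show "taylor_pair n d p \<tau> (2 * (K + 2 * (kb + ka)) / \<tau>) (split_coeff n (Suc s) a b X B) (split_coeff n (Suc s) a b X 0)"
      by (simp add: add_divide_distrib distrib_left)
  qed (use K k0 in auto)
qed

text \<open>The order condition entry by entry, which is the form that fits power series.\<close>

definition matrix_order :: "nat \<Rightarrow> (nat \<Rightarrow> real) \<Rightarrow> (nat \<Rightarrow> real) \<Rightarrow> nat \<Rightarrow> bool" where
  "matrix_order s a b p \<longleftrightarrow> (\<forall>n A B i j. i < n \<longrightarrow> j < n \<longrightarrow>
     (\<exists>C. \<forall>\<^sub>F \<sigma> in at_right 0. cmod (msplit n s a b A B \<sigma> i j - mexp n (A + B) \<sigma> i j) \<le> C * \<sigma> ^ (p + 1)))"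

text \<open>For B = 0 and a 1 x 1 matrix A the splitting is exp(\<sigma> (a_1 + ... + a_s)), and agreement with
exp \<sigma> to first order fixes the sum. It follows that splitting and exact flow have the same
free evolution for every diagonal A.\<close>

lemma order_sum_a:
  assumes "matrix_order s a b p" "1 \<le> p"
  shows "(\<Sum>k=1..s. a k) = 1"
proof -
  let ?A = "diagm (\<lambda>_. 1)" and ?c = "\<lambda>m. split_coeff 1 s a b (diagm (\<lambda>_. 1)) 0 m - exp_coeff 1 (diagm (\<lambda>_. 1) + 0) m"
  define S where "S = (\<Sum>k=1..s. a k)"
  obtain C where C: "\<forall>\<^sub>F \<sigma> in at_right 0.
      cmod (msplit 1 s a b ?A 0 \<sigma> 0 0 - mexp 1 (?A + 0) \<sigma> 0 0) \<le> C * \<sigma> ^ (p + 1)"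
    using assms(1)[unfolded matrix_order_def, rule_format, of 0 1 0 ?A 0] by auto
  have eq: "msplit 1 s a b ?A 0 \<sigma> 0 0 - mexp 1 (?A + 0) \<sigma> 0 0 = exp (of_real \<sigma> * of_real S) - exp (of_real \<sigma>)" for \<sigma>
    using msplit_diagm[of 0 1 0 s a b "\<lambda>_. 1" \<sigma>] mexp_diagm[of 0 1 0 "\<lambda>_. 1" \<sigma>]
    by (simp add: diagm_apply S_def)
  have sums: "(\<lambda>m. (of_real S ^ m / fact m - 1 / fact m) * of_real \<sigma> ^ m)
      sums (exp (of_real \<sigma> * of_real S) - exp (of_real \<sigma> :: complex))" for \<sigma>
    using sums_diff[OF exp_converges[of "of_real \<sigma> * of_real S :: complex"] exp_converges[of "of_real \<sigma> :: complex"]]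
    by (simp add: scaleR_conv_of_real field_simps)
  have "of_real S ^ 1 / fact 1 - 1 / fact 1 = (0 :: complex)"
    by (rule powser_coeff_zero[where c = "\<lambda>m. of_real S ^ m / fact m - 1 / fact m", OF sums])
      (use C[unfolded eq] assms(2) in auto)
  then have "complex_of_real S = of_real 1" by simp
  then show ?thesis unfolding of_real_eq_iff S_def .
qed

lemma taylor_pair_diffD:
  "taylor_pair n d p \<tau> K P E \<Longrightarrow> l \<le> j \<Longrightarrow> j \<le> p \<Longrightarrow> j + 1 \<le> l + i \<Longrightarrow>
    op_bound n d l j (K ^ i / fact i * \<tau> ^ (j - l + 1)) (P i - E i)"
  unfolding taylor_pair_def by blast

text \<open>The difference of splitting and exact flow is an entire function of \<sigma> for these matrices, so
its coefficients of degree at most p vanish by the order condition. The free evolutions of the two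
agree and can be subtracted from both; the remaining coefficients of degree m > p then gain
\<tau>^(p + 1) from level p by the bounds on Taylor pairs, and they are summed at \<sigma> = \<tau>.\<close>

lemma low_frequency_error:
  assumes order: "matrix_order s a b p" and p: "1 \<le> p" and \<beta>: "0 \<le> \<beta>" and t: "0 \<le> t"
  shows "\<exists>C\<ge>0. \<forall>n d x B \<tau>. weighted d \<longrightarrow> (\<forall>l\<le>p. op_bound n d l l (1 / \<tau>) (diagm x)) \<longrightarrow>
    (\<forall>l<p. op_bound n d l (Suc l) 1 (diagm x)) \<longrightarrow> (\<forall>l\<le>p. op_bound n d l l \<beta> B) \<longrightarrow> 0 < \<tau> \<longrightarrow> \<tau> \<le> t \<longrightarrow>
    op_bound n d 0 p (C * \<tau> ^ (p + 1)) (msplit n s a b (diagm x) B \<tau> - mexp n (diagm x + B) \<tau>)"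
proof -
  obtain K where K: "0 \<le> K" and split: "\<And>n d X B \<tau>. weighted d \<Longrightarrow> (\<forall>l\<le>p. op_bound n d l l (1 / \<tau>) X) \<Longrightarrow>
    (\<forall>l<p. op_bound n d l (Suc l) 1 X) \<Longrightarrow> (\<forall>l\<le>p. op_bound n d l l \<beta> B) \<Longrightarrow> 0 < \<tau> \<Longrightarrow> \<tau> \<le> t \<Longrightarrow>
    taylor_pair n d p \<tau> (K / \<tau>) (split_coeff n s a b X B) (split_coeff n s a b X 0)"
    using taylor_pair_split_coeff[OF \<beta> t, of p s a b] by blast
  define L where "L = 1 + \<beta> * (1 + t)"
  show ?thesis
  proof (intro exI[of _ "exp K + exp L"] conjI allI impI)
    fix n :: nat and d :: "nat \<Rightarrow> real" and x :: "nat \<Rightarrow> complex" and B :: cmatrix and \<tau> :: real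
    let ?X = "diagm x"
    assume w: "weighted d" and X: "\<forall>l\<le>p. op_bound n d l l (1 / \<tau>) ?X" "\<forall>l<p. op_bound n d l (Suc l) 1 ?X"
      and B: "\<forall>l\<le>p. op_bound n d l l \<beta> B" and \<tau>: "0 < \<tau>" "\<tau> \<le> t"
    interpret weighted n d by fact
    have S: "taylor_pair n d p \<tau> (K / \<tau>) (split_coeff n s a b ?X B) (split_coeff n s a b ?X 0)"
      using split w X B \<tau> by blast
    have T: "taylor_pair n d p \<tau> (L / \<tau>) (exp_coeff n (?X + B)) (exp_coeff n ?X)"
      unfolding L_def using X B \<tau> \<beta> by (intro taylor_pair_exp_coeff) auto
    define r where "r = (\<lambda>m. (split_coeff n s a b ?X B m - split_coeff n s a b ?X 0 m) - (exp_coeff n (?X + B) m - exp_coeff n ?X m))"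
    define R where "R = (\<lambda>\<sigma>. (msplit n s a b ?X B \<sigma> - msplit n s a b ?X 0 \<sigma>) - (mexp n (?X + B) \<sigma> - mexp n ?X \<sigma>))"
    have R_ser: "mat_series n R r"
      unfolding R_def r_def by (intro mat_series_diff mat_series_msplit mat_series_mexp)
    have S1: "(\<Sum>k=1..s. a k) = 1" by (rule order_sum_a[OF order p])
    have E1: "msplit n s a b ?X 0 \<sigma> i j = mexp n ?X \<sigma> i j" if "i < n" "j < n" for \<sigma> i j
      using msplit_diagm[OF that, of s a b x \<sigma>] that unfolding S1 by (simp add: mexp_diagm)
    have R_eq: "R \<sigma> i j = (msplit n s a b ?X B \<sigma> - mexp n (?X + B) \<sigma>) i j" if "i < n" "j < n" for \<sigma> i j
      using that by (simp add: R_def fun_arith minus_apply E1)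
    have r_zero: "r m i j = 0" if m: "m \<le> p" and ij: "i < n" "j < n" for m i j
    proof -
      obtain C where C: "\<forall>\<^sub>F \<sigma> in at_right 0.
          cmod (msplit n s a b ?X B \<sigma> i j - mexp n (?X + B) \<sigma> i j) \<le> C * \<sigma> ^ (p + 1)"
        using order ij unfolding matrix_order_def by blast
      show ?thesis
        by (rule powser_coeff_zero[where c = "\<lambda>m. r m i j" and f = "\<lambda>\<sigma>. R \<sigma> i j" and C = C])
          (use C m ij mat_seriesD[OF R_ser ij] in \<open>simp_all add: R_eq minus_apply\<close>)
    qed
    have r_bd: "op_bound n d 0 p ((K ^ m / fact m + L ^ m / fact m) * \<tau> ^ (p + 1)) (scalem (of_real \<tau> ^ m) (r m))" for m
    proof (cases "m \<le> p")
      case True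
      then have "op_bound n d 0 p ((K ^ m / fact m + L ^ m / fact m) * \<tau> ^ (p + 1)) (scalem (of_real \<tau> ^ m) (r m)) \<longleftrightarrow>
        op_bound n d 0 p ((K ^ m / fact m + L ^ m / fact m) * \<tau> ^ (p + 1)) 0"
        by (intro op_bound_cong) (simp add: scalem_def r_zero fun_arith)
      then show ?thesis using K \<beta> t \<tau> by (simp add: op_bound_zero L_def)
    next
      case False
      have "op_bound n d 0 p ((K / \<tau>) ^ m / fact m * \<tau> ^ (p - 0 + 1) + (L / \<tau>) ^ m / fact m * \<tau> ^ (p - 0 + 1)) (r m)"
        unfolding r_def by (intro op_bound_diff taylor_pair_diffD[OF S] taylor_pair_diffD[OF T]) (use False in auto)
      moreover have "cmod (of_real \<tau> ^ m) *
          ((K / \<tau>) ^ m / fact m * \<tau> ^ (p - 0 + 1) + (L / \<tau>) ^ m / fact m * \<tau> ^ (p - 0 + 1))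
          = (K ^ m / fact m + L ^ m / fact m) * \<tau> ^ (p + 1)"
        using \<tau> by (simp add: norm_power power_divide distrib_left distrib_right)
      ultimately show ?thesis
        using op_bound_scalem[OF \<open>op_bound n d 0 p _ (r m)\<close>, of "of_real \<tau> ^ m"] by (simp only:)
    qed
    have "op_bound n d 0 p ((exp K + exp L) * \<tau> ^ (p + 1)) (R \<tau>)"
    proof (rule op_bound_sums[OF _ r_bd])
      show "(\<lambda>m. scalem (of_real \<tau> ^ m) (r m) i j) sums R \<tau> i j" if "i < n" "j < n" for i j
        using mat_seriesD[OF R_ser that, of \<tau>] by (simp add: scalem_def mult.commute)
      show "(\<lambda>m. (K ^ m / fact m + L ^ m / fact m) * \<tau> ^ (p + 1)) sums ((exp K + exp L) * \<tau> ^ (p + 1))"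
        using exp_converges[of K] exp_converges[of L]
        by (intro sums_mult2 sums_add) (simp_all add: divide_inverse mult.commute)
    qed
    then show "op_bound n d 0 p ((exp K + exp L) * \<tau> ^ (p + 1)) (msplit n s a b ?X B \<tau> - mexp n (?X + B) \<tau>)"
      by (subst op_bound_cong[symmetric]) (auto simp: R_eq)
  qed simp
qed

section \<open>Cutting off high frequencies\<close>

lemma mexp_at_zero: "mexp n M 0 i j = diagm (\<lambda>_. 1) i j"
proof -
  have "(\<Sum>m. exp_coeff n M m i j * 0 ^ m) = exp_coeff n M 0 i j" by (rule powser_zero)
  then show ?thesis by (simp add: mexp_def exp_coeff_def scalem_def)
qed

lemma mexp_has_vector_derivative:
  assumes "i < n" "j < n"
  shows "((\<lambda>s. mexp n M s i j) has_vector_derivative mmul n M (mexp n M s) i j) (at s within S)"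
proof -
  define c where "c = (\<lambda>m. exp_coeff n M m i j)"
  have "summable (\<lambda>m. c m * z ^ m)" for z
    unfolding c_def by (rule summable_norm_cancel, rule mat_series_summable[OF mat_series_mexp assms])
  then have "((\<lambda>z. \<Sum>m. c m * z ^ m) has_field_derivative (\<Sum>m. diffs c m * of_real s ^ m)) (at (of_real s))"
    by (rule termdiffs_strong_converges_everywhere)
  then have "((\<lambda>s. mexp n M s i j) has_vector_derivative (\<Sum>m. diffs c m * of_real s ^ m)) (at s within S)"
    unfolding mexp_def c_def by (rule has_vector_derivative_real_field)
  moreover have "(\<lambda>m. diffs c m * of_real s ^ m) sums mmul n M (mexp n M s) i j"
  proof -
    have "(\<lambda>m. \<Sum>k<n. M i k * (exp_coeff n M m k j * of_real s ^ m)) sums (\<Sum>k<n. M i k * mexp n M s k j)"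
      using assms by (intro sums_sum sums_mult mat_seriesD[OF mat_series_mexp]) auto
    moreover have "(\<Sum>k<n. M i k * (exp_coeff n M m k j * of_real s ^ m)) = diffs c m * of_real s ^ m" for m
    proof -
      have "of_nat (Suc m) * (1 / fact (Suc m) :: complex) = 1 / fact m"
        by (simp add: fact_Suc del: of_nat_Suc)
      then have "diffs c m = 1 / fact m * mmul n M (mpow n M m) i j"
        unfolding diffs_def c_def exp_coeff_def scalem_def mpow.simps mult.assoc[symmetric] by simp
      then show ?thesis
        by (simp add: mmul_def exp_coeff_def scalem_def sum_distrib_left sum_distrib_right sum_divide_distrib mult_ac)
    qed
    ultimately show ?thesis by (simp add: mmul_def)
  qed
  ultimately show ?thesis by (simp add: sums_iff)
qed

text \<open>P is a product of exponentials, E the same product without the potential, and PL, EL are the two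
products after D has been cut off at 1/\<tau>. Removing the potential costs \<tau>, cutting off
costs \<tau>^p from level p, and the mixed difference is of the size of the product of both. Bounding
P - PL alone would lose a power of \<tau>: the loss sits in E - EL, which cancels in the end.\<close>

definition trunc_quad ::
  "nat \<Rightarrow> (nat \<Rightarrow> real) \<Rightarrow> nat \<Rightarrow> real \<Rightarrow> real \<Rightarrow> cmatrix \<Rightarrow> cmatrix \<Rightarrow> cmatrix \<Rightarrow> cmatrix \<Rightarrow> bool" where
  "trunc_quad n d p \<tau> k P E PL EL \<longleftrightarrow> 0 \<le> \<tau> \<and> 0 \<le> k \<and>
     op_bound n d p p k P \<and> op_bound n d p p k E \<and> op_bound n d 0 0 k PL \<and> op_bound n d 0 0 k EL \<and>
     op_bound n d p p (k * \<tau>) (P - E) \<and> op_bound n d 0 0 (k * \<tau>) (PL - EL) \<and>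
     op_bound n d 0 p (k * \<tau> ^ p) (P - PL) \<and> op_bound n d 0 p (k * \<tau> ^ p) (E - EL) \<and>
     op_bound n d 0 p (k * \<tau> ^ (p + 1)) ((P - E) - (PL - EL))"

context weighted
begin

text \<open>The mixed difference of a product expands by Leibniz into four products, each with either one mixed
difference or one difference of each kind. The levels match because P and P - E act on level p,
where the cut-off estimate starts, and PL and PL - EL on level 0, where it ends.\<close>

lemma trunc_quad_mmul:
  assumes 1: "trunc_quad n d p \<tau> k P E PL EL" and 2: "trunc_quad n d p \<tau> k' P' E' PL' EL'"
  shows "trunc_quad n d p \<tau> (4 * k * k') (mmul n P P') (mmul n E E') (mmul n PL PL') (mmul n EL EL')"
proof -
  have k: "0 \<le> \<tau>" "0 \<le> k" "0 \<le> k'" using 1 2 by (auto simp: trunc_quad_def)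
  have grow: "c * (k * k') * r \<le> 4 * k * k' * r" if "c \<le> 4" "0 \<le> r" for c r
    using mult_right_mono[OF that(1), of "k * k' * r"] k that by (simp add: mult_ac)
  note b1 = 1[unfolded trunc_quad_def] and b2 = 2[unfolded trunc_quad_def]
  have diff: "mmul n A A' - mmul n C C' = mmul n (A - C) A' + mmul n C (A' - C')" for A A' C C'
    by (simp add: mmul_algebra)
  have dd: "(mmul n P P' - mmul n E E') - (mmul n PL PL' - mmul n EL EL')
      = (mmul n ((P - E) - (PL - EL)) P' + mmul n (PL - EL) (P' - PL'))
        + (mmul n (E - EL) (P' - E') + mmul n EL ((P' - E') - (PL' - EL')))"
    by (simp add: mmul_algebra)
  have prods: "op_bound n d p p (1 * (k * k') * 1) (mmul n P P')" "op_bound n d p p (1 * (k * k') * 1) (mmul n E E')"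
    "op_bound n d 0 0 (1 * (k * k') * 1) (mmul n PL PL')" "op_bound n d 0 0 (1 * (k * k') * 1) (mmul n EL EL')"
    by (simp, rule op_bound_mmul; use b1 b2 in blast)+
  have d1: "op_bound n d p p (k * \<tau> * k' + k * (k' * \<tau>)) (mmul n P P' - mmul n E E')"
    unfolding diff by (rule op_bound_add; rule op_bound_mmul; use b1 b2 in blast)
  have d2: "op_bound n d 0 0 (k * \<tau> * k' + k * (k' * \<tau>)) (mmul n PL PL' - mmul n EL EL')"
    unfolding diff by (rule op_bound_add; rule op_bound_mmul; use b1 b2 in blast)
  have d3: "op_bound n d 0 p (k * \<tau> ^ p * k' + k * (k' * \<tau> ^ p)) (mmul n P P' - mmul n PL PL')"
    unfolding diff by (rule op_bound_add; rule op_bound_mmul; use b1 b2 in blast)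
  have d4: "op_bound n d 0 p (k * \<tau> ^ p * k' + k * (k' * \<tau> ^ p)) (mmul n E E' - mmul n EL EL')"
    unfolding diff by (rule op_bound_add; rule op_bound_mmul; use b1 b2 in blast)
  have d5: "op_bound n d 0 p ((k * \<tau> ^ (p + 1) * k' + k * \<tau> * (k' * \<tau> ^ p)) + (k * \<tau> ^ p * (k' * \<tau>) + k * (k' * \<tau> ^ (p + 1))))
      ((mmul n P P' - mmul n E E') - (mmul n PL PL' - mmul n EL EL'))"
    unfolding dd by (intro op_bound_add; rule op_bound_mmul; use b1 b2 in blast)
  have two: "k * r * k' + k * (k' * r) = 2 * (k * k') * r" for r by simp
  have four: "(k * \<tau> ^ (p + 1) * k' + k * \<tau> * (k' * \<tau> ^ p)) + (k * \<tau> ^ p * (k' * \<tau>) + k * (k' * \<tau> ^ (p + 1)))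
      = 4 * (k * k') * \<tau> ^ (p + 1)" by simp
  have le1: "1 * (k * k') * 1 \<le> 4 * k * k'" using grow[of 1 1] by simp
  show ?thesis
    unfolding trunc_quad_def
    by (intro conjI op_bound_mono[OF prods(1) le1] op_bound_mono[OF prods(2) le1] op_bound_mono[OF prods(3) le1]
        op_bound_mono[OF prods(4) le1] op_bound_mono[OF d1[unfolded two] grow] op_bound_mono[OF d2[unfolded two] grow]
        op_bound_mono[OF d3[unfolded two] grow] op_bound_mono[OF d4[unfolded two] grow]
        op_bound_mono[OF d5[unfolded four] grow]) (use k in auto)
qed

lemma mexp_series_bound:
  assumes B: "op_bound n d l l \<beta> B" and \<sigma>: "0 \<le> \<sigma>"
  shows op_bound_mexp: "op_bound n d l l (exp (\<beta> * \<sigma>)) (mexp n B \<sigma>)"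
    and op_bound_mexp_diff: "op_bound n d l l (\<beta> * \<sigma> * exp (\<beta> * \<sigma>)) (mexp n B \<sigma> - mexp n 0 \<sigma>)"
proof -
  have \<beta>: "0 \<le> \<beta>" using B by (simp add: op_bound_def)
  have trm: "op_bound n d l l ((\<beta> * \<sigma>) ^ m / fact m) (scalem (of_real \<sigma> ^ m) (exp_coeff n B m))" for m
  proof -
    have "cmod (of_real \<sigma> ^ m) * (cmod (1 / fact m) * \<beta> ^ m) = (\<beta> * \<sigma>) ^ m / fact m"
      using \<sigma> by (simp add: norm_power norm_divide power_mult_distrib mult.commute)
    then show ?thesis
      unfolding exp_coeff_def using op_bound_scalem[OF op_bound_scalem[OF op_bound_mpow[OF B, of m], of "1 / fact m"], of "of_real \<sigma> ^ m"]
      by (simp only:)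
  qed
  have e: "(\<lambda>m. (\<beta> * \<sigma>) ^ m / fact m) sums exp (\<beta> * \<sigma>)"
    using exp_converges[of "\<beta> * \<sigma>"] by (simp add: divide_inverse mult.commute)
  show "op_bound n d l l (exp (\<beta> * \<sigma>)) (mexp n B \<sigma>)"
    by (rule op_bound_sums[OF _ trm e]) (use mat_seriesD[OF mat_series_mexp] in \<open>auto simp: scalem_def mult.commute\<close>)
  define k where "k = (\<lambda>m. if m = 0 then 0 else (\<beta> * \<sigma>) ^ m / fact m)"
  have ks: "k sums (exp (\<beta> * \<sigma>) - 1)"
  proof -
    have "(\<lambda>m. (\<beta> * \<sigma>) ^ m / fact m - (if m = 0 then 1 else 0)) sums (exp (\<beta> * \<sigma>) - 1)"
      by (intro sums_diff e sums_single)
    moreover have "(\<lambda>m. (\<beta> * \<sigma>) ^ m / fact m - (if m = 0 then 1 else 0)) = k"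
      by (auto simp: k_def fun_eq_iff)
    ultimately show ?thesis by simp
  qed
  have "op_bound n d l l (exp (\<beta> * \<sigma>) - 1) (mexp n B \<sigma> - mexp n 0 \<sigma>)"
  proof (rule op_bound_sums[OF _ _ ks])
    show "(\<lambda>m. scalem (of_real \<sigma> ^ m) (exp_coeff n B m - exp_coeff n 0 m) i j) sums (mexp n B \<sigma> - mexp n 0 \<sigma>) i j"
      if "i < n" "j < n" for i j
      using mat_seriesD[OF mat_series_diff[OF mat_series_mexp mat_series_mexp] that, of B 0 \<sigma>] by (simp add: scalem_def mult.commute)
    show "op_bound n d l l (k m) (scalem (of_real \<sigma> ^ m) (exp_coeff n B m - exp_coeff n 0 m))" for m
    proof (cases m)
      case 0
      then have "exp_coeff n B m - exp_coeff n 0 m = 0" by (simp add: exp_coeff_def)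
      with 0 show ?thesis by (simp add: k_def op_bound_zero)
    next
      case (Suc m')
      have "exp_coeff n 0 m = 0" by (simp add: exp_coeff_def Suc mmul_def scalem_def fun_eq_iff fun_arith)
      then show ?thesis using trm[of m] Suc by (simp add: k_def)
    qed
  qed
  moreover have "exp (\<beta> * \<sigma>) - 1 \<le> \<beta> * \<sigma> * exp (\<beta> * \<sigma>)"
  proof -
    have "(1 - \<beta> * \<sigma>) * exp (\<beta> * \<sigma>) \<le> exp (- (\<beta> * \<sigma>)) * exp (\<beta> * \<sigma>)"
      using exp_ge_add_one_self[of "- (\<beta> * \<sigma>)"] by (intro mult_right_mono) auto
    then show ?thesis by (simp add: mult_exp_exp algebra_simps)
  qed
  ultimately show "op_bound n d l l (\<beta> * \<sigma> * exp (\<beta> * \<sigma>)) (mexp n B \<sigma> - mexp n 0 \<sigma>)"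
    by (rule op_bound_mono) auto
qed

lemma op_bound_mexp_skew:
  assumes "\<And>i. Re (x i) = 0"
  shows "op_bound n d l l 1 (mexp n (scalem (of_real r) (diagm x)) \<sigma>)"
proof -
  have "op_bound n d l l 1 (diagm (\<lambda>i. exp (of_real \<sigma> * (of_real r * x i))))"
    by (rule op_bound_diagm) (auto simp: assms)
  then show ?thesis
    by (rule op_bound_cong[THEN iffD1, rotated]) (simp add: scalem_diagm mexp_diagm)
qed

lemma op_bound_msplit:
  assumes x: "\<And>i. Re (x i) = 0" and B: "op_bound n d l l \<beta> B" and \<sigma>: "0 \<le> \<sigma>"
  shows "op_bound n d l l (exp ((\<Sum>k=1..s. \<bar>b k\<bar>) * \<beta> * \<sigma>)) (msplit n s a b (diagm x) B \<sigma>)"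
proof (induction s)
  case 0
  show ?case by (simp add: op_bound_one)
next
  case (Suc s)
  have "op_bound n d l l (exp (\<bar>b (Suc s)\<bar> * \<beta> * \<sigma>)) (mexp n (scalem (of_real (b (Suc s))) B) \<sigma>)"
    using op_bound_scalem[OF B, of "of_real (b (Suc s))"] by (intro op_bound_mexp \<sigma>) simp
  from op_bound_mmul[OF Suc op_bound_mmul[OF this op_bound_mexp_skew[OF x, where r = "a (Suc s)"]]] show ?case
    by (simp add: mult_exp_exp distrib_right)
qed

text \<open>Above the cut-off the weight 1 + d exceeds 1/\<tau>; this is what exchanges levels for powers of
\<tau>.\<close>

lemma high_frequency_weight:
  assumes "1 / \<tau> < d i" "0 < \<tau>"
  shows "1 \<le> \<tau> ^ q * (1 + d i) ^ q"
proof -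
  have "1 \<le> \<tau> * (1 + d i)" using assms by (simp add: field_simps)
  then show ?thesis by (simp flip: power_mult_distrib)
qed

lemma op_bound_skew_truncation:
  assumes x: "\<And>i. Re (x i) = 0" "\<And>i. Re (xL i) = 0" and xL: "\<And>i. xL i = x i \<or> 1 / \<tau> < d i" and \<tau>: "0 < \<tau>"
  shows "op_bound n d 0 p (2 * \<tau> ^ p) (mexp n (scalem (of_real r) (diagm x)) \<sigma> - mexp n (scalem (of_real r) (diagm xL)) \<sigma>)"
proof -
  have "op_bound n d 0 p (2 * \<tau> ^ p) (diagm (\<lambda>i. exp (of_real \<sigma> * (of_real r * x i)) - exp (of_real \<sigma> * (of_real r * xL i))))"
  proof (rule op_bound_diagm)
    fix i
    show "(1 + d i) ^ 0 * cmod (exp (of_real \<sigma> * (of_real r * x i)) - exp (of_real \<sigma> * (of_real r * xL i)))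
      \<le> 2 * \<tau> ^ p * (1 + d i) ^ p"
    proof (cases "xL i = x i")
      case True
      then show ?thesis using \<tau> d_nonneg[of i] by simp
    next
      case False
      then have "1 \<le> \<tau> ^ p * (1 + d i) ^ p" using xL[of i] \<tau> by (intro high_frequency_weight) auto
      moreover have "cmod (exp (of_real \<sigma> * (of_real r * x i)) - exp (of_real \<sigma> * (of_real r * xL i))) \<le> 1 + 1"
        by (rule order_trans[OF norm_triangle_ineq4]) (simp add: x)
      ultimately show ?thesis by simp
    qed
  qed (use \<tau> in auto)
  then show ?thesis
    by (rule op_bound_cong[THEN iffD1, rotated]) (simp add: scalem_diagm mexp_diagm minus_apply diagm_apply)
qed

lemma trunc_quad_skew:
  assumes x: "\<And>i. Re (x i) = 0" "\<And>i. Re (xL i) = 0" and xL: "\<And>i. xL i = x i \<or> 1 / \<tau> < d i" and \<tau>: "0 < \<tau>"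
  shows "trunc_quad n d p \<tau> 2
    (mexp n (scalem (of_real r) (diagm x)) \<tau>) (mexp n (scalem (of_real r) (diagm x)) \<tau>)
    (mexp n (scalem (of_real r) (diagm xL)) \<tau>) (mexp n (scalem (of_real r) (diagm xL)) \<tau>)"
  unfolding trunc_quad_def
  by (intro conjI op_bound_mono[OF op_bound_mexp_skew[of x, OF x(1)], of 2]
      op_bound_mono[OF op_bound_mexp_skew[of xL, OF x(2)], of 2] op_bound_skew_truncation[OF x xL \<tau>])
    (use \<tau> in \<open>auto simp: op_bound_zero\<close>)

lemma trunc_quad_potential:
  assumes B: "op_bound n d 0 0 \<beta> B" "op_bound n d p p \<beta> B" and \<tau>: "0 < \<tau>" "\<tau> \<le> t"
  shows "trunc_quad n d p \<tau> (1 + exp (\<beta> * t) + \<beta> * exp (\<beta> * t)) (mexp n B \<tau>) (mexp n 0 \<tau>) (mexp n B \<tau>) (mexp n 0 \<tau>)"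
proof -
  have \<beta>: "0 \<le> \<beta>" using B by (simp add: op_bound_def)
  define k where "k = 1 + exp (\<beta> * t) + \<beta> * exp (\<beta> * t)"
  have k0: "0 \<le> k" using \<beta> by (auto simp: k_def add_nonneg_nonneg)
  have e: "exp (\<beta> * \<tau>) \<le> exp (\<beta> * t)" using \<beta> \<tau> by (auto intro: mult_left_mono)
  have le: "exp (\<beta> * \<tau>) \<le> k" using e \<beta> by (simp add: k_def add_increasing add_increasing2)
  have "\<beta> * exp (\<beta> * \<tau>) \<le> k"
    using mult_left_mono[OF e \<beta>] by (simp add: k_def add_increasing)
  then have le': "\<beta> * \<tau> * exp (\<beta> * \<tau>) \<le> k * \<tau>"
    using mult_right_mono[of "\<beta> * exp (\<beta> * \<tau>)" k \<tau>] \<tau> by (simp add: mult_ac)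
  have one: "op_bound n d l l k (mexp n 0 \<tau>)" for l
  proof -
    have "op_bound n d l l (exp (0 * \<tau>)) (mexp n 0 \<tau>)" by (rule op_bound_mexp) (use \<tau> in \<open>auto simp: op_bound_zero\<close>)
    then show ?thesis by (rule op_bound_mono) (use \<beta> in \<open>auto simp: k_def add_nonneg_nonneg\<close>)
  qed
  have "trunc_quad n d p \<tau> k (mexp n B \<tau>) (mexp n 0 \<tau>) (mexp n B \<tau>) (mexp n 0 \<tau>)"
    unfolding trunc_quad_def
    by (intro conjI op_bound_mono[OF op_bound_mexp[OF B(1)] le] op_bound_mono[OF op_bound_mexp[OF B(2)] le] one
        op_bound_mono[OF op_bound_mexp_diff[OF B(1)] le'] op_bound_mono[OF op_bound_mexp_diff[OF B(2)] le'])
      (use \<tau> k0 in \<open>auto simp: op_bound_zero\<close>)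
  then show ?thesis by (simp add: k_def)
qed

end

lemma trunc_quad_msplit:
  assumes \<beta>: "0 \<le> \<beta>"
  shows "\<exists>k\<ge>0. \<forall>n d x xL B \<tau>. weighted d \<longrightarrow> (\<forall>i. Re (x i) = 0) \<longrightarrow> (\<forall>i. Re (xL i) = 0) \<longrightarrow>
    (\<forall>i. xL i = x i \<or> 1 / \<tau> < d i) \<longrightarrow> op_bound n d 0 0 \<beta> B \<longrightarrow> op_bound n d p p \<beta> B \<longrightarrow> 0 < \<tau> \<longrightarrow> \<tau> \<le> t \<longrightarrow>
    trunc_quad n d p \<tau> k (msplit n s a b (diagm x) B \<tau>) (msplit n s a b (diagm x) 0 \<tau>)
      (msplit n s a b (diagm xL) B \<tau>) (msplit n s a b (diagm xL) 0 \<tau>)"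
proof (induction s)
  case 0
  show ?case
  proof (intro exI[of _ 1] conjI allI impI)
    fix n :: nat and d :: "nat \<Rightarrow> real" and x xL :: "nat \<Rightarrow> complex" and B :: cmatrix and \<tau> :: real
    assume "weighted d" and \<tau>: "0 < \<tau>"
    then interpret weighted n d by simp
    show "trunc_quad n d p \<tau> 1 (msplit n 0 a b (diagm x) B \<tau>) (msplit n 0 a b (diagm x) 0 \<tau>)
      (msplit n 0 a b (diagm xL) B \<tau>) (msplit n 0 a b (diagm xL) 0 \<tau>)"
      using \<tau> by (auto simp: trunc_quad_def op_bound_zero op_bound_one)
  qed simp
next
  case (Suc s)
  then obtain k where k: "0 \<le> k" and IH: "\<And>n d x xL B \<tau>. weighted d \<Longrightarrow> (\<forall>i. Re (x i) = 0) \<Longrightarrow> (\<forall>i. Re (xL i) = 0) \<Longrightarrow>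
    (\<forall>i. xL i = x i \<or> 1 / \<tau> < d i) \<Longrightarrow> op_bound n d 0 0 \<beta> B \<Longrightarrow> op_bound n d p p \<beta> B \<Longrightarrow> 0 < \<tau> \<Longrightarrow> \<tau> \<le> t \<Longrightarrow>
    trunc_quad n d p \<tau> k (msplit n s a b (diagm x) B \<tau>) (msplit n s a b (diagm x) 0 \<tau>)
      (msplit n s a b (diagm xL) B \<tau>) (msplit n s a b (diagm xL) 0 \<tau>)" by blast
  define \<beta>' where "\<beta>' = \<bar>b (Suc s)\<bar> * \<beta>"
  define kB where "kB = 1 + exp (\<beta>' * t) + \<beta>' * exp (\<beta>' * t)"
  show ?case
  proof (intro exI[of _ "4 * k * (4 * kB * 2)"] conjI allI impI)
    fix n :: nat and d :: "nat \<Rightarrow> real" and x xL :: "nat \<Rightarrow> complex" and B :: cmatrix and \<tau> :: real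
    assume w: "weighted d" and x: "\<forall>i. Re (x i) = 0" "\<forall>i. Re (xL i) = 0" and xL: "\<forall>i. xL i = x i \<or> 1 / \<tau> < d i"
      and B: "op_bound n d 0 0 \<beta> B" "op_bound n d p p \<beta> B" and \<tau>: "0 < \<tau>" "\<tau> \<le> t"
    interpret weighted n d by fact
    have "trunc_quad n d p \<tau> kB (mexp n (scalem (b (Suc s)) B) \<tau>) (mexp n 0 \<tau>) (mexp n (scalem (b (Suc s)) B) \<tau>) (mexp n 0 \<tau>)"
      unfolding kB_def
      using op_bound_scalem[OF B(1), of "of_real (b (Suc s))"] op_bound_scalem[OF B(2), of "of_real (b (Suc s))"]
      by (intro trunc_quad_potential \<tau>) (simp_all add: \<beta>'_def)
    moreover have "trunc_quad n d p \<tau> 2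
      (mexp n (scalem (of_real (a (Suc s))) (diagm x)) \<tau>) (mexp n (scalem (of_real (a (Suc s))) (diagm x)) \<tau>)
      (mexp n (scalem (of_real (a (Suc s))) (diagm xL)) \<tau>) (mexp n (scalem (of_real (a (Suc s))) (diagm xL)) \<tau>)"
      by (rule trunc_quad_skew) (use x xL \<tau> in auto)
    ultimately show "trunc_quad n d p \<tau> (4 * k * (4 * kB * 2))
      (msplit n (Suc s) a b (diagm x) B \<tau>) (msplit n (Suc s) a b (diagm x) 0 \<tau>)
      (msplit n (Suc s) a b (diagm xL) B \<tau>) (msplit n (Suc s) a b (diagm xL) 0 \<tau>)"
      unfolding msplit.simps scalem_zero
      by (intro trunc_quad_mmul IH w x xL B \<tau>)
  qed (use k \<beta> in \<open>auto simp: kB_def \<beta>'_def add_nonneg_nonneg\<close>)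
qed

section \<open>The energy estimate\<close>

context weighted
begin

text \<open>As x is imaginary, x f does not contribute to the derivative of the squared norm, whatever its
size: only B f and g do. The forcing enters linearly with the factor \<tau>, because in
2 N M \<le> N^2 / \<tau> + \<tau> M^2 the weights are adapted to the length of the interval; a fixed
weight would only give the square root of \<tau>. The price is the constant exp 1.\<close>

lemma energy_estimate:
  fixes f g :: "real \<Rightarrow> nat \<Rightarrow> complex"
  assumes x: "\<And>i. Re (x i) = 0" and B: "op_bound n d l l \<beta> B" and \<tau>: "0 < \<tau>"
    and der: "\<And>s i. 0 \<le> s \<Longrightarrow> s \<le> \<tau> \<Longrightarrow> i < n \<Longrightarrow>
      ((\<lambda>s. f s i) has_vector_derivative (x i * f s i + mapp n B (f s) i + g s i)) (at s within {0..\<tau>})"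
    and g: "\<And>s. 0 \<le> s \<Longrightarrow> s \<le> \<tau> \<Longrightarrow> wnorm n d l (g s) \<le> M"
    and s: "0 \<le> s" "s \<le> \<tau>"
  shows "wnorm n d l (f s) \<le> exp (\<beta> * \<tau> + 1) * (wnorm n d l (f 0) + \<tau> * M)"
proof -
  define w where "w = (\<lambda>i. (1 + d i) ^ l)"
  define N where "N = (\<lambda>s. wnorm n d l (f s))"
  define \<Phi> where "\<Phi> = (\<lambda>s. \<Sum>i<n. (w i)\<^sup>2 * (f s i \<bullet> f s i))"
  define \<kappa> where "\<kappa> = 2 * \<beta> + 1 / \<tau>"
  \<comment> \<open>nonincreasing on the interval, by the differential inequality for \<Phi>\<close>
  define \<psi> where "\<psi> = (\<lambda>s. exp (- \<kappa> * s) * \<Phi> s - \<tau> * M\<^sup>2 * s)"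
  have \<beta>: "0 \<le> \<beta>" using B by (simp add: op_bound_def)
  have M: "0 \<le> M" using g[of 0] \<tau> wnorm_nonneg[of n d l "g 0"] by linarith
  have \<kappa>0: "0 \<le> \<kappa>" using \<beta> \<tau> by (simp add: \<kappa>_def)
  have N0: "0 \<le> N s" for s by (simp add: N_def)
  have \<Phi>N: "\<Phi> s = (N s)\<^sup>2" for s
    by (simp add: \<Phi>_def N_def wnorm_def L2_set_def w_def sum_nonneg power_mult_distrib flip: power2_norm_eq_inner)
  define D where "D = (\<lambda>s. 2 * (\<Sum>i<n. (w i)\<^sup>2 * (f s i \<bullet> (mapp n B (f s) i + g s i))))"
  have der\<Phi>: "(\<Phi> has_real_derivative D s) (at s within {0..\<tau>})" if s: "0 \<le> s" "s \<le> \<tau>" for s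
  proof -
    have "((\<lambda>s. f s i \<bullet> f s i) has_vector_derivative 2 * (f s i \<bullet> (mapp n B (f s) i + g s i)))
        (at s within {0..\<tau>})" if i: "i < n" for i
    proof -
      have "f s i \<bullet> (x i * f s i) = Re (x i) * (cmod (f s i))\<^sup>2"
        unfolding cmod_power2 by (simp add: inner_complex_def power2_eq_square algebra_simps)
      then have "f s i \<bullet> (x i * f s i) = 0" using x by simp
      then show ?thesis
        using bounded_bilinear.has_vector_derivative[OF bounded_bilinear_inner der[OF s i] der[OF s i]]
        by (simp add: inner_add_right inner_add_left inner_commute algebra_simps)
    qed
    then have "((\<lambda>s. (w i)\<^sup>2 * (f s i \<bullet> f s i)) has_real_derivative
        (w i)\<^sup>2 * (2 * (f s i \<bullet> (mapp n B (f s) i + g s i)))) (at s within {0..\<tau>})" if "i < n" for i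
      using that by (intro DERIV_cmult) (auto simp: has_real_derivative_iff_has_vector_derivative)
    then have "(\<Phi> has_real_derivative (\<Sum>i<n. (w i)\<^sup>2 * (2 * (f s i \<bullet> (mapp n B (f s) i + g s i)))))
        (at s within {0..\<tau>})"
      unfolding \<Phi>_def by (intro DERIV_sum) auto
    then show ?thesis by (simp add: D_def sum_distrib_left mult_ac)
  qed
  have D_le: "D s \<le> \<kappa> * \<Phi> s + \<tau> * M\<^sup>2" if s: "0 \<le> s" "s \<le> \<tau>" for s
  proof -
    let ?h = "mapp n B (f s) + g s"
    have "(\<Sum>i<n. (w i)\<^sup>2 * (f s i \<bullet> (mapp n B (f s) i + g s i)))
        \<le> (\<Sum>i<n. \<bar>w i * cmod (f s i)\<bar> * \<bar>w i * cmod (?h i)\<bar>)"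
    proof (rule sum_mono)
      fix i
      have "(w i)\<^sup>2 * (f s i \<bullet> (mapp n B (f s) i + g s i)) \<le> (w i)\<^sup>2 * (cmod (f s i) * cmod (?h i))"
        using norm_cauchy_schwarz[of "f s i" "?h i"] by (intro mult_left_mono) (auto simp: fun_arith)
      also have "\<dots> = \<bar>w i * cmod (f s i)\<bar> * \<bar>w i * cmod (?h i)\<bar>"
        by (simp add: abs_mult power2_eq_square)
      finally show "(w i)\<^sup>2 * (f s i \<bullet> (mapp n B (f s) i + g s i))
          \<le> \<bar>w i * cmod (f s i)\<bar> * \<bar>w i * cmod (?h i)\<bar>" .
    qed
    also have "\<dots> \<le> N s * wnorm n d l ?h"
      unfolding N_def wnorm_def w_def by (rule L2_set_mult_ineq)
    also have "\<dots> \<le> N s * (\<beta> * N s + M)"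
    proof (rule mult_left_mono[OF _ N0])
      have "wnorm n d l ?h \<le> wnorm n d l (mapp n B (f s)) + wnorm n d l (g s)" by (rule wnorm_triangle)
      also have "\<dots> \<le> \<beta> * N s + M"
        using B g[OF s] by (intro add_mono) (auto simp: op_bound_def N_def)
      finally show "wnorm n d l ?h \<le> \<beta> * N s + M" .
    qed
    finally have "D s \<le> 2 * (N s * (\<beta> * N s + M))" by (simp add: D_def)
    moreover have "2 * (N s * M) \<le> (N s)\<^sup>2 / \<tau> + \<tau> * M\<^sup>2"
    proof -
      have "0 \<le> (N s - \<tau> * M)\<^sup>2 / \<tau>" using \<tau> by simp
      also have "\<dots> = (N s)\<^sup>2 / \<tau> + \<tau> * M\<^sup>2 - 2 * (N s * M)"
        using \<tau> by (simp add: field_simps power2_eq_square)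
      finally show ?thesis by simp
    qed
    ultimately show ?thesis
      by (simp add: \<kappa>_def \<Phi>N algebra_simps power2_eq_square)
  qed
  have der\<psi>: "(\<psi> has_real_derivative (exp (- \<kappa> * s) * (D s - \<kappa> * \<Phi> s) - \<tau> * M\<^sup>2)) (at s within {0..\<tau>})"
    if "0 \<le> s" "s \<le> \<tau>" for s
    unfolding \<psi>_def by (auto intro!: derivative_eq_intros der\<Phi> that simp: algebra_simps)
  have "\<psi> s \<le> \<psi> 0"
  proof (cases "s = 0")
    case False
    then have "0 < s" using s by simp
    have "\<exists>z\<in>{0<..<s}. \<psi> s - \<psi> 0 = (exp (- \<kappa> * z) * (D z - \<kappa> * \<Phi> z) - \<tau> * M\<^sup>2) * (s - 0)"
      using \<open>0 < s\<close>
    proof (rule mvt_simple)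
      fix z assume "0 \<le> z" "z \<le> s"
      then have "(\<psi> has_real_derivative (exp (- \<kappa> * z) * (D z - \<kappa> * \<Phi> z) - \<tau> * M\<^sup>2)) (at z within {0..s})"
        using s by (intro DERIV_subset[OF der\<psi>]) auto
      then show "(\<psi> has_derivative (\<lambda>h. (exp (- \<kappa> * z) * (D z - \<kappa> * \<Phi> z) - \<tau> * M\<^sup>2) * h)) (at z within {0..s})"
        by (simp add: has_field_derivative_def)
    qed
    then obtain z where z: "0 < z" "z < s"
      and eq: "\<psi> s - \<psi> 0 = (exp (- \<kappa> * z) * (D z - \<kappa> * \<Phi> z) - \<tau> * M\<^sup>2) * s"
      by auto
    have "exp (- \<kappa> * z) * (D z - \<kappa> * \<Phi> z) \<le> exp (- \<kappa> * z) * (\<tau> * M\<^sup>2)"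
      using D_le[of z] z s by (intro mult_left_mono) auto
    also have "\<dots> \<le> 1 * (\<tau> * M\<^sup>2)"
      using \<kappa>0 z \<tau> by (intro mult_right_mono) auto
    finally have "\<psi> s - \<psi> 0 \<le> 0"
      unfolding eq using \<open>0 < s\<close> by (intro mult_nonpos_nonneg) auto
    then show ?thesis by simp
  qed simp
  then have "exp (- \<kappa> * s) * \<Phi> s \<le> \<Phi> 0 + \<tau> * M\<^sup>2 * s"
    by (simp add: \<psi>_def)
  then have "exp (\<kappa> * s) * (exp (- \<kappa> * s) * \<Phi> s) \<le> exp (\<kappa> * s) * (\<Phi> 0 + \<tau> * M\<^sup>2 * s)"
    by (intro mult_left_mono) auto
  moreover have "exp (\<kappa> * s) * (exp (- \<kappa> * s) * \<Phi> s) = \<Phi> s"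
    unfolding mult.assoc[symmetric] by (simp add: mult_exp_exp)
  ultimately have "\<Phi> s \<le> exp (\<kappa> * s) * (\<Phi> 0 + \<tau> * M\<^sup>2 * s)" by (simp only:)
  also have "\<dots> \<le> exp (2 * (\<beta> * \<tau> + 1)) * (\<Phi> 0 + \<tau> * M\<^sup>2 * \<tau>)"
  proof (intro mult_mono add_mono mult_left_mono)
    have "\<kappa> * s \<le> \<kappa> * \<tau>" using s \<kappa>0 by (intro mult_left_mono) auto
    also have "\<dots> \<le> 2 * (\<beta> * \<tau> + 1)" using \<tau> by (simp add: \<kappa>_def field_simps)
    finally show "exp (\<kappa> * s) \<le> exp (2 * (\<beta> * \<tau> + 1))" by simp
  qed (use s \<tau> in \<open>auto simp: \<Phi>N\<close>)
  also have "\<Phi> 0 + \<tau> * M\<^sup>2 * \<tau> \<le> (N 0 + \<tau> * M)\<^sup>2"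
    using N0 \<tau> M by (simp add: \<Phi>N power2_eq_square algebra_simps)
  also have "exp (2 * (\<beta> * \<tau> + 1)) * (N 0 + \<tau> * M)\<^sup>2 = (exp (\<beta> * \<tau> + 1) * (N 0 + \<tau> * M))\<^sup>2"
    by (simp only: power_mult_distrib exp_double)
  finally have "(N s)\<^sup>2 \<le> (exp (\<beta> * \<tau> + 1) * (N 0 + \<tau> * M))\<^sup>2"
    by (simp add: \<Phi>N)
  then have "N s \<le> exp (\<beta> * \<tau> + 1) * (N 0 + \<tau> * M)"
    by (rule power2_le_imp_le) (use N0 \<tau> M in auto)
  then show ?thesis by (simp add: N_def)
qed

end

section \<open>Local and global error\<close>

lemma mapp_cong: "(\<And>j. j < n \<Longrightarrow> M i j = M' i j) \<Longrightarrow> mapp n M y i = mapp n M' y i"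
  by (simp add: mapp_def)

lemma mapp_vec_cong: "(\<And>j. j < n \<Longrightarrow> y j = z j) \<Longrightarrow> mapp n M y = mapp n M z"
  by (simp add: mapp_def)

context weighted
begin

text \<open>The same mixed difference for the exact flow. It satisfies a linear equation whose forcing consists
of the part of D that was cut off, applied to \<zeta> = flow - free evolution, and of the potential applied to
\<delta> = flow - cut-off flow. The energy estimate bounds \<zeta> by \<tau> on level p and
\<delta> by \<tau>^p on level 0, although the removed part of D alone only gives \<tau>^(p - 1); applied
once more it yields \<tau>^(p + 1).\<close>

lemma flow_truncation_error:
  fixes u :: "real \<Rightarrow> nat \<Rightarrow> complex"
  assumes x: "\<And>i. Re (x i) = 0" "\<And>i. cmod (x i) \<le> d i"
    and xL: "\<And>i. xL i = x i \<or> xL i = 0 \<and> 1 / \<tau> < d i"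
    and B: "op_bound n d 0 0 \<beta> B" "op_bound n d p p \<beta> B" and \<tau>: "0 < \<tau>" "\<tau> \<le> t" and p: "1 \<le> p"
    and der: "\<And>s i. 0 \<le> s \<Longrightarrow> s \<le> \<tau> \<Longrightarrow> i < n \<Longrightarrow>
      ((\<lambda>s. u s i) has_vector_derivative (x i * u s i + mapp n B (u s) i)) (at s within {0..\<tau>})"
  defines "G \<equiv> exp (\<beta> * t + 1)"
  shows "wnorm n d 0 (\<lambda>i. (u \<tau> i - exp (of_real \<tau> * x i) * u 0 i)
      - (mapp n (mexp n (diagm xL + B) \<tau>) (u 0) i - exp (of_real \<tau> * xL i) * u 0 i))
    \<le> exp 1 * \<beta> * (G + G\<^sup>2) * \<tau> ^ (p + 1) * wnorm n d p (u 0)"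
proof -
  have \<beta>: "0 \<le> \<beta>" using B by (simp add: op_bound_def)
  have G: "exp (\<beta> * \<tau> + 1) \<le> G" using \<beta> \<tau> by (auto simp: G_def intro: mult_left_mono)
  have G0: "0 \<le> G" by (simp add: G_def)
  define Y where "Y = wnorm n d p (u 0)"
  have Y0: "0 \<le> Y" by (simp add: Y_def)
  have rxL: "Re (xL i) = 0" for i using x(1)[of i] xL[of i] by auto
  define fL where "fL = (\<lambda>s. mapp n (mexp n (diagm xL + B) s) (u 0))"
  define ef where "ef = (\<lambda>w s i. exp (of_real s * w i) * u 0 i :: complex)"
  have ef_der: "((\<lambda>s. ef w s i) has_vector_derivative (w i * ef w s i)) (at s within S)" for w s i S
    unfolding ef_def
    by (rule has_vector_derivative_real_field[where f = "\<lambda>z. exp (z * w i) * u 0 i"])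
      (auto intro!: derivative_eq_intros)
  have fL_der: "((\<lambda>s. fL s i) has_vector_derivative (xL i * fL s i + mapp n B (fL s) i)) (at s within S)"
    if i: "i < n" for s i S
  proof -
    let ?M = "diagm xL + B"
    have "((\<lambda>s. \<Sum>j<n. mexp n ?M s i j * u 0 j) has_vector_derivative
        (\<Sum>j<n. mmul n ?M (mexp n ?M s) i j * u 0 j)) (at s within S)"
      using i by (intro has_vector_derivative_sum has_vector_derivative_mult_left mexp_has_vector_derivative) auto
    moreover have "(\<Sum>j<n. mmul n ?M (mexp n ?M s) i j * u 0 j) = mapp n ?M (fL s) i"
      unfolding fL_def mapp_mmul[symmetric] by (simp add: mapp_def)
    moreover have "\<dots> = xL i * fL s i + mapp n B (fL s) i"
      using i by (simp add: mapp_add plus_fun_apply mapp_diagm)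
    ultimately show ?thesis by (simp add: fL_def mapp_def)
  qed
  have start: "fL 0 i = u 0 i" "ef w 0 i = u 0 i" if "i < n" for i w
  proof -
    have "mapp n (mexp n (diagm xL + B) 0) (u 0) i = mapp n (diagm (\<lambda>_. 1)) (u 0) i"
      by (rule mapp_cong) (simp add: mexp_at_zero)
    with that show "fL 0 i = u 0 i" by (simp add: fL_def mapp_diagm)
  qed (simp add: ef_def)
  have zero: "wnorm n d l f = 0" if "\<And>i. i < n \<Longrightarrow> f i = 0" for l and f :: "nat \<Rightarrow> complex"
  proof -
    have "wnorm n d l f = wnorm n d l 0" by (rule wnorm_cong) (simp add: that fun_arith)
    then show ?thesis by simp
  qed
  have ef_norm: "wnorm n d l (ef x s) = wnorm n d l (u 0)" for l s
    by (simp add: wnorm_def ef_def norm_mult x)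
  have cut: "wnorm n d 0 (\<lambda>i. (x i - xL i) * z i) \<le> \<tau> ^ (p - 1) * wnorm n d p z" for z
  proof (rule wnorm_mono_term)
    fix i
    have "cmod (x i - xL i) \<le> \<tau> ^ (p - 1) * (1 + d i) ^ p"
    proof (cases "xL i = x i")
      case True
      then show ?thesis using \<tau> d_nonneg[of i] by simp
    next
      case False
      then have hi: "xL i = 0" "1 / \<tau> < d i" using xL[of i] by auto
      have "cmod (x i) * 1 \<le> (1 + d i) * (\<tau> ^ (p - 1) * (1 + d i) ^ (p - 1))"
        using x(2)[of i] d_nonneg[of i] \<tau> high_frequency_weight[OF hi(2) \<tau>(1), of "p - 1"]
        by (intro mult_mono) auto
      also have "\<dots> = \<tau> ^ (p - 1) * (1 + d i) ^ p"
        using p by (cases p) auto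
      finally show ?thesis using hi by simp
    qed
    from mult_right_mono[OF this, of "cmod (z i)"]
    show "(1 + d i) ^ 0 * cmod ((x i - xL i) * z i) \<le> \<tau> ^ (p - 1) * ((1 + d i) ^ p * cmod (z i))"
      by (simp add: norm_mult mult.assoc)
  qed (use \<tau> in auto)
  have u_bd: "wnorm n d p (u s) \<le> G * Y" if s: "0 \<le> s" "s \<le> \<tau>" for s
  proof -
    have "wnorm n d p (u s) \<le> exp (\<beta> * \<tau> + 1) * (wnorm n d p (u 0) + \<tau> * 0)"
      by (rule energy_estimate[where g = "\<lambda>_ _. 0" and x = x, OF x(1) B(2) \<tau>(1)])
        (use der s in \<open>auto simp: zero\<close>)
    also have "\<dots> \<le> G * Y" using G Y0 by (auto simp: Y_def intro: mult_right_mono)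
    finally show ?thesis .
  qed
  define \<zeta> where "\<zeta> = (\<lambda>s. u s - ef x s)"
  have \<zeta>_bd: "wnorm n d p (\<zeta> s) \<le> G * (\<tau> * (\<beta> * Y))" if s: "0 \<le> s" "s \<le> \<tau>" for s
  proof -
    have "wnorm n d p (\<zeta> s) \<le> exp (\<beta> * \<tau> + 1) * (wnorm n d p (\<zeta> 0) + \<tau> * (\<beta> * Y))"
    proof (rule energy_estimate[where g = "\<lambda>s. mapp n B (ef x s)" and x = x, OF x(1) B(2) \<tau>(1)])
      fix r i assume r: "0 \<le> r" "r \<le> \<tau>" and i: "i < n"
      show "((\<lambda>s. \<zeta> s i) has_vector_derivative (x i * \<zeta> r i + mapp n B (\<zeta> r) i + mapp n B (ef x r) i)) (at r within {0..\<tau>})"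
        using has_vector_derivative_diff[OF der[OF r i] ef_der[of x i r "{0..\<tau>}"]]
        by (simp add: \<zeta>_def mapp_vdiff minus_apply algebra_simps)
    next
      fix r
      show "wnorm n d p (mapp n B (ef x r)) \<le> \<beta> * Y"
        using op_bound_D[OF B(2), of "ef x r"] by (simp add: ef_norm Y_def)
    qed (use s in auto)
    also have "wnorm n d p (\<zeta> 0) = 0" by (rule zero) (simp add: \<zeta>_def start minus_apply)
    also have "exp (\<beta> * \<tau> + 1) * (0 + \<tau> * (\<beta> * Y)) \<le> G * (\<tau> * (\<beta> * Y))"
      using G Y0 \<tau> \<beta> by (auto intro: mult_right_mono)
    finally show ?thesis .
  qed
  define \<delta> where "\<delta> = (\<lambda>s. u s - fL s)"
  have \<delta>_bd: "wnorm n d 0 (\<delta> s) \<le> G * (\<tau> * (\<tau> ^ (p - 1) * (G * Y)))" if s: "0 \<le> s" "s \<le> \<tau>" for s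
  proof -
    have "wnorm n d 0 (\<delta> s) \<le> exp (\<beta> * \<tau> + 1) * (wnorm n d 0 (\<delta> 0) + \<tau> * (\<tau> ^ (p - 1) * (G * Y)))"
    proof (rule energy_estimate[where g = "\<lambda>s i. (x i - xL i) * u s i" and x = xL, OF rxL B(1) \<tau>(1)])
      fix r i assume r: "0 \<le> r" "r \<le> \<tau>" and i: "i < n"
      show "((\<lambda>s. \<delta> s i) has_vector_derivative (xL i * \<delta> r i + mapp n B (\<delta> r) i + (x i - xL i) * u r i)) (at r within {0..\<tau>})"
        using has_vector_derivative_diff[OF der[OF r i] fL_der[OF i, of r "{0..\<tau>}"]]
        by (simp add: \<delta>_def mapp_vdiff minus_apply algebra_simps)
    next
      fix r assume r: "0 \<le> r" "r \<le> \<tau>"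
      show "wnorm n d 0 (\<lambda>i. (x i - xL i) * u r i) \<le> \<tau> ^ (p - 1) * (G * Y)"
        by (rule order_trans[OF cut mult_left_mono[OF u_bd[OF r]]]) (use \<tau> in auto)
    qed (use s in auto)
    also have "wnorm n d 0 (\<delta> 0) = 0" by (rule zero) (simp add: \<delta>_def start minus_apply)
    also have "exp (\<beta> * \<tau> + 1) * (0 + \<tau> * (\<tau> ^ (p - 1) * (G * Y))) \<le> G * (\<tau> * (\<tau> ^ (p - 1) * (G * Y)))"
      using G Y0 \<tau> G0 by (auto intro: mult_right_mono)
    finally show ?thesis .
  qed
  \<comment> \<open>B is moved into the forcing, hence the zero matrix in the next estimate\<close>
  define \<eta> where "\<eta> = (\<lambda>s. \<zeta> s - (fL s - ef xL s))"
  define M where "M = \<tau> ^ (p - 1) * (G * (\<tau> * (\<beta> * Y))) + \<beta> * (G * (\<tau> * (\<tau> ^ (p - 1) * (G * Y))))"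
  have "wnorm n d 0 (\<eta> \<tau>) \<le> exp (0 * \<tau> + 1) * (wnorm n d 0 (\<eta> 0) + \<tau> * M)"
  proof (rule energy_estimate[where g = "\<lambda>s. (\<lambda>i. (x i - xL i) * \<zeta> s i) + mapp n B (\<delta> s)" and x = xL, OF rxL op_bound_zero \<tau>(1)])
    fix r i assume r: "0 \<le> r" "r \<le> \<tau>" and i: "i < n"
    have "mapp n (0 :: cmatrix) (\<eta> r) i = 0" by (simp add: mapp_def fun_arith)
    then show "((\<lambda>s. \<eta> s i) has_vector_derivative (xL i * \<eta> r i + mapp n (0 :: cmatrix) (\<eta> r) i
        + ((\<lambda>i. (x i - xL i) * \<zeta> r i) + mapp n B (\<delta> r)) i)) (at r within {0..\<tau>})"
      using has_vector_derivative_diff[OF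
          has_vector_derivative_diff[OF der[OF r i] ef_der[of x i r "{0..\<tau>}"]]
          has_vector_derivative_diff[OF fL_der[OF i, of r "{0..\<tau>}"] ef_der[of xL i r "{0..\<tau>}"]]]
      by (simp add: \<eta>_def \<zeta>_def \<delta>_def mapp_vdiff minus_apply plus_fun_apply algebra_simps)
  next
    fix r assume r: "0 \<le> r" "r \<le> \<tau>"
    have "wnorm n d 0 ((\<lambda>i. (x i - xL i) * \<zeta> r i) + mapp n B (\<delta> r))
      \<le> wnorm n d 0 (\<lambda>i. (x i - xL i) * \<zeta> r i) + wnorm n d 0 (mapp n B (\<delta> r))"
      by (rule wnorm_triangle)
    also have "\<dots> \<le> \<tau> ^ (p - 1) * wnorm n d p (\<zeta> r) + \<beta> * wnorm n d 0 (\<delta> r)"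
      by (intro add_mono cut op_bound_D B)
    also have "\<dots> \<le> M"
      unfolding M_def using \<tau> \<beta> by (intro add_mono mult_left_mono \<zeta>_bd \<delta>_bd r) auto
    finally show "wnorm n d 0 ((\<lambda>i. (x i - xL i) * \<zeta> r i) + mapp n B (\<delta> r)) \<le> M" .
  qed (use \<tau> in auto)
  also have "wnorm n d 0 (\<eta> 0) = 0" by (rule zero) (simp add: \<eta>_def \<zeta>_def start minus_apply)
  also have "exp (0 * \<tau> + 1) * (0 + \<tau> * M) = exp 1 * \<beta> * (G + G\<^sup>2) * \<tau> ^ (p + 1) * Y"
  proof -
    obtain q where "p = Suc q" using p by (cases p) auto
    then show ?thesis by (simp add: M_def algebra_simps power2_eq_square)
  qed
  finally show ?thesis
    by (simp add: \<eta>_def \<zeta>_def fL_def ef_def Y_def fun_diff_def)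
qed

end

definition flow_on :: "nat \<Rightarrow> (nat \<Rightarrow> complex) \<Rightarrow> cmatrix \<Rightarrow> real set \<Rightarrow> (real \<Rightarrow> nat \<Rightarrow> complex) \<Rightarrow> bool" where
  "flow_on n x B T u \<longleftrightarrow> (\<forall>s\<in>T. \<forall>i<n.
     ((\<lambda>s. u s i) has_vector_derivative (x i * u s i + mapp n B (u s) i)) (at s within T))"

text \<open>The local error is (mixed difference of the flow) - (mixed difference of the splitting) + (error
with D cut off), because flow and splitting share the free evolution with and without the cut-off.
Each of the three is at most a constant times \<tau>^(p + 1) on level p, and no constant involves
n or D.\<close>

lemma splitting_local_error:
  assumes order: "matrix_order s a b p" and p: "1 \<le> p" and \<beta>: "0 \<le> \<beta>" and t: "0 \<le> t"
  shows "\<exists>C\<ge>0. \<forall>n d x B \<tau> u. weighted d \<longrightarrow> (\<forall>i. Re (x i) = 0) \<longrightarrow> (\<forall>i. cmod (x i) \<le> d i) \<longrightarrow>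
    (\<forall>l\<le>p. op_bound n d l l \<beta> B) \<longrightarrow> 0 < \<tau> \<longrightarrow> \<tau> \<le> t \<longrightarrow> flow_on n x B {0..\<tau>} u \<longrightarrow>
    wnorm n d 0 (u \<tau> - mapp n (msplit n s a b (diagm x) B \<tau>) (u 0)) \<le> C * \<tau> ^ (p + 1) * wnorm n d p (u 0)"
proof -
  obtain C1 where C1: "0 \<le> C1" and low: "\<And>n d x B \<tau>. weighted d \<Longrightarrow> (\<forall>l\<le>p. op_bound n d l l (1 / \<tau>) (diagm x)) \<Longrightarrow>
    (\<forall>l<p. op_bound n d l (Suc l) 1 (diagm x)) \<Longrightarrow> (\<forall>l\<le>p. op_bound n d l l \<beta> B) \<Longrightarrow> 0 < \<tau> \<Longrightarrow> \<tau> \<le> t \<Longrightarrow>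
    op_bound n d 0 p (C1 * \<tau> ^ (p + 1)) (msplit n s a b (diagm x) B \<tau> - mexp n (diagm x + B) \<tau>)"
    using low_frequency_error[OF order p \<beta> t] by blast
  obtain C2 where C2: "0 \<le> C2" and quad: "\<And>n d x xL B \<tau>. weighted d \<Longrightarrow> (\<forall>i. Re (x i) = 0) \<Longrightarrow> (\<forall>i. Re (xL i) = 0) \<Longrightarrow>
    (\<forall>i. xL i = x i \<or> 1 / \<tau> < d i) \<Longrightarrow> op_bound n d 0 0 \<beta> B \<Longrightarrow> op_bound n d p p \<beta> B \<Longrightarrow> 0 < \<tau> \<Longrightarrow> \<tau> \<le> t \<Longrightarrow>
    trunc_quad n d p \<tau> C2 (msplit n s a b (diagm x) B \<tau>) (msplit n s a b (diagm x) 0 \<tau>)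
      (msplit n s a b (diagm xL) B \<tau>) (msplit n s a b (diagm xL) 0 \<tau>)"
    using trunc_quad_msplit[OF \<beta>, of p t s a b] by blast
  define G where "G = exp (\<beta> * t + 1)"
  define C3 where "C3 = exp 1 * \<beta> * (G + G\<^sup>2)"
  have C3: "0 \<le> C3" using \<beta> by (auto simp: C3_def G_def add_nonneg_nonneg)
  have S1: "(\<Sum>k=1..s. a k) = 1" by (rule order_sum_a[OF order p])
  show ?thesis
  proof (intro exI[of _ "C3 + C2 + C1"] conjI allI impI)
    fix n d x B \<tau> and u :: "real \<Rightarrow> nat \<Rightarrow> complex"
    assume w: "weighted d" and x: "\<forall>i. Re (x i) = 0" "\<forall>i. cmod (x i) \<le> d i"
      and B: "\<forall>l\<le>p. op_bound n d l l \<beta> B" and \<tau>: "0 < \<tau>" "\<tau> \<le> t" and u: "flow_on n x B {0..\<tau>} u"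
    interpret weighted n d by fact
    define xL where "xL = (\<lambda>i. if d i \<le> 1 / \<tau> then x i else 0)"
    define Y where "Y = wnorm n d p (u 0)"
    let ?S = "msplit n s a b (diagm x) B \<tau>" and ?E = "msplit n s a b (diagm x) 0 \<tau>"
    let ?SL = "msplit n s a b (diagm xL) B \<tau>" and ?EL = "msplit n s a b (diagm xL) 0 \<tau>"
    let ?TL = "mexp n (diagm xL + B) \<tau>"
    have xLb: "cmod (xL i) \<le> d i" "cmod (xL i) \<le> 1 / \<tau>" for i
      using x(2) \<tau> d_nonneg[of i] by (auto simp: xL_def intro: order_trans)
    have E: "mapp n (msplit n s a b (diagm w) 0 \<tau>) y i = exp (of_real \<tau> * w i) * y i" if "i < n" for w y i
    proof -
      have "mapp n (msplit n s a b (diagm w) 0 \<tau>) y i = mapp n (diagm (\<lambda>i. exp (of_real \<tau> * w i))) y i"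
        using that msplit_diagm[of i n _ s a b w \<tau>] unfolding S1 by (intro mapp_cong) simp
      then show ?thesis using that by (simp add: mapp_diagm)
    qed
    define \<eta> where "\<eta> = (\<lambda>i. (u \<tau> i - exp (of_real \<tau> * x i) * u 0 i)
      - (mapp n ?TL (u 0) i - exp (of_real \<tau> * xL i) * u 0 i))"
    have 1: "wnorm n d 0 \<eta> \<le> C3 * \<tau> ^ (p + 1) * Y"
      unfolding \<eta>_def C3_def G_def Y_def
    proof (rule flow_truncation_error)
      show "xL i = x i \<or> xL i = 0 \<and> 1 / \<tau> < d i" for i by (auto simp: xL_def)
      show "((\<lambda>s. u s i) has_vector_derivative (x i * u s i + mapp n B (u s) i)) (at s within {0..\<tau>})"
        if "0 \<le> s" "s \<le> \<tau>" "i < n" for s i using u that by (auto simp: flow_on_def)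
    qed (use x B \<tau> p in auto)
    have "trunc_quad n d p \<tau> C2 ?S ?E ?SL ?EL"
      using w x B \<tau> by (intro quad) (auto simp: xL_def)
    then have 2: "wnorm n d 0 (mapp n ((?S - ?E) - (?SL - ?EL)) (u 0)) \<le> C2 * \<tau> ^ (p + 1) * Y"
      unfolding Y_def by (intro op_bound_D) (simp add: trunc_quad_def)
    have "op_bound n d 0 p (C1 * \<tau> ^ (p + 1)) (?SL - ?TL)"
    proof (rule low[OF w _ _ B \<tau>])
      show "\<forall>l\<le>p. op_bound n d l l (1 / \<tau>) (diagm xL)"
      proof (intro allI impI op_bound_diagm)
        fix l i
        show "(1 + d i) ^ l * cmod (xL i) \<le> 1 / \<tau> * (1 + d i) ^ l"
          using mult_right_mono[OF xLb(2)[of i], of "(1 + d i) ^ l"] d_nonneg[of i] by (simp add: mult.commute)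
      qed (use \<tau> in auto)
      have "cmod (xL i) \<le> 1 + d i" for i using xLb(1)[of i] by simp
      then show "\<forall>l<p. op_bound n d l (Suc l) 1 (diagm xL)"
        using d_nonneg by (auto intro!: op_bound_diagm simp: mult.commute[of _ "cmod _"] intro!: mult_right_mono)
    qed
    then have 3: "wnorm n d 0 (mapp n (?SL - ?TL) (u 0)) \<le> C1 * \<tau> ^ (p + 1) * Y"
      unfolding Y_def by (rule op_bound_D)
    have "wnorm n d 0 (u \<tau> - mapp n ?S (u 0))
        = wnorm n d 0 (\<eta> - mapp n ((?S - ?E) - (?SL - ?EL)) (u 0) - mapp n (?SL - ?TL) (u 0))"
      by (rule wnorm_cong) (simp add: \<eta>_def mapp_diff fun_arith minus_apply E)
    also have "\<dots> \<le> wnorm n d 0 (\<eta> - mapp n ((?S - ?E) - (?SL - ?EL)) (u 0)) + wnorm n d 0 (mapp n (?SL - ?TL) (u 0))"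
      by (rule wnorm_diff)
    also have "\<dots> \<le> (wnorm n d 0 \<eta> + wnorm n d 0 (mapp n ((?S - ?E) - (?SL - ?EL)) (u 0))) + wnorm n d 0 (mapp n (?SL - ?TL) (u 0))"
      by (intro add_right_mono wnorm_diff)
    also have "\<dots> \<le> (C3 * \<tau> ^ (p + 1) * Y + C2 * \<tau> ^ (p + 1) * Y) + C1 * \<tau> ^ (p + 1) * Y"
      by (intro add_mono 1 2 3)
    finally show "wnorm n d 0 (u \<tau> - mapp n ?S (u 0)) \<le> (C3 + C2 + C1) * \<tau> ^ (p + 1) * wnorm n d p (u 0)"
      by (simp add: Y_def distrib_right)
  qed (use C1 C2 C3 in auto)
qed

lemma flow_on_shift:
  assumes "flow_on n x B {0..} u" "0 \<le> r"
  shows "flow_on n x B {0..\<tau>} (\<lambda>s. u (r + s))"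
  unfolding flow_on_def
proof (intro ballI allI impI)
  fix s i assume s: "s \<in> {0..\<tau>}" and i: "i < n"
  have "((\<lambda>s. u s i) has_vector_derivative (x i * u (r + s) i + mapp n B (u (r + s)) i)) (at (r + s) within {0..})"
    using assms s i by (auto simp: flow_on_def)
  then have "((\<lambda>s. u s i) has_vector_derivative (x i * u (r + s) i + mapp n B (u (r + s)) i))
      (at (r + s) within (\<lambda>s. r + s) ` {0..\<tau>})"
    by (rule has_vector_derivative_within_subset) (use assms in auto)
  moreover have "((\<lambda>s. r + s) has_vector_derivative 1) (at s within {0..\<tau>})"
    by (auto intro!: derivative_eq_intros)
  ultimately show "((\<lambda>s. u (r + s) i) has_vector_derivative (x i * u (r + s) i + mapp n B (u (r + s)) i)) (at s within {0..\<tau>})"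
    using vector_diff_chain_within[of "\<lambda>s. r + s" 1 s "{0..\<tau>}" "\<lambda>s. u s i"] by (simp add: o_def)
qed

text \<open>Local errors are propagated by the splitting, whose norm is at most exp (c \<tau>) per step since D only
contributes rotations. They are measured along the exact solution, whose level-p norm is controlled
by the energy estimate. There are t / \<tau> of them, so one power of \<tau> is lost.\<close>

lemma splitting_global_error:
  assumes order: "matrix_order s a b p" and p: "1 \<le> p" and \<beta>: "0 \<le> \<beta>"
  shows "\<exists>C C'. \<forall>n d x B \<tau> u v m. weighted d \<longrightarrow> (\<forall>i. Re (x i) = 0) \<longrightarrow> (\<forall>i. cmod (x i) \<le> d i) \<longrightarrow>
    (\<forall>l\<le>p. op_bound n d l l \<beta> B) \<longrightarrow> 0 < \<tau> \<longrightarrow> real m * \<tau> = t \<longrightarrow> flow_on n x B {0..} u \<longrightarrow>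
    (\<forall>k. v (Suc k) = mapp n (msplit n s a b (diagm x) B \<tau>) (v k)) \<longrightarrow>
    wnorm n d 0 (u t - v m) \<le> C * wnorm n d 0 (u 0 - v 0) + C' * \<tau> ^ p * wnorm n d p (u 0)"
proof (cases "0 \<le> t")
  case False
  then have "\<not> (0 < \<tau> \<and> real m * \<tau> = t)" for \<tau> m by (auto simp: zero_le_mult_iff)
  then show ?thesis by blast
next
  case t: True
  obtain K where K: "0 \<le> K" and loc: "\<And>n d x B \<tau> u. weighted d \<Longrightarrow> (\<forall>i. Re (x i) = 0) \<Longrightarrow> (\<forall>i. cmod (x i) \<le> d i) \<Longrightarrow>
    (\<forall>l\<le>p. op_bound n d l l \<beta> B) \<Longrightarrow> 0 < \<tau> \<Longrightarrow> \<tau> \<le> t \<Longrightarrow> flow_on n x B {0..\<tau>} u \<Longrightarrow>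
    wnorm n d 0 (u \<tau> - mapp n (msplit n s a b (diagm x) B \<tau>) (u 0)) \<le> K * \<tau> ^ (p + 1) * wnorm n d p (u 0)"
    using splitting_local_error[OF order p \<beta> t] by blast
  define c where "c = (\<Sum>k=1..s. \<bar>b k\<bar>) * \<beta>"
  define G where "G = exp (\<beta> * t + 1)"
  have c: "0 \<le> c" using \<beta> by (auto simp: c_def intro: mult_nonneg_nonneg sum_nonneg)
  show ?thesis
  proof (rule exI[of _ "exp (c * t)"], rule exI[of _ "exp (c * t) * (t * K * G)"], intro allI impI)
    fix n d x B \<tau> and u :: "real \<Rightarrow> nat \<Rightarrow> complex" and v :: "nat \<Rightarrow> nat \<Rightarrow> complex" and m
    assume w: "weighted d" and x: "\<forall>i. Re (x i) = 0" "\<forall>i. cmod (x i) \<le> d i"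
      and B: "\<forall>l\<le>p. op_bound n d l l \<beta> B" and \<tau>: "0 < \<tau>" and m: "real m * \<tau> = t" and u: "flow_on n x B {0..} u"
      and v: "\<forall>k. v (Suc k) = mapp n (msplit n s a b (diagm x) B \<tau>) (v k)"
    interpret weighted n d by fact
    let ?S = "msplit n s a b (diagm x) B \<tau>"
    define Y where "Y = wnorm n d p (u 0)"
    define e0 where "e0 = wnorm n d 0 (u 0 - v 0)"
    have Y0: "0 \<le> Y" "0 \<le> e0" by (auto simp: Y_def e0_def)
    have u_bd: "wnorm n d p (u r) \<le> G * Y" if r: "0 \<le> r" "r \<le> t" for r
    proof (cases "t = 0")
      case True
      then have "r = 0" using r by simp
      have "1 * Y \<le> G * Y" using True Y0 by (intro mult_right_mono) (auto simp: G_def)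
      then show ?thesis using \<open>r = 0\<close> by (simp add: Y_def)
    next
      case False
      have "flow_on n x B {0..t} u" using flow_on_shift[OF u, of 0 t] by simp
      then have "wnorm n d p (u r) \<le> exp (\<beta> * t + 1) * (wnorm n d p (u 0) + t * 0)"
        by (intro energy_estimate[where g = "\<lambda>_ _. 0" and x = x and B = B])
          (use r t x B False in \<open>auto simp: flow_on_def wnorm_def L2_set_def\<close>)
      then show ?thesis by (simp add: G_def Y_def)
    qed
    have S_bd: "wnorm n d 0 (mapp n ?S y) \<le> exp (c * \<tau>) * wnorm n d 0 y" for y
      unfolding c_def by (rule op_bound_D[OF op_bound_msplit]) (use x B \<tau> in auto)
    have E1: "1 \<le> exp (c * \<tau>)" using c \<tau> by simp
    have "k \<le> m \<Longrightarrow> wnorm n d 0 (u (real k * \<tau>) - v k) \<le> exp (c * \<tau>) ^ k * (e0 + real k * (K * \<tau> ^ (p + 1) * (G * Y)))" for k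
    proof (induction k)
      case 0
      then show ?case by (simp add: e0_def)
    next
      case (Suc k)
      define L where "L = K * \<tau> ^ (p + 1) * (G * Y)"
      have L0: "0 \<le> L" using K \<tau> Y0 by (simp add: L_def G_def)
      have kt: "real k * \<tau> \<le> t" "\<tau> \<le> t" "0 \<le> real k * \<tau>"
        using Suc.prems m \<tau> mult_right_mono[of "real k" "real m" \<tau>] mult_right_mono[of 1 "real m" \<tau>] by auto
      have next_t: "real (Suc k) * \<tau> = real k * \<tau> + \<tau>" by (simp add: distrib_right)
      have "wnorm n d 0 (u (real k * \<tau> + \<tau>) - mapp n ?S (u (real k * \<tau> + 0))) \<le> K * \<tau> ^ (p + 1) * wnorm n d p (u (real k * \<tau> + 0))"
        by (rule loc[OF w x B \<tau> kt(2) flow_on_shift[OF u kt(3)]])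
      also have "\<dots> \<le> L"
        unfolding L_def using u_bd[OF kt(3,1)] K \<tau> by (intro mult_left_mono) auto
      finally have 1: "wnorm n d 0 (u (real (Suc k) * \<tau>) - mapp n ?S (u (real k * \<tau>))) \<le> L"
        unfolding next_t by simp
      have "u (real (Suc k) * \<tau>) - v (Suc k)
          = (u (real (Suc k) * \<tau>) - mapp n ?S (u (real k * \<tau>))) + mapp n ?S (u (real k * \<tau>) - v k)"
        using v by (simp add: mapp_vdiff)
      then have "wnorm n d 0 (u (real (Suc k) * \<tau>) - v (Suc k))
          \<le> wnorm n d 0 (u (real (Suc k) * \<tau>) - mapp n ?S (u (real k * \<tau>))) + wnorm n d 0 (mapp n ?S (u (real k * \<tau>) - v k))"
        using wnorm_triangle by metis
      also have "\<dots> \<le> L + exp (c * \<tau>) * (exp (c * \<tau>) ^ k * (e0 + real k * L))"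
        using Suc by (intro add_mono 1 order_trans[OF S_bd] mult_left_mono) (auto simp: L_def)
      finally have "wnorm n d 0 (u (real (Suc k) * \<tau>) - v (Suc k))
          \<le> L + exp (c * \<tau>) * (exp (c * \<tau>) ^ k * (e0 + real k * L))" .
      moreover have "L \<le> exp (c * \<tau>) ^ Suc k * L"
        using mult_right_mono[OF one_le_power[OF E1, of "Suc k"] L0] by simp
      moreover have "exp (c * \<tau>) ^ Suc k * (e0 + real (Suc k) * L)
          = exp (c * \<tau>) ^ Suc k * L + exp (c * \<tau>) * (exp (c * \<tau>) ^ k * (e0 + real k * L))"
        by (simp add: algebra_simps)
      ultimately show ?case unfolding L_def[symmetric] by linarith
    qed
    from this[of m] have "wnorm n d 0 (u t - v m) \<le> exp (c * \<tau>) ^ m * (e0 + real m * (K * \<tau> ^ (p + 1) * (G * Y)))"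
      using m by simp
    also have "exp (c * \<tau>) ^ m = exp (c * t)"
      using m by (simp add: mult_ac flip: exp_of_nat_mult)
    also have "real m * (K * \<tau> ^ (p + 1) * (G * Y)) = t * (K * \<tau> ^ p * (G * Y))"
      by (simp flip: m)
    finally show "wnorm n d 0 (u t - v m) \<le> exp (c * t) * wnorm n d 0 (u 0 - v 0)
        + exp (c * t) * (t * K * G) * \<tau> ^ p * wnorm n d p (u 0)"
      by (simp add: Y_def e0_def algebra_simps)
  qed
qed

section \<open>Fourier inversion on the torus\<close>

definition torus_char :: "int ^ 'd \<Rightarrow> real ^ 'd \<Rightarrow> complex" where
  "torus_char h x = exp (2 * pi * \<i> * complex_of_real (inner (rvec h) x))"

lemma rvec_add: "rvec (h + k) = rvec h + rvec k"
  by (simp add: rvec_def Finite_Cartesian_Product.vec_eq_iff)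
lemma rvec_minus: "rvec (- h) = - rvec h"
  by (simp add: rvec_def Finite_Cartesian_Product.vec_eq_iff)
lemma rvec_zero [simp]: "rvec 0 = 0"
  by (simp add: rvec_def Finite_Cartesian_Product.vec_eq_iff)
lemma torus_char_mult: "torus_char h x * torus_char k x = torus_char (h + k) x"
  by (simp add: torus_char_def rvec_add inner_add_left distrib_left flip: exp_add)

lemma torus_char_zero [simp]: "torus_char 0 x = 1"
  by (simp add: torus_char_def)

lemma norm_torus_char [simp]: "cmod (torus_char h x) = 1"
  by (simp add: torus_char_def norm_exp_eq_Re)

lemma continuous_torus_char: "continuous_on S (torus_char h)"
  unfolding torus_char_def by (intro continuous_intros)

lemma fourier_coeff_eq_integral:
  assumes "continuous_on (cbox 0 1) f"
  shows "fourier_coeff f h = integral (cbox 0 1) (\<lambda>x. f x * torus_char (- h) x)"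
proof -
  have "continuous_on (cbox 0 1) (\<lambda>x. f x * torus_char (- h) x)"
    by (intro continuous_intros assms continuous_torus_char)
  then have "set_integrable lebesgue (cbox 0 1) (\<lambda>x. f x * torus_char (- h) x)"
    by (rule absolutely_integrable_continuous)
  then have "(LINT x:cbox 0 1|lebesgue. f x * torus_char (- h) x) = integral (cbox 0 1) (\<lambda>x. f x * torus_char (- h) x)"
    by (rule set_lebesgue_integral_eq_integral)
  then show ?thesis by (simp add: fourier_coeff_def torus_char_def rvec_minus)
qed

lemma exp_2pi_int: "exp (2 * pi * \<i> * complex_of_int m) = 1"
  using exp_integer_2pi[of "of_int m"] by (simp add: mult_ac)

lemma integral_unit_interval_torus_char:
  fixes k :: int
  shows "(LINT t|lborel. indicator {0..1} t *\<^sub>R exp (2 * pi * \<i> * of_real (real_of_int k * t)))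
      = (if k = 0 then 1 else 0 :: complex)"
    and "integrable lborel (\<lambda>t. indicator {0..1} t *\<^sub>R exp (2 * pi * \<i> * complex_of_real (real_of_int k * t)))"
proof -
  let ?f = "\<lambda>t. exp (2 * pi * \<i> * complex_of_real (real_of_int k * t))"
  have int: "set_integrable lborel {0..1} ?f"
    by (intro borel_integrable_atLeastAtMost' continuous_intros)
  then show "integrable lborel (\<lambda>t. indicator {0..1} t *\<^sub>R ?f t)" by (simp add: set_integrable_def)
  have "(LINT t|lborel. indicator {0..1} t *\<^sub>R ?f t) = integral {0..1} ?f"
    using set_borel_integral_eq_integral(2)[OF int] by (simp add: set_lebesgue_integral_def)
  also have "\<dots> = (if k = 0 then 1 else 0)"
  proof (cases "k = 0")
    case False
    let ?c = "2 * pi * \<i> * complex_of_int k"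
    have c: "?c \<noteq> 0" using False by simp
    have "(?f has_integral (exp (?c * of_real 1) / ?c - exp (?c * of_real 0) / ?c)) {0..1}"
    proof (rule fundamental_theorem_of_calculus)
      fix t :: real
      have "((\<lambda>z. exp (?c * z) / ?c) has_field_derivative exp (?c * of_real t)) (at (of_real t))"
        using c by (auto intro!: derivative_eq_intros)
      then show "((\<lambda>t. exp (?c * of_real t) / ?c) has_vector_derivative ?f t) (at t within {0..1})"
        by (drule_tac has_vector_derivative_real_field) (simp add: mult.assoc)
    qed simp
    moreover have "exp (?c * of_real 1) = 1"
      using exp_integer_2pi[of "of_int k"] by (simp add: mult_ac)
    ultimately have "(?f has_integral 0) {0..1}" by simp
    then show ?thesis using False by (simp add: integral_unique)
  qed simp
  finally show "(LINT t|lborel. indicator {0..1} t *\<^sub>R ?f t) = (if k = 0 then 1 else 0)" .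
qed

text \<open>The integral factors over the coordinates, and a coordinate with nonzero frequency gives the factor 0.\<close>

lemma integral_torus_char: "integral (cbox 0 1) (torus_char (h :: int ^ 'd)) = (if h = 0 then 1 else 0)"
proof -
  interpret product_sigma_finite "\<lambda>b :: real ^ 'd. lborel :: real measure"
    by (rule product_sigma_finite.intro) (rule sigma_finite_lborel)
  define g where "g = (\<lambda>(b :: real ^ 'd) t :: real. indicator {0..1} t *\<^sub>R
    exp (2 * pi * \<i> * complex_of_real ((rvec h \<bullet> b) * t)))"
  have hb: "\<exists>k::int. rvec h \<bullet> b = real_of_int k" if b: "b \<in> Basis" for b :: "real ^ 'd"
  proof -
    obtain i where "b = axis i 1" using b by (auto simp: Basis_vec_def)
    then show ?thesis by (auto simp: inner_axis rvec_def)
  qed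
  have int: "integrable lborel (g b)" if "b \<in> Basis" for b
    using hb[OF that] integral_unit_interval_torus_char(2) by (auto simp: g_def)
  have val: "integral\<^sup>L lborel (g b) = (if rvec h \<bullet> b = 0 then 1 else 0)" if b: "b \<in> Basis" for b
  proof -
    obtain k :: int where k: "rvec h \<bullet> b = real_of_int k" using hb[OF b] by blast
    show ?thesis using integral_unit_interval_torus_char(1)[of k] by (simp add: g_def k)
  qed
  have prod_eq: "indicator (cbox 0 1) x *\<^sub>R torus_char h x = (\<Prod>b\<in>Basis. g b (x \<bullet> b))" for x
  proof -
    have one: "(1 :: real ^ 'd) \<bullet> b = 1" if b: "b \<in> Basis" for b
    proof -
      obtain i where "b = axis i 1" using b by (auto simp: Basis_vec_def)
      then show ?thesis by (auto simp: inner_axis)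
    qed
    have "(indicator (cbox 0 1) x :: real) = (\<Prod>b\<in>Basis. indicator {0..1} (x \<bullet> b))"
    proof (cases "x \<in> cbox 0 1")
      case True
      then show ?thesis by (simp add: mem_box one)
    next
      case False
      then obtain b where "b \<in> Basis" "x \<bullet> b \<notin> {0..1}" by (auto simp: mem_box one)
      then have "(\<Prod>b\<in>Basis. indicator {0..1} (x \<bullet> b) :: real) = 0"
        by (intro prod_zero bexI[of _ b]) (simp_all add: indicator_def)
      with False show ?thesis by simp
    qed
    moreover have "torus_char h x = (\<Prod>b\<in>Basis. exp (2 * pi * \<i> * complex_of_real ((rvec h \<bullet> b) * (x \<bullet> b))))"
      unfolding torus_char_def by (subst euclidean_inner) (simp add: exp_sum sum_distrib_left)
    ultimately show ?thesis
      by (simp add: g_def scaleR_conv_of_real prod.distrib)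
  qed
  have cont: "continuous_on (cbox 0 1) (torus_char h)" by (rule continuous_torus_char)
  have "integral (cbox 0 1) (torus_char h) = (LINT x:cbox 0 1|lborel. torus_char h x)"
    by (rule set_borel_integral_eq_integral(2)[symmetric])
      (use borel_integrable_compact[OF compact_cbox cont] in \<open>simp add: set_integrable_def\<close>)
  also have "\<dots> = (LINT x|lborel. (\<Prod>b\<in>Basis. g b (x \<bullet> b)))"
    by (simp add: set_lebesgue_integral_def prod_eq)
  also have "\<dots> = (LINT f|(\<Pi>\<^sub>M b\<in>Basis. lborel). (\<Prod>b\<in>Basis. g b ((\<Sum>b\<in>Basis. f b *\<^sub>R b) \<bullet> b)))"
  proof (subst lborel_eq, rule integral_distr)
    show "(\<lambda>f. \<Sum>b\<in>Basis. f b *\<^sub>R b) \<in> measurable (\<Pi>\<^sub>M b\<in>Basis. lborel) borel" by measurable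
    show "(\<lambda>x. \<Prod>b\<in>Basis. g b (x \<bullet> b)) \<in> borel_measurable borel"
      unfolding g_def by measurable
  qed
  also have "\<dots> = (LINT f|(\<Pi>\<^sub>M b\<in>Basis. lborel). (\<Prod>b\<in>Basis. g b (f b)))"
    by (intro Bochner_Integration.integral_cong prod.cong refl) (simp add: inner_sum_left_Basis)
  also have "\<dots> = (\<Prod>b\<in>Basis. integral\<^sup>L lborel (g b))"
    by (rule product_integral_prod) (auto intro: int)
  also have "\<dots> = (if h = 0 then 1 else 0)"
  proof (cases "h = 0")
    case True
    then show ?thesis by (simp add: val)
  next
    case False
    then obtain i where i: "vec_nth h i \<noteq> 0" by (auto simp: Finite_Cartesian_Product.vec_eq_iff)
    have "(\<Prod>b\<in>Basis. integral\<^sup>L lborel (g b)) = 0"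
    proof (rule prod_zero)
      have "axis i 1 \<in> (Basis :: (real ^ 'd) set)" by (auto simp: Basis_vec_def)
      moreover have "rvec h \<bullet> axis i 1 \<noteq> 0" using i by (simp add: inner_axis rvec_def)
      ultimately show "\<exists>b\<in>Basis. integral\<^sup>L lborel (g b) = 0" using val by fastforce
    qed simp
    with False show ?thesis by simp
  qed
  finally show ?thesis .
qed

text \<open>Trigonometric polynomials, generated by the characters; induction reduces orthogonality and
continuity to characters.\<close>

inductive trig_poly :: "(real ^ 'd \<Rightarrow> complex) \<Rightarrow> bool" where
  torus_char: "trig_poly (\<lambda>x. c * torus_char h x)"
| add: "trig_poly f \<Longrightarrow> trig_poly g \<Longrightarrow> trig_poly (\<lambda>x. f x + g x)"

lemma trig_poly_const: "trig_poly (\<lambda>x. c)"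
  using trig_poly.torus_char[of c 0] by simp

lemma trig_poly_mult: "trig_poly f \<Longrightarrow> trig_poly g \<Longrightarrow> trig_poly (\<lambda>x. f x * g x)"
proof (induction rule: trig_poly.induct)
  case (torus_char c h)
  from torus_char show ?case
  proof (induction rule: trig_poly.induct)
    case (torus_char c' k)
    have "(\<lambda>x. c * torus_char h x * (c' * torus_char k x)) = (\<lambda>x. (c * c') * torus_char (h + k) x)"
      by (simp add: fun_eq_iff flip: torus_char_mult)
    then show ?case using trig_poly.torus_char by metis
  next
    case (add f g)
    then show ?case by (simp add: distrib_left trig_poly.add)
  qed
next
  case (add f f')
  then show ?case by (simp add: distrib_right trig_poly.add)
qed

lemma trig_poly_sum: "(\<And>i. i \<in> I \<Longrightarrow> trig_poly (f i)) \<Longrightarrow> trig_poly (\<lambda>x. \<Sum>i\<in>I. f i x)"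
  by (induction I rule: infinite_finite_induct) (auto intro: trig_poly.add trig_poly_const)

lemma continuous_trig_poly: "trig_poly f \<Longrightarrow> continuous_on S f"
  by (induction rule: trig_poly.induct) (auto intro!: continuous_intros continuous_torus_char)

text \<open>This map identifies exactly the points that differ by integers, so periodic functions descend to its
image, and polynomials on the ambient space pull back to trigonometric polynomials.\<close>

definition torus_embedding :: "real ^ 'd \<Rightarrow> complex ^ 'd" where
  "torus_embedding x = (\<chi> j. cis (2 * pi * vec_nth x j))"

lemma cis_coordinate: "cis (2 * pi * vec_nth x j) = torus_char (axis j 1) x" "cis (- (2 * pi * vec_nth x j)) = torus_char (- axis j 1) x"
proof -
  have "rvec (axis j 1) = axis j 1" by (auto simp add: rvec_def axis_def Finite_Cartesian_Product.vec_eq_iff)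
  then show "cis (2 * pi * vec_nth x j) = torus_char (axis j 1) x" "cis (- (2 * pi * vec_nth x j)) = torus_char (- axis j 1) x"
    by (simp_all add: torus_char_def cis_conv_exp inner_axis' rvec_minus mult_ac)
qed

lemma trig_poly_coordinates:
  "trig_poly (\<lambda>x. of_real (Re (vec_nth (torus_embedding x) j)))"
  "trig_poly (\<lambda>x. of_real (Im (vec_nth (torus_embedding x) j)))"
proof -
  have "(\<lambda>x. of_real (Re (vec_nth (torus_embedding x) j))) = (\<lambda>x. 1 / 2 * torus_char (axis j 1) x + 1 / 2 * torus_char (- axis j 1) x)"
    by (simp add: torus_embedding_def fun_eq_iff complex_eq_iff flip: cis_coordinate)
  then show "trig_poly (\<lambda>x. of_real (Re (vec_nth (torus_embedding x) j)))"
    by (simp only:) (intro trig_poly.intros)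
  have "(\<lambda>x. of_real (Im (vec_nth (torus_embedding x) j))) = (\<lambda>x. (- \<i> / 2) * torus_char (axis j 1) x + \<i> / 2 * torus_char (- axis j 1) x)"
    by (simp add: torus_embedding_def fun_eq_iff complex_eq_iff flip: cis_coordinate)
  then show "trig_poly (\<lambda>x. of_real (Im (vec_nth (torus_embedding x) j)))"
    by (simp only:) (intro trig_poly.intros)
qed

lemma trig_poly_of_polynomial:
  fixes q :: "complex ^ 'd \<Rightarrow> real"
  assumes "real_polynomial_function q"
  shows "trig_poly (\<lambda>x. of_real (q (torus_embedding x)))"
  using assms
proof (induction rule: real_polynomial_function.induct)
  case (linear f)
  then interpret bounded_linear f .
  have decomp: "y = (\<Sum>j\<in>UNIV. Re (vec_nth y j) *\<^sub>R axis j 1 + Im (vec_nth y j) *\<^sub>R axis j \<i>)" for y :: "complex ^ 'd"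
  proof -
    have "vec_nth (\<Sum>j\<in>UNIV. Re (vec_nth y j) *\<^sub>R axis j 1 + Im (vec_nth y j) *\<^sub>R axis j \<i>) i
      = (\<Sum>j\<in>UNIV. if i = j then Re (vec_nth y i) *\<^sub>R 1 + Im (vec_nth y i) *\<^sub>R \<i> else 0)" for i
      unfolding sum_component by (rule sum.cong) (auto simp: axis_def)
    then show ?thesis
      by (simp add: Finite_Cartesian_Product.vec_eq_iff complex_eq_iff)
  qed
  have rep: "f y = (\<Sum>j\<in>UNIV. Re (vec_nth y j) * f (axis j 1) + Im (vec_nth y j) * f (axis j \<i>))" for y
    using arg_cong[OF decomp[of y], of f] by (simp only: sum add scaleR real_scaleR_def)
  have "(\<lambda>x. complex_of_real (f (torus_embedding x)))
      = (\<lambda>x. \<Sum>j\<in>UNIV. of_real (Re (vec_nth (torus_embedding x) j)) * of_real (f (axis j 1))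
          + of_real (Im (vec_nth (torus_embedding x) j)) * of_real (f (axis j \<i>)))"
    by (rule ext, subst rep) simp
  then show ?case
    by (simp only:) (intro trig_poly_sum trig_poly.add trig_poly_mult trig_poly_coordinates trig_poly_const)
next
  case (const c)
  show ?case by (rule trig_poly_const)
next
  case (add f g)
  then show ?case by (simp add: trig_poly.add)
next
  case (mult f g)
  then show ?case by (simp add: trig_poly_mult)
qed

lemma torus_embedding_eq_imp:
  assumes "torus_embedding x = torus_embedding y" "torus_periodic f"
  shows "f x = f y"
proof -
  have "\<exists>k::int. vec_nth x j = vec_nth y j + of_int k" for j
  proof -
    have "cis (2 * pi * vec_nth x j) = cis (2 * pi * vec_nth y j)"
      using assms(1) by (simp add: torus_embedding_def Finite_Cartesian_Product.vec_eq_iff)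
    then have "exp (\<i> * (2 * pi * vec_nth x j)) = exp (\<i> * (2 * pi * vec_nth y j))"
      by (simp add: cis_conv_exp)
    then obtain m :: int where "\<i> * (2 * pi * vec_nth x j) = \<i> * (2 * pi * vec_nth y j) + (of_int (2 * m) * pi) * \<i>"
      unfolding exp_eq by auto
    then have "2 * pi * vec_nth x j = 2 * pi * vec_nth y j + 2 * of_int m * pi"
      by (auto simp: complex_eq_iff)
    then have "2 * pi * vec_nth x j = 2 * pi * (vec_nth y j + of_int m)" by (simp add: algebra_simps)
    then have "vec_nth x j = vec_nth y j + of_int m" by simp
    then show ?thesis by blast
  qed
  then obtain k where k: "\<And>j. vec_nth x j = vec_nth y j + real_of_int (k j)" by metis
  have "x = y + rvec (\<chi> j. k j)" by (simp add: Finite_Cartesian_Product.vec_eq_iff rvec_def k)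
  with assms(2) show ?thesis by (simp add: torus_periodic_def)
qed

text \<open>Weierstrass approximation on the embedded torus. The descended function is continuous by the closed
graph theorem: its graph is the continuous image of the compact cube.\<close>

lemma trig_poly_dense:
  fixes f :: "real ^ 'd \<Rightarrow> complex"
  assumes per: "torus_periodic f" and cont: "continuous_on UNIV f" and e: "0 < e"
  shows "\<exists>q. trig_poly q \<and> (\<forall>x\<in>cbox 0 1. cmod (f x - q x) < e)"
proof -
  let ?C = "cbox 0 1 :: (real ^ 'd) set"
  define K where "K = torus_embedding ` ?C"
  define F where "F = (\<lambda>w. f (SOME x. x \<in> ?C \<and> torus_embedding x = w))"
  have cont_emb: "continuous_on S torus_embedding" for S :: "(real ^ 'd) set"
    unfolding torus_embedding_def by (intro continuous_intros)
  have F: "F (torus_embedding x) = f x" if "x \<in> ?C" for x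
  proof -
    have "\<exists>y. y \<in> ?C \<and> torus_embedding y = torus_embedding x" using that by blast
    then have "torus_embedding (SOME y. y \<in> ?C \<and> torus_embedding y = torus_embedding x) = torus_embedding x"
      by (rule someI2_ex) simp
    then show ?thesis unfolding F_def by (rule torus_embedding_eq_imp[OF _ per])
  qed
  have contC: "continuous_on ?C f" using cont continuous_on_subset by blast
  have "continuous_on K F"
  proof (rule continuous_from_closed_graph)
    show "compact (f ` ?C)" by (intro compact_continuous_image contC compact_cbox)
    show "F \<in> K \<rightarrow> f ` ?C" by (auto simp: K_def F)
    have "(\<lambda>w. (w, F w)) ` K = (\<lambda>x. (torus_embedding x, f x)) ` ?C"
      by (auto simp: K_def image_image F intro!: image_cong)
    moreover have "compact ((\<lambda>x. (torus_embedding x, f x)) ` ?C)"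
      by (intro compact_continuous_image continuous_intros cont_emb contC compact_cbox)
    ultimately show "closed ((\<lambda>w. (w, F w)) ` K)" by (simp add: compact_imp_closed)
  qed
  moreover have "compact K"
    unfolding K_def by (intro compact_continuous_image cont_emb compact_cbox)
  ultimately obtain q where q: "polynomial_function q" "\<And>w. w \<in> K \<Longrightarrow> cmod (F w - q w) < e"
    using Stone_Weierstrass_polynomial_function e by metis
  have "real_polynomial_function (Re \<circ> q)" "real_polynomial_function (Im \<circ> q)"
    using q(1) bounded_linear_Re bounded_linear_Im by (auto simp: polynomial_function_def)
  from this[THEN trig_poly_of_polynomial]
  have "trig_poly (\<lambda>x. of_real ((Re \<circ> q) (torus_embedding x)) + \<i> * of_real ((Im \<circ> q) (torus_embedding x)))"
    by (intro trig_poly.add trig_poly_mult trig_poly_const)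
  then have "trig_poly (\<lambda>x. q (torus_embedding x))"
    by (simp flip: complex_eq)
  moreover have "cmod (f x - q (torus_embedding x)) < e" if "x \<in> ?C" for x
    using q(2)[of "torus_embedding x"] that F by (auto simp: K_def)
  ultimately show ?thesis by blast
qed

lemma norm_integral_unit_cube_le:
  fixes f :: "real ^ 'd \<Rightarrow> complex"
  assumes "continuous_on (cbox 0 1) f" "\<And>x. x \<in> cbox 0 1 \<Longrightarrow> cmod (f x) \<le> B"
  shows "cmod (integral (cbox 0 1) f) \<le> B"
proof -
  have "0 \<le> B" by (rule order_trans[OF norm_ge_zero assms(2)[of 0]]) (simp add: mem_box_cart)
  moreover have "measure lborel (cbox 0 (1 :: real ^ 'd)) = 1"
  proof -
    have "(1 :: real ^ 'd) \<bullet> b = 1" if "b \<in> Basis" for b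
      using that by (auto simp: Basis_vec_def inner_axis)
    then show ?thesis by (subst measure_lborel_cbox_eq) simp
  qed
  ultimately show ?thesis
    using has_integral_bound[OF _ integrable_integral[OF integrable_continuous[OF assms(1)]], of B] assms(2) by simp
qed

text \<open>f is orthogonal to all trigonometric polynomials and its conjugate is a uniform limit of such, so
the integral of the squared modulus vanishes.\<close>

lemma fourier_uniqueness:
  fixes f :: "real ^ 'd \<Rightarrow> complex"
  assumes per: "torus_periodic f" and cont: "continuous_on UNIV f"
    and zero: "\<And>h. integral (cbox 0 1) (\<lambda>x. f x * torus_char h x) = 0" and x: "x \<in> cbox 0 1"
  shows "f x = 0"
proof -
  let ?C = "cbox 0 1 :: (real ^ 'd) set"
  have contC: "continuous_on ?C f" using cont continuous_on_subset by blast
  have orth: "trig_poly q \<Longrightarrow> integral ?C (\<lambda>x. f x * q x) = 0" for q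
  proof (induction rule: trig_poly.induct)
    case (torus_char c h)
    have "integral ?C (\<lambda>x. c * (f x * torus_char h x)) = 0" by (simp add: zero)
    then show ?case by (simp add: mult_ac)
  next
    case (add g h)
    have "integral ?C (\<lambda>x. f x * g x + f x * h x) = integral ?C (\<lambda>x. f x * g x) + integral ?C (\<lambda>x. f x * h x)"
      by (intro Henstock_Kurzweil_Integration.integral_add integrable_continuous continuous_intros
          contC continuous_trig_poly add)
    with add show ?case by (simp add: distrib_left)
  qed
  obtain M where M: "\<And>x. x \<in> ?C \<Longrightarrow> cmod (f x) \<le> M"
    using compact_imp_bounded[OF compact_continuous_image[OF contC compact_cbox]] by (auto simp: bounded_iff)
  have M0: "0 \<le> M" using M[OF x] norm_ge_zero[of "f x"] by linarith
  have "cmod (integral ?C (\<lambda>x. f x * cnj (f x))) \<le> 0"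
  proof (rule field_le_epsilon)
    fix e :: real assume e: "0 < e"
    have "torus_periodic (\<lambda>x. cnj (f x))" using per by (simp add: torus_periodic_def)
    moreover have "continuous_on UNIV (\<lambda>x. cnj (f x))" by (intro continuous_intros cont)
    moreover have "0 < e / (M + 1)" using e M0 by simp
    ultimately obtain q where q: "trig_poly q" "\<And>x. x \<in> ?C \<Longrightarrow> cmod (cnj (f x) - q x) < e / (M + 1)"
      using trig_poly_dense by blast
    have "integral ?C (\<lambda>x. f x * cnj (f x)) = integral ?C (\<lambda>x. f x * cnj (f x)) - integral ?C (\<lambda>x. f x * q x)"
      by (simp add: orth q)
    also have "\<dots> = integral ?C (\<lambda>x. f x * cnj (f x) - f x * q x)"
      by (intro Henstock_Kurzweil_Integration.integral_diff[symmetric] integrable_continuous continuous_intros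
          contC continuous_trig_poly q)
    also have "cmod \<dots> \<le> M * (e / (M + 1))"
    proof (rule norm_integral_unit_cube_le)
      show "continuous_on ?C (\<lambda>x. f x * cnj (f x) - f x * q x)"
        by (intro continuous_intros contC continuous_trig_poly q)
      fix x assume x: "x \<in> ?C"
      have "cmod (f x * cnj (f x) - f x * q x) = cmod (f x) * cmod (cnj (f x) - q x)"
        by (simp add: right_diff_distrib flip: norm_mult)
      also have "\<dots> \<le> M * (e / (M + 1))"
        using M[OF x] q(2)[OF x] M0 by (intro mult_mono) auto
      finally show "cmod (f x * cnj (f x) - f x * q x) \<le> M * (e / (M + 1))" .
    qed
    also have "\<dots> \<le> 0 + e" using e M0 by (simp add: field_simps)
    finally show "cmod (integral ?C (\<lambda>x. f x * cnj (f x))) \<le> 0 + e" .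
  qed
  moreover have "continuous_on ?C (\<lambda>x. f x * cnj (f x))" by (intro continuous_intros contC)
  ultimately have "((\<lambda>x. f x * cnj (f x)) has_integral 0) ?C"
    by (simp add: has_integral_iff integrable_continuous)
  from has_integral_linear[OF this bounded_linear_Re]
  have "((\<lambda>x. (cmod (f x))\<^sup>2) has_integral 0) ?C"
    by (simp add: o_def complex_mult_cnj cmod_power2)
  moreover have "box 0 (1 :: real ^ 'd) \<noteq> {}"
  proof -
    have "(\<chi> j. 1 / 2) \<in> box 0 (1 :: real ^ 'd)" by (simp add: mem_box_cart)
    then show ?thesis by blast
  qed
  ultimately have "(cmod (f x))\<^sup>2 = 0"
    by (intro has_integral_0_cbox_imp_0[of 0 1 "\<lambda>x. (cmod (f x))\<^sup>2"]) (auto intro!: continuous_intros contC x)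
  then show ?thesis by simp
qed

text \<open>The series converges uniformly to a continuous periodic function, whose coefficients are those of
f since integration over the cube is continuous under uniform convergence.\<close>

lemma fourier_inversion:
  fixes f :: "real ^ 'd \<Rightarrow> complex"
  assumes per: "torus_periodic f" and cont: "continuous_on UNIV f"
    and summable: "(\<lambda>h. cmod (fourier_coeff f h)) summable_on UNIV" and x: "x \<in> cbox 0 1"
  shows "((\<lambda>h. fourier_coeff f h * torus_char h x) has_sum f x) UNIV"
proof -
  let ?C = "cbox 0 1 :: (real ^ 'd) set"
  have contC: "continuous_on ?C f" using cont continuous_on_subset by blast
  define c where "c = fourier_coeff f"
  define S where "S = (\<lambda>x. \<Sum>\<^sub>\<infinity>h. c h * torus_char h x)"
  have abs: "(\<lambda>h. c h * torus_char h x) summable_on UNIV" for x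
    by (rule abs_summable_summable) (use summable in \<open>simp add: norm_mult c_def\<close>)
  have lim: "uniform_limit UNIV (\<lambda>H x. \<Sum>h\<in>H. c h * torus_char h x) S (finite_subsets_at_top UNIV)"
    unfolding S_def
    by (rule Weierstrass_m_test_general) (use summable in \<open>auto simp: norm_mult c_def\<close>)
  have contS: "continuous_on UNIV S"
    by (rule uniform_limit_theorem[OF _ lim])
      (auto intro!: always_eventually continuous_intros continuous_torus_char)
  have perS: "torus_periodic S"
  proof -
    have "torus_char h (y + rvec k) = torus_char h y" for h y and k :: "int ^ 'd"
    proof -
      have "rvec h \<bullet> rvec k = of_int (\<Sum>j\<in>UNIV. vec_nth h j * vec_nth k j)"
        by (simp add: inner_vec_def rvec_def)
      then have "torus_char h (y + rvec k) = torus_char h y * exp (2 * pi * \<i> * of_int (\<Sum>j\<in>UNIV. vec_nth h j * vec_nth k j))"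
        unfolding torus_char_def by (simp only: inner_add_right of_real_add distrib_left exp_add of_real_of_int_eq)
      also have "exp (2 * pi * \<i> * of_int (\<Sum>j\<in>UNIV. vec_nth h j * vec_nth k j)) = 1"
        by (rule exp_2pi_int)
      finally show ?thesis by simp
    qed
    then show ?thesis by (simp add: torus_periodic_def S_def)
  qed
  have S_coeff: "integral ?C (\<lambda>x. S x * torus_char (- k) x) = c k" for k
  proof -
    have "cmod (integral ?C (\<lambda>x. S x * torus_char (- k) x) - c k) \<le> 0"
    proof (rule field_le_epsilon)
      fix e :: real assume e: "0 < e"
      have "\<forall>\<^sub>F H in finite_subsets_at_top UNIV. \<forall>x\<in>UNIV. dist (\<Sum>h\<in>H. c h * torus_char h x) (S x) < e"
        using lim e by (simp add: uniform_limit_iff)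
      moreover have "\<forall>\<^sub>F H in finite_subsets_at_top UNIV. finite H \<and> {k} \<subseteq> H \<and> H \<subseteq> UNIV"
        by (auto simp: eventually_finite_subsets_at_top intro!: exI[of _ "{k}"])
      ultimately have "\<forall>\<^sub>F H in finite_subsets_at_top UNIV.
          (finite H \<and> {k} \<subseteq> H) \<and> (\<forall>x. dist (\<Sum>h\<in>H. c h * torus_char h x) (S x) < e)"
        by eventually_elim auto
      then obtain H where H: "finite H" "k \<in> H" "\<And>x. dist (\<Sum>h\<in>H. c h * torus_char h x) (S x) < e"
        by (auto dest!: eventually_happens'[OF finite_subsets_at_top_neq_bot])
      have prod: "c h * torus_char h x * torus_char (- k) x = c h * torus_char (h - k) x" for h x
        by (simp add: mult.assoc torus_char_mult)
      have "((\<lambda>x. \<Sum>h\<in>H. c h * torus_char (h - k) x) has_integral (\<Sum>h\<in>H. c h * (if h - k = 0 then 1 else 0))) ?C"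
        unfolding integral_torus_char[symmetric]
        by (intro has_integral_sum H has_integral_mult_right integrable_integral integrable_continuous continuous_torus_char)
      then have fin: "integral ?C (\<lambda>x. (\<Sum>h\<in>H. c h * torus_char h x) * torus_char (- k) x) = c k"
        using H by (simp add: sum_distrib_right prod integral_unique if_distrib[of "\<lambda>z. _ * z"] cong: if_cong)
      have "integral ?C (\<lambda>x. S x * torus_char (- k) x) - c k
          = integral ?C (\<lambda>x. S x * torus_char (- k) x - (\<Sum>h\<in>H. c h * torus_char h x) * torus_char (- k) x)"
        unfolding fin[symmetric]
        by (intro Henstock_Kurzweil_Integration.integral_diff[symmetric] integrable_continuous continuous_intros
            continuous_torus_char continuous_on_subset[OF contS]) auto
      also have "cmod \<dots> \<le> e"
      proof (rule norm_integral_unit_cube_le)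
        show "continuous_on ?C (\<lambda>x. S x * torus_char (- k) x - (\<Sum>h\<in>H. c h * torus_char h x) * torus_char (- k) x)"
          by (intro continuous_intros continuous_torus_char continuous_on_subset[OF contS]) auto
        fix x
        have "cmod (S x * torus_char (- k) x - (\<Sum>h\<in>H. c h * torus_char h x) * torus_char (- k) x) = dist (\<Sum>h\<in>H. c h * torus_char h x) (S x)"
          unfolding left_diff_distrib[symmetric] norm_mult norm_torus_char dist_norm mult_1_right
          by (rule norm_minus_commute)
        then show "cmod (S x * torus_char (- k) x - (\<Sum>h\<in>H. c h * torus_char h x) * torus_char (- k) x) \<le> e"
          using H(3)[of x] by simp
      qed
      finally show "cmod (integral ?C (\<lambda>x. S x * torus_char (- k) x) - c k) \<le> 0 + e" by simp
    qed
    then show ?thesis by simp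
  qed
  have "f x - S x = 0"
  proof (rule fourier_uniqueness[of "\<lambda>x. f x - S x"])
    show "torus_periodic (\<lambda>x. f x - S x)" using per perS by (simp add: torus_periodic_def)
    show "continuous_on UNIV (\<lambda>x. f x - S x)" by (intro continuous_intros cont contS)
    fix h
    have "integral ?C (\<lambda>x. f x * torus_char h x - S x * torus_char h x) = integral ?C (\<lambda>x. f x * torus_char h x) - integral ?C (\<lambda>x. S x * torus_char h x)"
      by (intro Henstock_Kurzweil_Integration.integral_diff integrable_continuous continuous_intros contC
          continuous_torus_char continuous_on_subset[OF contS]) auto
    also have "\<dots> = 0"
      using S_coeff[of "- h"] fourier_coeff_eq_integral[OF contC, of "- h"] by (simp add: c_def)
    finally show "integral ?C (\<lambda>x. (f x - S x) * torus_char h x) = 0" by (simp add: left_diff_distrib)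
  qed (rule x)
  then have "f x = (\<Sum>\<^sub>\<infinity>h. c h * torus_char h x)" by (simp add: S_def)
  then show ?thesis
    using has_sum_infsum[OF abs[of x]] unfolding c_def by (simp only:)
qed

section \<open>Decay of the Fourier coefficients\<close>

text \<open>The hyperbolic-cross modulus: its power 2\<alpha> is the Korobov weight, and its square dominates
the Euclidean weight up to a constant.\<close>

definition mod_prod :: "int ^ 'd \<Rightarrow> real" where
  "mod_prod h = (\<Prod>j\<in>UNIV. max 1 \<bar>real_of_int (vec_nth h j)\<bar>)"

lemma mod_prod_ge_1: "1 \<le> mod_prod h"
  unfolding mod_prod_def by (rule prod_ge_1) auto

lemma korobov_weight_eq: "0 \<le> \<alpha> \<Longrightarrow> korobov_weight \<alpha> h = mod_prod h powr (2 * \<alpha>)"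
proof -
  assume \<alpha>: "0 \<le> \<alpha>"
  have "max (\<bar>x\<bar> powr (2 * \<alpha>)) 1 = max 1 \<bar>x\<bar> powr (2 * \<alpha>)" if "x = 0 \<or> 1 \<le> \<bar>x\<bar>" for x :: real
    using that \<alpha> ge_one_powr_ge_zero[of "\<bar>x\<bar>" "2 * \<alpha>"] by (auto simp: max_def)
  moreover have "real_of_int (vec_nth h j) = 0 \<or> 1 \<le> \<bar>real_of_int (vec_nth h j)\<bar>" for j
    by (cases "vec_nth h j = 0") (auto simp flip: of_int_abs)
  ultimately show ?thesis
    unfolding korobov_weight_def mod_prod_def by (subst prod_powr_distrib) auto
qed

lemma summable_on_int_powr:
  assumes "1 < s"
  shows "(\<lambda>k::int. max 1 \<bar>real_of_int k\<bar> powr (- s)) summable_on UNIV"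
proof -
  let ?g = "\<lambda>k::int. max 1 \<bar>real_of_int k\<bar> powr (- s)"
  have "summable (\<lambda>n. max 1 (real n) powr (- s)) \<longleftrightarrow> summable (\<lambda>n. real n powr (- s))"
    by (rule summable_cong) (use eventually_ge_at_top[of "1::nat"] in \<open>eventually_elim, simp add: max_def\<close>)
  then have sm: "summable (\<lambda>n. max 1 (real n) powr (- s))"
    using assms by (simp add: summable_real_powr_iff)
  have nat: "(\<lambda>n::nat. max 1 (real n) powr (- s)) summable_on UNIV"
    by (rule norm_summable_imp_summable_on) (use sm in simp)
  have 1: "?g summable_on range int"
    using nat by (subst summable_on_reindex) (auto simp: o_def)
  have 2: "?g summable_on range (\<lambda>n. - int n)"
    using nat by (subst summable_on_reindex) (auto simp: o_def inj_def)
  have "?g summable_on (range int \<union> (range (\<lambda>n. - int n) - range int))"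
    by (intro summable_on_Un_disjoint 1 summable_on_subset_banach[OF 2]) auto
  moreover have "range int \<union> (range (\<lambda>n. - int n) - range int) = UNIV"
  proof -
    have "k \<in> range int \<union> range (\<lambda>n. - int n)" for k
      by (cases k rule: int_cases2) auto
    then show ?thesis by blast
  qed
  ultimately show ?thesis by simp
qed

lemma summable_on_vec_prod:
  fixes g :: "int \<Rightarrow> real"
  assumes g: "g summable_on UNIV" and nonneg: "\<And>k. 0 \<le> g k"
  shows "(\<lambda>h :: int ^ 'd. \<Prod>j\<in>UNIV. g (vec_nth h j)) summable_on UNIV"
proof (rule nonneg_bdd_above_summable_on)
  let ?f = "\<lambda>h :: int ^ 'd. \<Prod>j\<in>UNIV. g (vec_nth h j)"
  have "sum ?f F \<le> (\<Prod>j\<in>(UNIV :: 'd set). infsum g UNIV)" if F: "finite F" for F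
  proof -
    define B where "B = (\<lambda>j. (\<lambda>h. vec_nth h j) ` F)"
    have inj: "inj_on vec_nth F" by (auto simp: inj_on_def vec_nth_inject)
    have "sum ?f F = (\<Sum>\<phi>\<in>vec_nth ` F. \<Prod>j\<in>UNIV. g (\<phi> j))"
      by (simp add: sum.reindex[OF inj])
    also have "\<dots> \<le> (\<Sum>\<phi>\<in>PiE UNIV B. \<Prod>j\<in>UNIV. g (\<phi> j))"
      by (rule sum_mono2) (use F nonneg in \<open>auto simp: B_def intro!: prod_nonneg finite_PiE\<close>)
    also have "\<dots> = (\<Prod>j\<in>UNIV. \<Sum>k\<in>B j. g k)"
      by (rule prod_sum_PiE[symmetric]) (use F in \<open>auto simp: B_def\<close>)
    also have "\<dots> \<le> (\<Prod>j\<in>(UNIV :: 'd set). infsum g UNIV)"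
      by (intro prod_mono conjI sum_nonneg finite_sum_le_infsum g) (use F nonneg in \<open>auto simp: B_def\<close>)
    finally show ?thesis .
  qed
  then show "bdd_above (sum ?f ` {F. F \<subseteq> UNIV \<and> finite F})" by (auto intro!: bdd_aboveI2)
qed (auto intro: prod_nonneg nonneg)

lemma one_plus_norm_le_mod_prod:
  "1 + (norm (rvec (h :: int ^ 'd)))\<^sup>2 \<le> (1 + real CARD('d)) * (mod_prod h)\<^sup>2"
proof -
  have le: "\<bar>real_of_int (vec_nth h j)\<bar> \<le> mod_prod h" for j
  proof -
    have "max 1 \<bar>real_of_int (vec_nth h j)\<bar> * 1
        \<le> max 1 \<bar>real_of_int (vec_nth h j)\<bar> * (\<Prod>j\<in>UNIV - {j}. max 1 \<bar>real_of_int (vec_nth h j)\<bar>)"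
      by (intro mult_left_mono prod_ge_1) auto
    also have "\<dots> = mod_prod h"
      unfolding mod_prod_def by (rule prod.remove[symmetric]) auto
    finally show ?thesis by simp
  qed
  have "(norm (rvec h))\<^sup>2 = (\<Sum>j\<in>UNIV. (real_of_int (vec_nth h j))\<^sup>2)"
    by (simp add: norm_vec_def L2_set_def rvec_def sum_nonneg)
  also have "\<dots> \<le> (\<Sum>j\<in>(UNIV :: 'd set). (mod_prod h)\<^sup>2)"
    by (intro sum_mono) (metis le abs_ge_zero power2_abs power_mono)
  finally have "(norm (rvec h))\<^sup>2 \<le> real CARD('d) * (mod_prod h)\<^sup>2" by simp
  moreover have "1 \<le> (mod_prod h)\<^sup>2" using mod_prod_ge_1[of h] by (simp add: one_le_power)
  ultimately show ?thesis by (simp add: distrib_right)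
qed

text \<open>By the inequality xy \<le> x^2 + y^2 the terms are dominated by the sum of the summand of the Korobov
norm and mod_prod h powr (4p - 2\<alpha>). The latter is a product over the coordinates, summable because
2\<alpha> - 4p > 1; here the hypothesis on \<alpha> enters.\<close>

lemma korobov_weighted_summable:
  fixes v :: "real ^ 'd \<Rightarrow> complex"
  assumes v: "v \<in> korobov_space \<alpha>" and \<alpha>: "\<alpha> > 2 * real p + 1 / 2" and K: "0 \<le> K"
  shows "(\<lambda>h. cmod (fourier_coeff v h) * (K * (1 + (norm (rvec h))\<^sup>2)) ^ p) summable_on UNIV"
proof -
  define s where "s = 2 * \<alpha> - 4 * real p"
  define C where "C = (K * (1 + real CARD('d))) ^ p"
  let ?A = "\<lambda>h. (cmod (fourier_coeff v h))\<^sup>2 * korobov_weight \<alpha> h"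
  let ?B = "\<lambda>h :: int ^ 'd. \<Prod>j\<in>UNIV. max 1 \<bar>real_of_int (vec_nth h j)\<bar> powr (- s)"
  have A: "?A summable_on UNIV" using v by (simp add: korobov_space_def)
  have B: "?B summable_on UNIV"
    by (rule summable_on_vec_prod[OF summable_on_int_powr]) (use \<alpha> in \<open>auto simp: s_def\<close>)
  have C0: "0 \<le> C" using K by (simp add: C_def)
  have "(\<lambda>h. C * (?A h + ?B h)) summable_on UNIV"
    by (intro summable_on_cmult_right summable_on_add A B)
  then show ?thesis
  proof (rule summable_on_comparison_test)
    fix h :: "int ^ 'd"
    define P where "P = mod_prod h"
    define a where "a = cmod (fourier_coeff v h)"
    have P1: "1 \<le> P" by (simp add: P_def mod_prod_ge_1)
    have A_eq: "?A h = (a * P powr \<alpha>)\<^sup>2"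
      using \<alpha> P1 by (simp add: korobov_weight_eq a_def P_def power_mult_distrib powr_power mult.commute)
    have B_eq: "?B h = (P powr (2 * real p - \<alpha>))\<^sup>2"
    proof -
      have "?B h = P powr (- s)" unfolding P_def mod_prod_def by (subst prod_powr_distrib) auto
      then show ?thesis using P1 by (simp add: s_def powr_power algebra_simps)
    qed
    have "a * (K * (1 + (norm (rvec h))\<^sup>2)) ^ p \<le> a * (K * ((1 + real CARD('d)) * P\<^sup>2)) ^ p"
      using K one_plus_norm_le_mod_prod[of h]
      by (intro mult_left_mono power_mono mult_nonneg_nonneg) (auto simp: a_def P_def)
    also have "\<dots> = C * (a * P ^ (2 * p))"
      by (simp add: C_def power_mult_distrib power_mult)
    also have "a * P ^ (2 * p) = (a * P powr \<alpha>) * P powr (2 * real p - \<alpha>)"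
      using P1 by (simp add: mult.assoc powr_realpow[symmetric] flip: powr_add)
    also have "C * ((a * P powr \<alpha>) * P powr (2 * real p - \<alpha>)) \<le> C * (?A h + ?B h)"
    proof (rule mult_left_mono[OF _ C0])
      have "x * y \<le> x\<^sup>2 + y\<^sup>2" for x y :: real
      proof -
        have "0 \<le> ((x - y)\<^sup>2 + (x\<^sup>2 + y\<^sup>2)) / 2" by simp
        then show ?thesis by (simp add: power2_eq_square field_simps)
      qed
      then show "(a * P powr \<alpha>) * P powr (2 * real p - \<alpha>) \<le> ?A h + ?B h"
        unfolding A_eq B_eq .
    qed
    finally show "cmod (fourier_coeff v h) * (K * (1 + (norm (rvec h))\<^sup>2)) ^ p \<le> C * (?A h + ?B h)"
      by (simp add: a_def)
  qed (use K in auto)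
qed

section \<open>Aliasing on the lattice\<close>

lemma root_of_unity_sum:
  fixes r :: int
  assumes n: "1 \<le> n"
  shows "(\<Sum>k<n. exp (2 * pi * \<i> * of_int r * of_nat k / of_nat n)) = (if [r = 0] (mod int n) then of_nat n else (0 :: complex))"
proof -
  define w :: complex where "w = exp (2 * pi * \<i> * of_int r / of_nat n)"
  have wk: "exp (2 * pi * \<i> * of_int r * of_nat k / of_nat n) = w ^ k" for k
    by (simp add: w_def mult_ac flip: exp_of_nat_mult)
  have "w ^ n = exp (2 * pi * \<i> * of_int r)"
    using n by (simp add: w_def flip: exp_of_nat_mult)
  then have wn: "w ^ n = 1" by (simp only: exp_2pi_int)
  have w1: "w = 1 \<longleftrightarrow> [r = 0] (mod int n)"
  proof
    assume "[r = 0] (mod int n)"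
    then obtain m where "r = int n * m" by (auto simp: cong_0_iff)
    then have "w = exp (2 * pi * \<i> * of_int m)" using n by (simp add: w_def mult.assoc)
    then show "w = 1" by (simp only: exp_2pi_int)
  next
    assume "w = 1"
    then obtain m :: int where "Im (2 * pi * \<i> * of_int r / of_nat n) = of_int (2 * m) * pi"
      unfolding w_def exp_eq_1 by blast
    then have "real_of_int r = real n * real_of_int m" using n by (simp add: field_simps)
    then have "r = int n * m" by (metis of_int_eq_iff of_int_mult of_int_of_nat_eq)
    then show "[r = 0] (mod int n)" by (simp add: cong_0_iff)
  qed
  show ?thesis
  proof (cases "w = 1")
    case True
    then show ?thesis using w1 unfolding wk by simp
  next
    case False
    then have "(\<Sum>k<n. w ^ k) = (w ^ n - 1) / (w - 1)" by (rule geometric_sum)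
    then show ?thesis using wn w1 False unfolding wk by simp
  qed
qed

text \<open>Reducing a lattice point modulo 1 changes the phase by an integer multiple of 2 \<pi> \<i>.\<close>

lemma torus_char_lattice_point:
  assumes "1 \<le> n"
  shows "torus_char h (lattice_point z n k) = exp (2 * pi * \<i> * of_int (idot h z) * of_nat k / of_nat n)"
proof -
  define m where "m = (\<Sum>j\<in>UNIV. vec_nth h j * \<lfloor>real_of_int (vec_nth z j) * real k / real n\<rfloor>)"
  have "rvec h \<bullet> lattice_point z n k = of_int (idot h z) * real k / real n - of_int m"
    by (simp add: inner_vec_def rvec_def lattice_point_def idot_def m_def frac_def right_diff_distrib
        sum_subtractf sum_distrib_right sum_divide_distrib mult.assoc)
  then have "2 * pi * \<i> * complex_of_real (rvec h \<bullet> lattice_point z n k)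
      = 2 * pi * \<i> * of_int (idot h z) * of_nat k / of_nat n - 2 * pi * \<i> * of_int m"
    by (simp add: right_diff_distrib)
  then show ?thesis by (simp only: torus_char_def exp_diff exp_2pi_int div_by_1)
qed

lemma lattice_point_in_cube: "lattice_point z n k \<in> cbox 0 1"
  by (simp add: mem_box_cart lattice_point_def frac_lt_1 less_imp_le)

lemma mat_inverse_eqI:
  fixes F G :: "'a::field mat"
  assumes "F \<in> carrier_mat n n" "G \<in> carrier_mat n n" "F * G = 1\<^sub>m n" "G * F = 1\<^sub>m n"
  shows "mat_inverse F = Some G"
proof (cases "mat_inverse F")
  case None
  have "F \<in> Units (ring_mat TYPE('a) n ())"
    using assms by (auto simp: Units_def ring_mat_simps)
  with mat_inverse(1)[OF assms(1) None, of "()"] show ?thesis by blast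
next
  case (Some B)
  then have B: "B * F = 1\<^sub>m n" "B \<in> carrier_mat n n" using mat_inverse(2)[OF assms(1)] by auto
  have "B = B * (F * G)" using assms B by simp
  also have "\<dots> = (B * F) * G" using assms B by (metis assoc_mult_mat)
  also have "\<dots> = G" using assms B by simp
  finally show ?thesis using Some by simp
qed

lemma cong_distinct_below: "i < n \<Longrightarrow> j < n \<Longrightarrow> [int i - int j = 0] (mod int n) \<longleftrightarrow> i = j"
  by (metis cong_diff_iff_cong_0 cong_int_iff cong_less_modulus_unique_nat cong_refl)

lemma W_mat_entry:
  assumes n: "1 \<le> n" and i: "i < n" and j: "j < n"
  shows "W_mat n z v $$ (i, j)
    = 1 / of_nat n * (\<Sum>k<n. v (lattice_point z n k) * exp (2 * pi * \<i> * of_int (int j - int i) * of_nat k / of_nat n))"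
    and "W_mat n z v \<in> carrier_mat n n"
proof -
  define G :: "complex mat" where "G = Matrix.mat n n
     (\<lambda>(\<xi>, \<xi>'). exp (2 * pi * \<i> * of_nat \<xi> * of_nat \<xi>' / of_nat n) / complex_of_real (sqrt (real n)))"
  have sq: "complex_of_real (sqrt (real n)) * complex_of_real (sqrt (real n)) = of_nat n"
    by (simp flip: of_real_mult)
  have F: "F_mat n \<in> carrier_mat n n" and G: "G \<in> carrier_mat n n" by (simp_all add: F_mat_def G_def)
  have expm: "exp (- 2 * pi * \<i> * of_nat i * of_nat k / of_nat n) * exp (2 * pi * \<i> * of_nat k * of_nat j / of_nat n)
      = exp (2 * pi * \<i> * of_int (int j - int i) * of_nat k / of_nat n)" for i j k :: nat
    unfolding exp_add[symmetric] by (rule arg_cong[of _ _ exp]) (simp add: algebra_simps diff_divide_distrib)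
  have FG: "F_mat n * G = 1\<^sub>m n"
  proof (rule eq_matI)
    fix a b assume "a < dim_row (1\<^sub>m n)" "b < dim_col (1\<^sub>m n)"
    then have ab: "a < n" "b < n" by auto
    have "(F_mat n * G) $$ (a, b) = (\<Sum>k<n. exp (2 * pi * \<i> * of_int (int b - int a) * of_nat k / of_nat n) / of_nat n)"
      using ab unfolding expm[symmetric]
      by (simp add: F_mat_def G_def scalar_prod_def atLeast0LessThan sq)
    also have "\<dots> = (if a = b then 1 else 0)"
      unfolding sum_divide_distrib[symmetric] root_of_unity_sum[OF n] using ab n
      by (auto simp: cong_distinct_below)
    finally show "(F_mat n * G) $$ (a, b) = 1\<^sub>m n $$ (a, b)" using ab by simp
  qed (simp_all add: F_mat_def G_def)
  have GF: "G * F_mat n = 1\<^sub>m n"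
  proof (rule eq_matI)
    fix a b assume "a < dim_row (1\<^sub>m n)" "b < dim_col (1\<^sub>m n)"
    then have ab: "a < n" "b < n" by auto
    have expm': "exp (2 * pi * \<i> * of_nat a * of_nat k / of_nat n) * exp (- 2 * pi * \<i> * of_nat k * of_nat b / of_nat n)
      = exp (2 * pi * \<i> * of_int (int a - int b) * of_nat k / of_nat n)" for k :: nat
      unfolding exp_add[symmetric] by (rule arg_cong[of _ _ exp]) (simp add: algebra_simps diff_divide_distrib)
    have "(G * F_mat n) $$ (a, b) = (\<Sum>k<n. exp (2 * pi * \<i> * of_int (int a - int b) * of_nat k / of_nat n) / of_nat n)"
      using ab unfolding expm'[symmetric]
      by (simp add: F_mat_def G_def scalar_prod_def atLeast0LessThan sq)
    also have "\<dots> = (if a = b then 1 else 0)"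
      unfolding sum_divide_distrib[symmetric] root_of_unity_sum[OF n] using ab n
      by (auto simp: cong_distinct_below)
    finally show "(G * F_mat n) $$ (a, b) = 1\<^sub>m n $$ (a, b)" using ab by simp
  qed (simp_all add: F_mat_def G_def)
  have W: "W_mat n z v = F_mat n * V_mat n z v * G"
    by (simp add: W_mat_def mat_inverse_eqI[OF F G FG GF])
  have FV: "F_mat n * V_mat n z v = Matrix.mat n n (\<lambda>(i, k). F_mat n $$ (i, k) * v (lattice_point z n k))"
    unfolding V_mat_def by (rule mat_diag_mult_right[OF F])
  show "W_mat n z v \<in> carrier_mat n n" unfolding W FV using G by auto
  have "W_mat n z v $$ (i, j)
      = (\<Sum>k<n. v (lattice_point z n k) * exp (2 * pi * \<i> * of_int (int j - int i) * of_nat k / of_nat n) / of_nat n)"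
    unfolding W FV expm[symmetric] using i j
    by (simp add: F_mat_def G_def scalar_prod_def atLeast0LessThan sq mult_ac)
  then show "W_mat n z v $$ (i, j)
    = 1 / of_nat n * (\<Sum>k<n. v (lattice_point z n k) * exp (2 * pi * \<i> * of_int (int j - int i) * of_nat k / of_nat n))"
    by (simp add: sum_divide_distrib)
qed

lemma has_sum_sum_finite:
  fixes f :: "'a \<Rightarrow> 'b \<Rightarrow> complex"
  assumes "finite K" "\<And>k. k \<in> K \<Longrightarrow> (f k has_sum s k) A"
  shows "((\<lambda>x. \<Sum>k\<in>K. f k x) has_sum (\<Sum>k\<in>K. s k)) A"
  using assms by (induction K rule: finite_induct) (auto intro: has_sum_add)

text \<open>W is the discrete Fourier transform of the samples of v. After inserting the Fourier series of v, the
sum over the lattice keeps exactly the frequencies that are congruent to i - j.\<close>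

lemma W_mat_aliasing:
  fixes v :: "real ^ 'd \<Rightarrow> complex"
  assumes n: "1 \<le> n" and i: "i < n" and j: "j < n" and per: "torus_periodic v" and cont: "continuous_on UNIV v"
    and summable: "(\<lambda>h. cmod (fourier_coeff v h)) summable_on UNIV"
  shows "(fourier_coeff v has_sum W_mat n z v $$ (i, j)) {h. [idot h z = int i - int j] (mod int n)}"
proof -
  let ?e = "\<lambda>r k. exp (2 * pi * \<i> * of_int r * of_nat k / of_nat n) :: complex"
  have ee: "?e r k * ?e r' k = ?e (r + r') k" for r r' and k :: nat
    by (simp add: add_divide_distrib distrib_left distrib_right flip: exp_add)
  have "((\<lambda>h. 1 / of_nat n * (\<Sum>k<n. fourier_coeff v h * torus_char h (lattice_point z n k) * ?e (int j - int i) k))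
      has_sum W_mat n z v $$ (i, j)) UNIV"
    unfolding W_mat_entry(1)[OF n i j]
    by (intro has_sum_cmult_right has_sum_sum_finite has_sum_cmult_left fourier_inversion per cont summable
        lattice_point_in_cube) simp
  moreover have "1 / of_nat n * (\<Sum>k<n. fourier_coeff v h * torus_char h (lattice_point z n k) * ?e (int j - int i) k)
      = (if [idot h z = int i - int j] (mod int n) then fourier_coeff v h else 0)" for h
  proof -
    have "(\<Sum>k<n. fourier_coeff v h * torus_char h (lattice_point z n k) * ?e (int j - int i) k)
        = fourier_coeff v h * (\<Sum>k<n. ?e (idot h z + (int j - int i)) k)"
      unfolding sum_distrib_left torus_char_lattice_point[OF n] ee[symmetric] by (simp only: mult.assoc)
    also have "(\<Sum>k<n. ?e (idot h z + (int j - int i)) k) = (if [idot h z + (int j - int i) = 0] (mod int n) then of_nat n else 0)"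
      by (rule root_of_unity_sum[OF n])
    also have "[idot h z + (int j - int i) = 0] (mod int n) \<longleftrightarrow> [idot h z = int i - int j] (mod int n)"
      by (simp add: cong_iff_dvd_diff algebra_simps)
    finally show ?thesis using n by simp
  qed
  ultimately have "((\<lambda>h. if [idot h z = int i - int j] (mod int n) then fourier_coeff v h else 0) has_sum W_mat n z v $$ (i, j)) UNIV"
    by simp
  then show ?thesis
    by (rule has_sum_cong_neutral[THEN iffD1, rotated -1]) auto
qed

section \<open>Bounds for the potential uniform in the lattice\<close>

text \<open>Cauchy-Schwarz with the kernel split into two square roots.\<close>

lemma (in weighted) schur_test:
  assumes le: "\<And>i j. i < n \<Longrightarrow> j < n \<Longrightarrow> (1 + d i) ^ l * cmod (M i j) \<le> k i j * (1 + d j) ^ q"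
    and k: "\<And>i j. 0 \<le> k i j" and R: "0 \<le> R"
    and rows: "\<And>i. i < n \<Longrightarrow> (\<Sum>j<n. k i j) \<le> R" and cols: "\<And>j. j < n \<Longrightarrow> (\<Sum>i<n. k i j) \<le> R"
  shows "op_bound n d l q R M"
  unfolding op_bound_def
proof (intro conjI allI)
  fix y
  define Y where "Y = (\<lambda>j. (1 + d j) ^ q * cmod (y j))"
  have Y0: "0 \<le> Y j" for j using d_nonneg[of j] by (simp add: Y_def)
  have row: "((1 + d i) ^ l * cmod (mapp n M y i))\<^sup>2 \<le> R * (\<Sum>j<n. k i j * (Y j)\<^sup>2)" if i: "i < n" for i
  proof -
    have "(1 + d i) ^ l * cmod (mapp n M y i) \<le> (1 + d i) ^ l * (\<Sum>j<n. cmod (M i j * y j))"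
      unfolding mapp_def using d_nonneg[of i] by (intro mult_left_mono norm_sum) auto
    also have "\<dots> = (\<Sum>j<n. (1 + d i) ^ l * cmod (M i j) * cmod (y j))"
      by (simp add: sum_distrib_left norm_mult mult.assoc)
    also have "\<dots> \<le> (\<Sum>j<n. k i j * (1 + d j) ^ q * cmod (y j))"
      by (intro sum_mono mult_right_mono le i) auto
    also have "\<dots> = (\<Sum>j<n. sqrt (k i j) * (sqrt (k i j) * Y j))"
      by (intro sum.cong refl) (simp add: Y_def k flip: mult.assoc)
    finally have "((1 + d i) ^ l * cmod (mapp n M y i))\<^sup>2 \<le> (\<Sum>j<n. sqrt (k i j) * (sqrt (k i j) * Y j))\<^sup>2"
      using d_nonneg[of i] by (intro power_mono) auto
    also have "\<dots> \<le> (\<Sum>j<n. (sqrt (k i j))\<^sup>2) * (\<Sum>j<n. (sqrt (k i j) * Y j)\<^sup>2)"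
      by (rule Cauchy_Schwarz_ineq_sum)
    also have "\<dots> = (\<Sum>j<n. k i j) * (\<Sum>j<n. k i j * (Y j)\<^sup>2)"
      by (simp add: k power_mult_distrib)
    also have "\<dots> \<le> R * (\<Sum>j<n. k i j * (Y j)\<^sup>2)"
      by (intro mult_right_mono rows i sum_nonneg mult_nonneg_nonneg k) auto
    finally show ?thesis .
  qed
  have "(wnorm n d l (mapp n M y))\<^sup>2 = (\<Sum>i<n. ((1 + d i) ^ l * cmod (mapp n M y i))\<^sup>2)"
    by (simp add: wnorm_def L2_set_def sum_nonneg)
  also have "\<dots> \<le> (\<Sum>i<n. R * (\<Sum>j<n. k i j * (Y j)\<^sup>2))" by (intro sum_mono row) auto
  also have "\<dots> = R * (\<Sum>i<n. \<Sum>j<n. k i j * (Y j)\<^sup>2)" by (rule sum_distrib_left[symmetric])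
  also have "\<dots> = R * (\<Sum>j<n. (\<Sum>i<n. k i j) * (Y j)\<^sup>2)"
    unfolding sum_distrib_right by (rule arg_cong[OF sum.swap])
  also have "\<dots> \<le> R * (\<Sum>j<n. R * (Y j)\<^sup>2)"
    by (intro mult_left_mono sum_mono mult_right_mono cols R) auto
  also have "\<dots> = (R * wnorm n d q y)\<^sup>2"
    by (simp add: wnorm_def L2_set_def Y_def sum_nonneg power_mult_distrib sum_distrib_left power2_eq_square[of R] mult.assoc)
  finally show "wnorm n d l (mapp n M y) \<le> R * wnorm n d q y"
    by (rule power2_le_imp_le) (use R in auto)
qed fact

text \<open>The alias classes of pairwise incongruent residues are disjoint. For n residues this is a bound by a
sum over the whole frequency lattice, in which n no longer occurs.\<close>

lemma alias_sum_le:
  fixes \<rho> :: "int ^ 'd \<Rightarrow> real"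
  assumes n: "1 \<le> n" and \<rho>: "\<rho> summable_on UNIV" "\<And>h. 0 \<le> \<rho> h"
    and inj: "\<And>j j'. j < n \<Longrightarrow> j' < n \<Longrightarrow> [r j = r j'] (mod int n) \<Longrightarrow> j = j'"
  shows "(\<Sum>j<n. infsum \<rho> {h. [idot h z = r j] (mod int n)}) \<le> infsum \<rho> UNIV"
proof -
  have sub: "\<rho> summable_on A" for A by (rule summable_on_subset_banach[OF \<rho>(1)]) simp
  have "(\<Sum>j<n. infsum \<rho> {h. [idot h z = r j] (mod int n)}) = infsum \<rho> (\<Union>j\<in>{..<n}. {h. [idot h z = r j] (mod int n)})"
  proof (rule sum_infsum)
    fix j j' assume j: "j \<in> {..<n}" "j' \<in> {..<n}" "j \<noteq> j'"
    have "\<not> ([idot h z = r j] (mod int n) \<and> [idot h z = r j'] (mod int n))" for h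
      using inj[of j j'] j cong_trans[of "r j" "idot h z" "int n" "r j'"] cong_sym[of "idot h z" "r j" "int n"] by auto
    then show "{h. [idot h z = r j] (mod int n)} \<inter> {h. [idot h z = r j'] (mod int n)} = {}" by blast
  qed (use sub in auto)
  also have "\<dots> \<le> infsum \<rho> UNIV"
    by (rule infsum_mono2) (use sub \<rho> in auto)
  finally show ?thesis .
qed

lemma idot_add: "idot (h + k) z = idot h z + idot k z"
  by (simp add: idot_def distrib_right sum.distrib)

lemma residue_unique: "j < n \<Longrightarrow> j' < n \<Longrightarrow> [int j = int j'] (mod int n) \<Longrightarrow> j = j'"
  by (simp add: cong_int_iff cong_less_modulus_unique_nat)

text \<open>The diagonal entries of scaled_D.\<close>

definition kinetic :: "real \<Rightarrow> (nat \<Rightarrow> int ^ 'd) \<Rightarrow> nat \<Rightarrow> real" where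
  "kinetic \<gamma> h i = 2 * pi\<^sup>2 * \<gamma> * (norm (rvec (h i)))\<^sup>2"

text \<open>The vector h j + k lies in the alias class of i, so by minimality h i is not longer. The weight of
i is therefore at most that of j times the weight of k, up to a constant, independently of n; this is
the point at which the choice of the anti-aliasing set matters.\<close>

lemma kinetic_comparison:
  assumes min: "minimal_anti_aliasing z n A h" and i: "i < n" and j: "j < n" and \<gamma>: "0 < \<gamma>"
    and k: "[idot k z = int i - int j] (mod int n)"
  shows "1 + kinetic \<gamma> h i \<le> (2 + 4 * pi\<^sup>2 * \<gamma>) * (1 + (norm (rvec k))\<^sup>2) * (1 + kinetic \<gamma> h j)"
proof -
  define c where "c = 2 * pi\<^sup>2 * \<gamma>"
  have c: "0 \<le> c" using \<gamma> by (simp add: c_def)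
  define x where "x = norm (rvec (h j))"
  define y where "y = norm (rvec k)"
  have "[idot (h j) z + idot k z = int j + (int i - int j)] (mod int n)"
    using min j k by (intro cong_add) (auto simp: minimal_anti_aliasing_def full_anti_aliasing_def)
  then have "h j + k \<in> alias_class z n i" by (simp add: alias_class_def idot_add)
  then have "norm (rvec (h i)) \<le> norm (rvec (h j + k))"
    using min i by (auto simp: minimal_anti_aliasing_def)
  also have "\<dots> \<le> x + y" unfolding rvec_add x_def y_def by (rule norm_triangle_ineq)
  finally have "(norm (rvec (h i)))\<^sup>2 \<le> (x + y)\<^sup>2" by (intro power_mono) auto
  also have "\<dots> \<le> 2 * x\<^sup>2 + 2 * y\<^sup>2"
    using zero_le_power2[of "x - y"] by (simp add: power2_eq_square algebra_simps)
  finally have "c * (norm (rvec (h i)))\<^sup>2 \<le> c * (2 * x\<^sup>2 + 2 * y\<^sup>2)" by (rule mult_left_mono[OF _ c])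
  then have "1 + kinetic \<gamma> h i \<le> 1 + c * (2 * x\<^sup>2 + 2 * y\<^sup>2)" by (simp add: kinetic_def c_def)
  also have "\<dots> \<le> (2 + 2 * c) * (1 + y\<^sup>2) * (1 + c * x\<^sup>2)"
  proof -
    have "0 \<le> c * x\<^sup>2" "0 \<le> y\<^sup>2" "0 \<le> c * y\<^sup>2" "0 \<le> c * x\<^sup>2 * y\<^sup>2" "0 \<le> c * (c * x\<^sup>2)" "0 \<le> c * (c * x\<^sup>2 * y\<^sup>2)"
      using c by auto
    then show ?thesis using c by (simp add: algebra_simps)
  qed
  also have "\<dots> = (2 + 4 * pi\<^sup>2 * \<gamma>) * (1 + (norm (rvec k))\<^sup>2) * (1 + kinetic \<gamma> h j)"
    by (simp add: c_def x_def y_def kinetic_def mult_ac)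
  finally show ?thesis .
qed

lemma weighted_kinetic: "0 < \<gamma> \<Longrightarrow> weighted (kinetic \<gamma> h)"
  by unfold_locales (simp add: kinetic_def)

text \<open>The entry W i j is a sum of Fourier coefficients over the class of i - j. By kinetic_comparison the
weights of i and j and the factor d i - d j can be moved inside that sum, onto the frequency k,
at the expense of (1 + |k|^2)^p. The kernel that results has row and column sums at most the full
weighted sum of the Fourier coefficients of v / \<gamma>, and Schur's test applies.\<close>

lemma uniform_potential_bounds:
  fixes v :: "real ^ 'd \<Rightarrow> complex"
  assumes v: "v \<in> korobov_cont \<alpha>" and \<alpha>: "\<alpha> > 2 * real p + 1 / 2" and \<gamma>: "0 < \<gamma>"
  shows "\<exists>R\<ge>0. \<forall>(z :: int ^ 'd) n A h. 1 \<le> n \<longrightarrow> minimal_anti_aliasing z n A h \<longrightarrow>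
    (\<forall>l\<le>p. op_bound n (kinetic \<gamma> h) l l R (\<lambda>i j. W_mat n z v $$ (i, j) / of_real \<gamma>)) \<and>
    op_bound n (kinetic \<gamma> h) 0 p R
      (\<lambda>i j. of_real ((kinetic \<gamma> h i - kinetic \<gamma> h j) ^ p) * (W_mat n z v $$ (i, j) / of_real \<gamma>))"
proof -
  define K where "K = 2 + 4 * pi\<^sup>2 * \<gamma>"
  have K: "1 \<le> K" using \<gamma> by (simp add: K_def)
  define m where "m = (\<lambda>h :: int ^ 'd. K * (1 + (norm (rvec h))\<^sup>2))"
  have m1: "1 \<le> m h" for h
  proof -
    have "1 * 1 \<le> m h" unfolding m_def using K by (intro mult_mono) auto
    then show ?thesis by simp
  qed
  define \<rho> where "\<rho> = (\<lambda>h. cmod (fourier_coeff v h) * m h ^ p / \<gamma>)"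
  have "(\<lambda>h. cmod (fourier_coeff v h) * m h ^ p) summable_on UNIV"
    unfolding m_def by (rule korobov_weighted_summable[where \<alpha> = \<alpha>]) (use v \<alpha> K in \<open>auto simp: korobov_cont_def\<close>)
  note sm = this
  have \<rho>: "\<rho> summable_on UNIV"
    unfolding \<rho>_def divide_inverse by (rule summable_on_cmult_left[OF sm])
  have \<rho>0: "0 \<le> \<rho> h" for h
    using m1[of h] \<gamma> by (simp add: \<rho>_def)
  have summable: "(\<lambda>h. cmod (fourier_coeff v h)) summable_on UNIV"
  proof (rule summable_on_comparison_test[OF sm])
    fix h
    show "cmod (fourier_coeff v h) \<le> cmod (fourier_coeff v h) * m h ^ p"
      using mult_left_mono[OF one_le_power[OF m1[of h], of p], of "cmod (fourier_coeff v h)"] by simp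
  qed auto
  have per: "torus_periodic v" and cont: "continuous_on UNIV v"
    using v by (auto simp: korobov_cont_def korobov_space_def torus_L2_def)
  define R where "R = infsum \<rho> UNIV"
  have R0: "0 \<le> R" unfolding R_def by (rule infsum_nonneg) (rule \<rho>0)
  show ?thesis
  proof (intro exI[of _ R] conjI[OF R0] allI impI)
    fix z :: "int ^ 'd" and n A h
    assume n: "1 \<le> n" and min: "minimal_anti_aliasing z n A h"
    interpret weighted n "kinetic \<gamma> h" by (rule weighted_kinetic[OF \<gamma>])
    let ?d = "kinetic \<gamma> h"
    define cl where "cl = (\<lambda>i j. {k. [idot k z = int i - int j] (mod int n)})"
    define ker where "ker = (\<lambda>i j. infsum \<rho> (cl i j))"
    have ker0: "0 \<le> ker i j" for i j unfolding ker_def by (rule infsum_nonneg) (rule \<rho>0)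
    have rows: "(\<Sum>j<n. ker i j) \<le> R" for i
      unfolding ker_def cl_def R_def
    proof (rule alias_sum_le[OF n \<rho> \<rho>0])
      fix j j' assume j: "j < n" "j' < n" and c: "[int i - int j = int i - int j'] (mod int n)"
      show "j = j'" by (rule residue_unique[OF j]) (use cong_diff[OF cong_refl[of "int i"] c] in simp)
    qed
    have cols: "(\<Sum>i<n. ker i j) \<le> R" for j
      unfolding ker_def cl_def R_def
    proof (rule alias_sum_le[OF n \<rho> \<rho>0])
      fix i i' assume i: "i < n" "i' < n" and c: "[int i - int j = int i' - int j] (mod int n)"
      show "i = i'" by (rule residue_unique[OF i]) (use cong_add[OF c cong_refl[of "int j"]] in simp)
    qed
    have entry: "q * cmod (W_mat n z v $$ (i, j) / of_real \<gamma>) \<le> ker i j"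
      if ij: "i < n" "j < n" and q: "0 \<le> q" "\<And>k. k \<in> cl i j \<Longrightarrow> q \<le> m k ^ p" for q i j
    proof -
      have sub: "f summable_on cl i j" if "f summable_on UNIV" for f :: "int ^ 'd \<Rightarrow> real"
        by (rule summable_on_subset_banach[OF that]) simp
      have "(fourier_coeff v has_sum W_mat n z v $$ (i, j)) (cl i j)"
        unfolding cl_def by (rule W_mat_aliasing[OF n ij per cont summable])
      then have "W_mat n z v $$ (i, j) = infsum (fourier_coeff v) (cl i j)" by (simp add: infsumI)
      then have "cmod (W_mat n z v $$ (i, j)) \<le> (\<Sum>\<^sub>\<infinity>k\<in>cl i j. cmod (fourier_coeff v k))"
        using norm_infsum_bound[OF sub[OF summable]] by simp
      then have "q / \<gamma> * cmod (W_mat n z v $$ (i, j)) \<le> q / \<gamma> * (\<Sum>\<^sub>\<infinity>k\<in>cl i j. cmod (fourier_coeff v k))"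
        using q \<gamma> by (intro mult_left_mono) auto
      also have "\<dots> = (\<Sum>\<^sub>\<infinity>k\<in>cl i j. q / \<gamma> * cmod (fourier_coeff v k))"
        by (rule infsum_cmult_right[symmetric]) (rule sub[OF summable])
      also have "\<dots> \<le> ker i j"
        unfolding ker_def
      proof (rule infsum_mono)
        show "(\<lambda>k. q / \<gamma> * cmod (fourier_coeff v k)) summable_on cl i j"
          by (intro summable_on_cmult_right sub summable)
        show "\<rho> summable_on cl i j" by (rule sub[OF \<rho>])
        fix k assume "k \<in> cl i j"
        then have "q * cmod (fourier_coeff v k) \<le> m k ^ p * cmod (fourier_coeff v k)"
          by (intro mult_right_mono q) auto
        then show "q / \<gamma> * cmod (fourier_coeff v k) \<le> \<rho> k"
          using \<gamma> by (simp add: \<rho>_def divide_right_mono mult.commute)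
      qed
      finally show ?thesis using \<gamma> by (simp add: norm_divide)
    qed
    have comp: "(1 + ?d i) \<le> m k * (1 + ?d j)" if "i < n" "j < n" "k \<in> cl i j" for i j k
      using kinetic_comparison[OF min that(1,2) \<gamma>, of k] that(3) by (simp add: m_def K_def cl_def)
    have d0: "0 < 1 + ?d j" for j using d_nonneg[of j] by simp
    have part1: "\<forall>l\<le>p. op_bound n ?d l l R (\<lambda>i j. W_mat n z v $$ (i, j) / of_real \<gamma>)"
    proof (intro allI impI)
      fix l assume l: "l \<le> p"
      show "op_bound n ?d l l R (\<lambda>i j. W_mat n z v $$ (i, j) / of_real \<gamma>)"
      proof (rule schur_test[OF _ ker0 R0 rows cols])
        fix i j assume ij: "i < n" "j < n"
        have "((1 + ?d i) / (1 + ?d j)) ^ l * cmod (W_mat n z v $$ (i, j) / of_real \<gamma>) \<le> ker i j"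
        proof (rule entry[OF ij])
          fix k assume "k \<in> cl i j"
          then have "(1 + ?d i) / (1 + ?d j) \<le> m k" using comp[OF ij] d0[of j] by (simp add: divide_le_eq)
          then have "((1 + ?d i) / (1 + ?d j)) ^ l \<le> m k ^ l"
            using d0[of i] d0[of j] by (intro power_mono) auto
          also have "\<dots> \<le> m k ^ p" using m1 l by (intro power_increasing) auto
          finally show "((1 + ?d i) / (1 + ?d j)) ^ l \<le> m k ^ p" .
        qed (use d0[of i] d0[of j] in auto)
        from mult_right_mono[OF this, of "(1 + ?d j) ^ l"]
        show "(1 + ?d i) ^ l * cmod (W_mat n z v $$ (i, j) / of_real \<gamma>) \<le> ker i j * (1 + ?d j) ^ l"
          using d0[of j] by (simp add: power_divide)
      qed
    qed
    have part2: "op_bound n ?d 0 p R (\<lambda>i j. of_real ((?d i - ?d j) ^ p) * (W_mat n z v $$ (i, j) / of_real \<gamma>))"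
    proof (rule schur_test[OF _ ker0 R0 rows cols])
      fix i j assume ij: "i < n" "j < n"
      have "(\<bar>?d i - ?d j\<bar> / (1 + ?d j)) ^ p * cmod (W_mat n z v $$ (i, j) / of_real \<gamma>) \<le> ker i j"
      proof (rule entry[OF ij])
        fix k assume k: "k \<in> cl i j"
        have "1 * (1 + ?d j) \<le> m k * (1 + ?d j)" using m1[of k] d0[of j] by (intro mult_right_mono) auto
        moreover have "\<bar>x - y\<bar> \<le> M" if "1 * (1 + y) \<le> M" "1 + x \<le> M" "0 \<le> x" "0 \<le> y" for x y M :: real
          using that by (simp add: abs_le_iff)
        ultimately have "\<bar>?d i - ?d j\<bar> \<le> m k * (1 + ?d j)"
          using comp[OF ij k] d_nonneg[of i] d_nonneg[of j] by blast
        then have "\<bar>?d i - ?d j\<bar> / (1 + ?d j) \<le> m k" using d0[of j] by (simp add: divide_le_eq)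
        then show "(\<bar>?d i - ?d j\<bar> / (1 + ?d j)) ^ p \<le> m k ^ p"
          using d0[of j] by (intro power_mono) auto
      qed (use d0[of j] in auto)
      from mult_right_mono[OF this, of "(1 + ?d j) ^ p"]
      show "(1 + ?d i) ^ 0 * cmod (of_real ((?d i - ?d j) ^ p) * (W_mat n z v $$ (i, j) / of_real \<gamma>)) \<le> ker i j * (1 + ?d j) ^ p"
        unfolding norm_mult norm_of_real power_abs using d0[of j] by (simp add: power_divide)
    qed
    from part1 part2 show "(\<forall>l\<le>p. op_bound n ?d l l R (\<lambda>i j. W_mat n z v $$ (i, j) / of_real \<gamma>)) \<and>
      op_bound n ?d 0 p R (\<lambda>i j. of_real ((?d i - ?d j) ^ p) * (W_mat n z v $$ (i, j) / of_real \<gamma>))"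
      by (rule conjI)
  qed
qed

section \<open>Exponentials and splittings as arrays\<close>

definition entries :: "complex Matrix.mat \<Rightarrow> cmatrix" where
  "entries M = (\<lambda>i j. M $$ (i, j))"

lemma entries_mult:
  assumes "A \<in> carrier_mat n n" "B \<in> carrier_mat n n" "i < n" "j < n"
  shows "(A * B) $$ (i, j) = mmul n (entries A) (entries B) i j"
  using assms by (simp add: mmul_def entries_def scalar_prod_def atLeast0LessThan)

lemma entries_mult_vec:
  assumes "A \<in> carrier_mat n n" "y \<in> carrier_vec n" "i < n"
  shows "vec_index (A *\<^sub>v y) i = mapp n (entries A) (vec_index y) i"
  using assms by (simp add: mapp_def entries_def scalar_prod_def atLeast0LessThan)

lemma pow_mat_Suc_left: "A \<in> carrier_mat n n \<Longrightarrow> A ^\<^sub>m Suc k = A * A ^\<^sub>m k"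
proof (induction k)
  case 0
  then show ?case by simp
next
  case (Suc k)
  then have "A ^\<^sub>m Suc (Suc k) = (A * A ^\<^sub>m k) * A" by simp
  also have "\<dots> = A * (A ^\<^sub>m k * A)" using Suc.prems by (metis assoc_mult_mat pow_carrier_mat)
  finally show ?case by simp
qed

lemma entries_pow:
  assumes "A \<in> carrier_mat n n"
  shows "i < n \<Longrightarrow> j < n \<Longrightarrow> (A ^\<^sub>m k) $$ (i, j) = mpow n (entries A) k i j"
proof (induction k arbitrary: i j)
  case 0
  then show ?case using assms by (simp add: diagm_apply)
next
  case (Suc k)
  have "(A ^\<^sub>m Suc k) $$ (i, j) = mmul n (entries A) (entries (A ^\<^sub>m k)) i j"
    unfolding pow_mat_Suc_left[OF assms] using assms Suc.prems by (intro entries_mult) auto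
  also have "\<dots> = mpow n (entries A) (Suc k) i j"
    unfolding mpow.simps by (rule mmul_cong) (use Suc in \<open>auto simp: entries_def\<close>)
  finally show ?case .
qed

lemma mpow_cong:
  assumes "\<And>i j. i < n \<Longrightarrow> j < n \<Longrightarrow> M i j = M' i j"
  shows "i < n \<Longrightarrow> j < n \<Longrightarrow> mpow n M k i j = mpow n M' k i j"
  by (induction k arbitrary: i j) (auto intro: mmul_cong assms)

lemma mexp_cong:
  assumes "\<And>i j. i < n \<Longrightarrow> j < n \<Longrightarrow> M i j = M' i j" "i < n" "j < n"
  shows "mexp n M \<sigma> i j = mexp n M' \<sigma> i j"
  by (simp add: mexp_def exp_coeff_def scalem_def mpow_cong[OF assms])

lemma mpow_scalem: "mpow n (scalem c M) k = scalem (c ^ k) (mpow n M k)"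
proof (induction k)
  case (Suc k)
  then show ?case
    by (simp add: mmul_def scalem_def fun_eq_iff sum_distrib_left mult_ac)
qed (simp add: scalem_def)

lemma mat_exp_carrier: "A \<in> carrier_mat n n \<Longrightarrow> mat_exp A \<in> carrier_mat n n"
  by (simp add: mat_exp_def)

lemma mat_exp_entry:
  assumes M: "M \<in> carrier_mat n n" and ij: "i < n" "j < n"
  shows "mat_exp (complex_of_real (r * \<sigma>) \<cdot>\<^sub>m M) $$ (i, j) = mexp n (scalem (of_real r) (entries M)) \<sigma> i j"
proof -
  let ?A = "complex_of_real (r * \<sigma>) \<cdot>\<^sub>m M"
  have A: "?A \<in> carrier_mat n n" using M by simp
  have "(?A ^\<^sub>m k) $$ (i, j) / fact k = exp_coeff n (scalem (of_real r) (entries M)) k i j * of_real \<sigma> ^ k" for k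
  proof -
    have "mpow n (entries ?A) k i j = mpow n (scalem (of_real (r * \<sigma>)) (entries M)) k i j"
      by (rule mpow_cong) (use M ij in \<open>auto simp: entries_def scalem_def\<close>)
    then show ?thesis
      unfolding entries_pow[OF A ij] exp_coeff_def mpow_scalem by (simp add: scalem_def power_mult_distrib)
  qed
  then show ?thesis using M A ij unfolding mat_exp_def mexp_def by (simp del: of_real_mult)
qed

lemma splitting_entries:
  assumes A: "A \<in> carrier_mat n n" and B: "B \<in> carrier_mat n n"
  shows "splitting s a b A B \<sigma> \<in> carrier_mat n n \<and>
    (\<forall>i<n. \<forall>j<n. splitting s a b A B \<sigma> $$ (i, j) = msplit n s a b (entries A) (entries B) \<sigma> i j)"
proof (induction s)
  case 0
  then show ?case using A by (simp add: diagm_apply)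
next
  case (Suc s)
  let ?EB = "mat_exp (complex_of_real (b (Suc s) * \<sigma>) \<cdot>\<^sub>m B)" and ?EA = "mat_exp (complex_of_real (a (Suc s) * \<sigma>) \<cdot>\<^sub>m A)"
  have E: "?EB \<in> carrier_mat n n" "?EA \<in> carrier_mat n n" using A B by (auto intro!: mat_exp_carrier)
  have inner: "(?EB * ?EA) $$ (i, j) = mmul n (mexp n (scalem (b (Suc s)) (entries B)) \<sigma>)
      (mexp n (scalem (a (Suc s)) (entries A)) \<sigma>) i j" if "i < n" "j < n" for i j
    unfolding entries_mult[OF E that]
    by (rule mmul_cong) (use that A B in \<open>simp_all add: mat_exp_entry entries_def[of "mat_exp _"] del: of_real_mult\<close>)
  have "splitting (Suc s) a b A B \<sigma> $$ (i, j) = msplit n (Suc s) a b (entries A) (entries B) \<sigma> i j" if ij: "i < n" "j < n" for i j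
  proof -
    have "splitting (Suc s) a b A B \<sigma> $$ (i, j) = mmul n (entries (splitting s a b A B \<sigma>)) (entries (?EB * ?EA)) i j"
      unfolding splitting.simps by (rule entries_mult) (use Suc E ij in auto)
    also have "\<dots> = msplit n (Suc s) a b (entries A) (entries B) \<sigma> i j"
      unfolding msplit.simps
      by (rule mmul_cong) (use Suc inner ij in \<open>auto simp: entries_def[of "splitting _ _ _ _ _ _"] entries_def[of "_ * _"]\<close>)
    finally show ?thesis .
  qed
  then show ?case using Suc E by auto
qed

lemma msplit_cong:
  assumes "\<And>i j. i < n \<Longrightarrow> j < n \<Longrightarrow> A i j = A' i j" "\<And>i j. i < n \<Longrightarrow> j < n \<Longrightarrow> B i j = B' i j"
  shows "i < n \<Longrightarrow> j < n \<Longrightarrow> msplit n s a b A B \<sigma> i j = msplit n s a b A' B' \<sigma> i j"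
proof (induction s arbitrary: i j)
  case (Suc s)
  show ?case unfolding msplit.simps
    by (intro mmul_cong mexp_cong Suc) (auto simp: scalem_def assms)
qed simp

lemma vnorm_eq_wnorm: "dim_vec y = n \<Longrightarrow> vnorm y = wnorm n d 0 (vec_index y)"
  by (simp add: vnorm_def wnorm_def L2_set_def)

lemma cmod_le_vnorm: "i < dim_vec y \<Longrightarrow> cmod (vec_index y i) \<le> vnorm y"
  using member_le_L2_set[of "{..<dim_vec y}" i "\<lambda>i. cmod (vec_index y i)"] by (simp add: vnorm_def L2_set_def)

lemma matrix_order_of_splitting_order:
  assumes "splitting_order s a b p"
  shows "matrix_order s a b p"
  unfolding matrix_order_def
proof (intro allI impI)
  fix n i j :: nat and A B :: cmatrix assume ij: "i < n" "j < n"
  define MA where "MA = Matrix.mat n n (\<lambda>(i, j). A i j)"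
  define MB where "MB = Matrix.mat n n (\<lambda>(i, j). B i j)"
  have M: "MA \<in> carrier_mat n n" "MB \<in> carrier_mat n n" by (simp_all add: MA_def MB_def)
  define y where "y = (unit_vec n j :: complex Matrix.vec)"
  have y: "y \<in> carrier_vec n" by (simp add: y_def)
  obtain C where C: "\<forall>\<^sub>F dt in at_right 0.
      vnorm (splitting s a b MA MB dt *\<^sub>v y - mat_exp (complex_of_real dt \<cdot>\<^sub>m (MA + MB)) *\<^sub>v y) \<le> C * dt ^ (p + 1)"
    using assms M y unfolding splitting_order_def by blast
  have "cmod (msplit n s a b A B dt i j - mexp n (A + B) dt i j)
      \<le> vnorm (splitting s a b MA MB dt *\<^sub>v y - mat_exp (complex_of_real dt \<cdot>\<^sub>m (MA + MB)) *\<^sub>v y)" for dt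
  proof -
    let ?S = "splitting s a b MA MB dt" and ?T = "mat_exp (complex_of_real dt \<cdot>\<^sub>m (MA + MB))"
    have S: "?S \<in> carrier_mat n n" using splitting_entries[OF M] by blast
    have T: "?T \<in> carrier_mat n n" using M by (intro mat_exp_carrier) auto
    have S_entry: "?S $$ (i, j) = msplit n s a b A B dt i j"
      using splitting_entries[OF M, of s a b dt] ij msplit_cong[of n "entries MA" A "entries MB" B i j s a b dt]
      by (simp add: entries_def MA_def MB_def)
    have "?T $$ (i, j) = mexp n (scalem (of_real 1) (entries (MA + MB))) dt i j"
      using mat_exp_entry[of "MA + MB" n i j 1 dt] M ij by simp
    also have "\<dots> = mexp n (A + B) dt i j"
      by (rule mexp_cong) (use ij in \<open>auto simp: scalem_def entries_def MA_def MB_def fun_arith\<close>)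
    finally have T_entry: "?T $$ (i, j) = mexp n (A + B) dt i j" .
    have col: "vec_index (X *\<^sub>v y) i = X $$ (i, j)" if X: "X \<in> carrier_mat n n" for X
      using X ij by (simp add: y_def)
    have "vec_index (?S *\<^sub>v y - ?T *\<^sub>v y) i = msplit n s a b A B dt i j - mexp n (A + B) dt i j"
      using ij S T by (simp add: col S_entry T_entry del: index_mult_mat_vec)
    moreover have "i < dim_vec (?S *\<^sub>v y - ?T *\<^sub>v y)" using T ij by simp
    ultimately show ?thesis using cmod_le_vnorm by metis
  qed
  then have "\<forall>\<^sub>F dt in at_right 0. cmod (msplit n s a b A B dt i j - mexp n (A + B) dt i j) \<le> C * dt ^ (p + 1)"
    using C by (elim eventually_mono) (meson order_trans)
  then show "\<exists>C. \<forall>\<^sub>F \<sigma> in at_right 0. cmod (msplit n s a b A B \<sigma> i j - mexp n (A + B) \<sigma> i j) \<le> C * \<sigma> ^ (p + 1)"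
    by blast
qed

section \<open>Commutator bound and total error\<close>

lemma scaled_D_eq: "scaled_D \<gamma> n h = mat_diag n (\<lambda>i. complex_of_real (kinetic \<gamma> h i))"
  by (rule eq_matI) (auto simp: scaled_D_def D_mat_def mat_diag_def kinetic_def)

lemma dim_mat_diag [simp]: "dim_row (mat_diag n f) = n" "dim_col (mat_diag n f) = n"
  by (simp_all add: mat_diag_def)

lemma scaled_W_carrier: "1 \<le> n \<Longrightarrow> scaled_W \<gamma> n z v \<in> carrier_mat n n"
  using W_mat_entry(2)[of n 0 0 z v] by (simp add: scaled_W_def)

lemma scaled_W_entry:
  "1 \<le> n \<Longrightarrow> i < n \<Longrightarrow> j < n \<Longrightarrow> scaled_W \<gamma> n z v $$ (i, j) = W_mat n z v $$ (i, j) / of_real \<gamma>"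
  using W_mat_entry(2)[of n i j z v] by (simp add: scaled_W_def)

lemma ad_mat_diag:
  assumes M: "M \<in> carrier_mat n n"
  shows "ad (mat_diag n f) p M = Matrix.mat n n (\<lambda>(i, j). (f i - f j) ^ p * M $$ (i, j))"
proof (induction p)
  case 0
  then show ?case using M by (auto intro!: eq_matI)
next
  case (Suc p)
  let ?M = "Matrix.mat n n (\<lambda>(i, j). (f i - f j) ^ p * M $$ (i, j))"
  have C: "?M \<in> carrier_mat n n" by simp
  show ?case
    unfolding ad.simps Suc commutator_def mat_diag_mult_left[OF C] mat_diag_mult_right[OF C]
    by (rule eq_matI) (auto simp: algebra_simps)
qed

lemma scaled_D_plus_one_pow:
  "(scaled_D \<gamma> n h + 1\<^sub>m n) ^\<^sub>m p = mat_diag n (\<lambda>i. complex_of_real ((1 + kinetic \<gamma> h i) ^ p))"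
proof (induction p)
  case 0
  then show ?case by (auto intro!: eq_matI simp: scaled_D_eq mat_diag_def)
next
  case (Suc p)
  have eq: "scaled_D \<gamma> n h + 1\<^sub>m n = mat_diag n (\<lambda>i. complex_of_real (1 + kinetic \<gamma> h i))"
    by (rule eq_matI) (auto simp: scaled_D_eq mat_diag_def)
  show ?case unfolding pow_mat.simps Suc unfolding eq mat_diag_diag by (simp add: mult.commute)
qed

lemma mat_diag_mult_vec: "y \<in> carrier_vec n \<Longrightarrow> i < n \<Longrightarrow> vec_index (mat_diag n f *\<^sub>v y) i = f i * vec_index y i"
  by (simp add: mat_diag_def scalar_prod_def if_distrib[of "\<lambda>x. x * _"] cong: if_cong)

lemma vnorm_scaled_D_plus_one_pow:
  assumes "y \<in> carrier_vec n" "0 < \<gamma>"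
  shows "vnorm (((scaled_D \<gamma> n h + 1\<^sub>m n) ^\<^sub>m p) *\<^sub>v y) = wnorm n (kinetic \<gamma> h) p (vec_index y)"
proof -
  have "0 \<le> kinetic \<gamma> h i" for i using assms by (simp add: kinetic_def)
  then have c: "cmod (complex_of_real ((1 + kinetic \<gamma> h i) ^ p)) = (1 + kinetic \<gamma> h i) ^ p" for i
    unfolding norm_of_real by simp
  let ?M = "(scaled_D \<gamma> n h + 1\<^sub>m n) ^\<^sub>m p"
  have "vnorm (?M *\<^sub>v y) = L2_set (\<lambda>i. cmod (vec_index (?M *\<^sub>v y) i)) {..<n}"
    by (simp add: vnorm_def L2_set_def scaled_D_plus_one_pow del: index_mult_mat_vec)
  also have "\<dots> = wnorm n (kinetic \<gamma> h) p (vec_index y)"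
    unfolding wnorm_def scaled_D_plus_one_pow
    by (rule L2_set_cong) (use assms c in \<open>simp_all add: mat_diag_mult_vec norm_mult del: index_mult_mat_vec of_real_power\<close>)
  finally show ?thesis .
qed

text \<open>Division of the discretized equation by \<i> \<gamma>.\<close>

lemma flow_on_discretized_solution:
  assumes u: "discretized_solution \<gamma> z n h v g u" and n: "1 \<le> n" and \<gamma>: "0 < \<gamma>"
  shows "flow_on n (\<lambda>i. - \<i> * complex_of_real (kinetic \<gamma> h i)) (\<lambda>i j. - \<i> * (W_mat n z v $$ (i, j) / of_real \<gamma>))
    {0..} (\<lambda>t. vec_index (u t))"
  unfolding flow_on_def
proof (intro ballI allI impI)
  fix t :: real and i assume t: "t \<in> {0..}" and i: "i < n"
  have W: "W_mat n z v \<in> carrier_mat n n" using W_mat_entry(2)[OF n i i] .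
  have ut: "u t \<in> carrier_vec n" using u t by (auto simp: discretized_solution_def)
  obtain u' where u': "u' \<in> carrier_vec n"
    and der: "((\<lambda>s. vec_index (u s) i) has_vector_derivative vec_index u' i) (at t within {0..})"
    and eq: "(\<i> * complex_of_real \<gamma>) \<cdot>\<^sub>v u' =
             complex_of_real (\<gamma>\<^sup>2 / 2) \<cdot>\<^sub>v (D_mat n h *\<^sub>v u t) + W_mat n z v *\<^sub>v u t"
    using u t i unfolding discretized_solution_def by force
  let ?w = "\<Sum>j<n. W_mat n z v $$ (i, j) * vec_index (u t) j"
  have "vec_index ((\<i> * complex_of_real \<gamma>) \<cdot>\<^sub>v u') i = \<i> * complex_of_real \<gamma> * vec_index u' i"
    using u' i by simp
  moreover have "vec_index (complex_of_real (\<gamma>\<^sup>2 / 2) \<cdot>\<^sub>v (D_mat n h *\<^sub>v u t) + W_mat n z v *\<^sub>v u t) i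
      = complex_of_real (\<gamma>\<^sup>2 / 2) * (complex_of_real (4 * pi\<^sup>2 * (norm (rvec (h i)))\<^sup>2) * vec_index (u t) i) + ?w"
  proof -
    have "vec_index (D_mat n h *\<^sub>v u t) i = complex_of_real (4 * pi\<^sup>2 * (norm (rvec (h i)))\<^sup>2) * vec_index (u t) i"
      unfolding D_mat_def by (rule mat_diag_mult_vec[OF ut i])
    moreover have "vec_index (W_mat n z v *\<^sub>v u t) i = ?w"
      using entries_mult_vec[OF W ut i] by (simp add: mapp_def entries_def)
    moreover have "dim_row (D_mat n h) = n" "dim_row (W_mat n z v) = n" using W by (auto simp: D_mat_def)
    ultimately show ?thesis using i by (simp del: index_mult_mat_vec)
  qed
  ultimately have "\<i> * complex_of_real \<gamma> * vec_index u' i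
      = complex_of_real (\<gamma>\<^sup>2 / 2) * (complex_of_real (4 * pi\<^sup>2 * (norm (rvec (h i)))\<^sup>2) * vec_index (u t) i) + ?w"
    using eq by metis
  also have "complex_of_real (\<gamma>\<^sup>2 / 2) * (complex_of_real (4 * pi\<^sup>2 * (norm (rvec (h i)))\<^sup>2) * vec_index (u t) i)
      = complex_of_real \<gamma> * (complex_of_real (kinetic \<gamma> h i) * vec_index (u t) i)"
    by (simp add: kinetic_def power2_eq_square)
  finally have "\<i> * complex_of_real \<gamma> * vec_index u' i
      = complex_of_real \<gamma> * (complex_of_real (kinetic \<gamma> h i) * vec_index (u t) i) + ?w" .
  then have "- \<i> / complex_of_real \<gamma> * (\<i> * complex_of_real \<gamma> * vec_index u' i)
      = - \<i> / complex_of_real \<gamma> * (complex_of_real \<gamma> * (complex_of_real (kinetic \<gamma> h i) * vec_index (u t) i) + ?w)"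
    by (rule arg_cong)
  then have "vec_index u' i = - \<i> * complex_of_real (kinetic \<gamma> h i) * vec_index (u t) i + - \<i> / complex_of_real \<gamma> * ?w"
    using \<gamma> by (simp add: field_simps)
  also have "- \<i> / complex_of_real \<gamma> * ?w = mapp n (\<lambda>i j. - \<i> * (W_mat n z v $$ (i, j) / of_real \<gamma>)) (vec_index (u t)) i"
    unfolding mapp_def sum_distrib_left by (intro sum.cong refl) simp
  finally show "((\<lambda>s. vec_index (u s) i) has_vector_derivative
      (- \<i> * complex_of_real (kinetic \<gamma> h i) * vec_index (u t) i
        + mapp n (\<lambda>i j. - \<i> * (W_mat n z v $$ (i, j) / of_real \<gamma>)) (vec_index (u t)) i)) (at t within {0..})"
    using der by simp
qed

lemma splitting_approx_entries:
  fixes v :: "real ^ 'd \<Rightarrow> complex" and z :: "int ^ 'd" and h :: "nat \<Rightarrow> int ^ 'd"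
    and s :: nat and a b :: "nat \<Rightarrow> real" and \<gamma> dt :: real
  assumes n: "1 \<le> n" and ua: "ua \<in> carrier_vec n"
  defines "S \<equiv> msplit n s a b (diagm (\<lambda>i. - \<i> * complex_of_real (kinetic \<gamma> h i)))
     (\<lambda>i j. - \<i> * (W_mat n z v $$ (i, j) / of_real \<gamma>)) dt"
  shows "splitting_approx s a b (scaled_D \<gamma> n h) (scaled_W \<gamma> n z v) dt ua k \<in> carrier_vec n \<and>
    (\<forall>i<n. vec_index (splitting_approx s a b (scaled_D \<gamma> n h) (scaled_W \<gamma> n z v) dt ua k) i
      = ((mapp n S ^^ k) (vec_index ua)) i)"
proof (induction k)
  case 0
  then show ?case using ua by (simp add: splitting_approx_def)
next
  case (Suc k)
  let ?A = "(- \<i>) \<cdot>\<^sub>m scaled_D \<gamma> n h" and ?B = "(- \<i>) \<cdot>\<^sub>m scaled_W \<gamma> n z v"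
  let ?M = "splitting s a b ?A ?B dt"
  let ?w = "splitting_approx s a b (scaled_D \<gamma> n h) (scaled_W \<gamma> n z v) dt ua"
  have C: "?A \<in> carrier_mat n n" "?B \<in> carrier_mat n n"
    using scaled_W_carrier[OF n, of \<gamma> z v] by (simp_all add: scaled_D_eq)
  have M: "?M \<in> carrier_mat n n" using splitting_entries[OF C] by blast
  have entry: "?M $$ (i, j) = S i j" if ij: "i < n" "j < n" for i j
  proof -
    have "?M $$ (i, j) = msplit n s a b (entries ?A) (entries ?B) dt i j"
      using splitting_entries[OF C] ij by blast
    also have "\<dots> = S i j"
      unfolding S_def
    proof (rule msplit_cong[OF _ _ ij])
      fix i j assume ij: "i < n" "j < n"
      show "entries ?A i j = diagm (\<lambda>i. - \<i> * complex_of_real (kinetic \<gamma> h i)) i j"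
        using ij by (simp add: entries_def scaled_D_eq mat_diag_def diagm_apply)
      have "dim_row (scaled_W \<gamma> n z v) = n" "dim_col (scaled_W \<gamma> n z v) = n" using scaled_W_carrier[OF n, of \<gamma> z v] by auto
      then show "entries ?B i j = - \<i> * (W_mat n z v $$ (i, j) / of_real \<gamma>)"
        using ij by (simp add: entries_def scaled_W_entry[OF n])
    qed
    finally show ?thesis .
  qed
  have step: "?w (Suc k) = ?M *\<^sub>v ?w k" by (simp add: splitting_approx_def)
  have "vec_index (?w (Suc k)) i = ((mapp n S ^^ Suc k) (vec_index ua)) i" if i: "i < n" for i
  proof -
    have "vec_index (?w (Suc k)) i = mapp n (entries ?M) (vec_index (?w k)) i"
      unfolding step by (rule entries_mult_vec[OF M _ i]) (use Suc in blast)
    also have "\<dots> = mapp n S (vec_index (?w k)) i"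
      by (rule mapp_cong) (use entry i in \<open>simp add: entries_def\<close>)
    also have "mapp n S (vec_index (?w k)) = mapp n S ((mapp n S ^^ k) (vec_index ua))"
      by (rule mapp_vec_cong) (use Suc in blast)
    finally show ?thesis by simp
  qed
  moreover have "?w (Suc k) \<in> carrier_vec n"
    unfolding step using M Suc by auto
  ultimately show ?case by blast
qed

theorem theorem4:
  fixes v :: "real ^ 'd \<Rightarrow> complex" and \<alpha> \<beta> \<gamma> :: real and p :: nat
  assumes "p \<ge> 1" and "\<gamma> > 0"
    and "\<alpha> > 2 * real p + 1 / 2" and "v \<in> korobov_cont \<alpha>"
    and "\<beta> \<ge> 2"
  shows
    "(\<exists>c. \<forall>(z :: int ^ 'd) n A h. n \<ge> 1 \<and> minimal_anti_aliasing z n A h \<longrightarrow>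
        (\<forall>y :: real Matrix.vec. y \<in> carrier_vec n \<longrightarrow>
           vnorm (ad (scaled_D \<gamma> n h) p (scaled_W \<gamma> n z v) *\<^sub>v map_vec complex_of_real y)
             \<le> c * vnorm (((scaled_D \<gamma> n h + 1\<^sub>m n) ^\<^sub>m p) *\<^sub>v map_vec complex_of_real y)))
     \<and>
     (\<forall>s a b t. splitting_order s a b p \<longrightarrow>
       (\<exists>C C'. \<forall>(z :: int ^ 'd) n A h g u ua0 m dt.
          n \<ge> 1 \<and> minimal_anti_aliasing z n A h \<and> g \<in> korobov_cont \<beta> \<and>
          discretized_solution \<gamma> z n h v g u \<and> ua0 \<in> carrier_vec n \<and>
          dt > 0 \<and> real m * dt = t \<longrightarrow>
          vnorm (u t - splitting_approx s a b (scaled_D \<gamma> n h) (scaled_W \<gamma> n z v) dt ua0 m)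
            \<le> C * vnorm (u 0 - ua0)
              + C' * dt ^ p * vnorm (((scaled_D \<gamma> n h + 1\<^sub>m n) ^\<^sub>m p) *\<^sub>v u 0)))"
proof -
  note \<gamma> = assms(2)
  obtain R where R: "0 \<le> R"
    and bounds: "\<And>(z :: int ^ 'd) n A h. 1 \<le> n \<Longrightarrow> minimal_anti_aliasing z n A h \<Longrightarrow>
      (\<forall>l\<le>p. op_bound n (kinetic \<gamma> h) l l R (\<lambda>i j. W_mat n z v $$ (i, j) / of_real \<gamma>)) \<and>
      op_bound n (kinetic \<gamma> h) 0 p R
        (\<lambda>i j. of_real ((kinetic \<gamma> h i - kinetic \<gamma> h j) ^ p) * (W_mat n z v $$ (i, j) / of_real \<gamma>))"
    using uniform_potential_bounds[OF assms(4,3) \<gamma>] by blast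
  show ?thesis
  proof (rule conjI, goal_cases)
    case 1
    show ?case
    proof (intro exI[of _ R] allI impI, elim conjE)
      fix z :: "int ^ 'd" and n A h and y :: "real Matrix.vec"
      assume y: "y \<in> carrier_vec n" and n: "1 \<le> n" and min: "minimal_anti_aliasing z n A h"
      let ?y = "map_vec complex_of_real y" and ?d = "kinetic \<gamma> h"
      let ?M = "ad (scaled_D \<gamma> n h) p (scaled_W \<gamma> n z v)"
      have y': "?y \<in> carrier_vec n" using y by simp
      have M: "?M = Matrix.mat n n (\<lambda>(i, j). (of_real (?d i) - of_real (?d j)) ^ p * scaled_W \<gamma> n z v $$ (i, j))"
        unfolding scaled_D_eq by (rule ad_mat_diag[OF scaled_W_carrier[OF n]])
      then have MC: "?M \<in> carrier_mat n n" by simp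
      have "vnorm (?M *\<^sub>v ?y) = wnorm n ?d 0 (vec_index (?M *\<^sub>v ?y))"
        by (rule vnorm_eq_wnorm) (use MC in simp)
      also have "\<dots> = wnorm n ?d 0 (mapp n
          (\<lambda>i j. of_real ((?d i - ?d j) ^ p) * (W_mat n z v $$ (i, j) / of_real \<gamma>)) (vec_index ?y))"
      proof (rule wnorm_cong)
        fix i assume i: "i < n"
        show "vec_index (?M *\<^sub>v ?y) i = mapp n
          (\<lambda>i j. of_real ((?d i - ?d j) ^ p) * (W_mat n z v $$ (i, j) / of_real \<gamma>)) (vec_index ?y) i"
          unfolding entries_mult_vec[OF MC y' i]
          by (rule mapp_cong) (use i n in \<open>simp add: entries_def M scaled_W_entry\<close>)
      qed
      also have "\<dots> \<le> R * wnorm n ?d p (vec_index ?y)" by (rule op_bound_D[OF bounds[OF n min, THEN conjunct2]])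
      also have "wnorm n ?d p (vec_index ?y) = vnorm (((scaled_D \<gamma> n h + 1\<^sub>m n) ^\<^sub>m p) *\<^sub>v ?y)"
        by (rule vnorm_scaled_D_plus_one_pow[OF y' \<gamma>, symmetric])
      finally show "vnorm (?M *\<^sub>v ?y) \<le> R * vnorm (((scaled_D \<gamma> n h + 1\<^sub>m n) ^\<^sub>m p) *\<^sub>v ?y)" .
    qed
  next
    case 2
    show ?case
    proof (intro allI impI, goal_cases)
      case (1 s a b t)
      then have order: "matrix_order s a b p" by (rule matrix_order_of_splitting_order)
      obtain C C' where CC: "\<And>n d x B \<tau> u v m. weighted d \<Longrightarrow> (\<forall>i. Re (x i) = 0) \<Longrightarrow> (\<forall>i. cmod (x i) \<le> d i) \<Longrightarrow>
        (\<forall>l\<le>p. op_bound n d l l R B) \<Longrightarrow> 0 < \<tau> \<Longrightarrow> real m * \<tau> = t \<Longrightarrow> flow_on n x B {0..} u \<Longrightarrow>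
        (\<forall>k. v (Suc k) = mapp n (msplit n s a b (diagm x) B \<tau>) (v k)) \<Longrightarrow>
        wnorm n d 0 (u t - v m) \<le> C * wnorm n d 0 (u 0 - v 0) + C' * \<tau> ^ p * wnorm n d p (u 0)"
        using splitting_global_error[OF order assms(1) R, of t] by blast
      show ?case
      proof (rule exI[of _ C], rule exI[of _ C'], intro allI impI, elim conjE)
        fix z :: "int ^ 'd" and n A h g u and ua0 :: "complex Matrix.vec" and m dt
        assume n: "1 \<le> n" and min: "minimal_anti_aliasing z n A h" and u: "discretized_solution \<gamma> z n h v g u"
          and ua0: "ua0 \<in> carrier_vec n" and dt: "0 < dt" and m: "real m * dt = t"
        let ?d = "kinetic \<gamma> h" and ?x = "\<lambda>i. - \<i> * complex_of_real (kinetic \<gamma> h i)"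
        let ?B = "\<lambda>i j. - \<i> * (W_mat n z v $$ (i, j) / of_real \<gamma>)"
        let ?S = "msplit n s a b (diagm ?x) ?B dt"
        let ?w = "splitting_approx s a b (scaled_D \<gamma> n h) (scaled_W \<gamma> n z v) dt ua0 m"
        define V where "V = (\<lambda>k. (mapp n ?S ^^ k) (vec_index ua0))"
        interpret weighted n ?d by (rule weighted_kinetic[OF \<gamma>])
        have B: "\<forall>l\<le>p. op_bound n ?d l l R ?B"
          using op_bound_scalem[OF bounds[OF n min, THEN conjunct1, rule_format], of _ "- \<i>"] by (simp add: scalem_def)
        have t: "0 \<le> t" using m dt by auto
        have ut: "u r \<in> carrier_vec n" if "0 \<le> r" for r
          using u that by (auto simp: discretized_solution_def)
        have w: "?w \<in> carrier_vec n" "\<And>i. i < n \<Longrightarrow> vec_index ?w i = V m i"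
          using splitting_approx_entries[OF n ua0] unfolding V_def by blast+
        have "wnorm n ?d 0 (vec_index (u t) - V m)
            \<le> C * wnorm n ?d 0 (vec_index (u 0) - V 0) + C' * dt ^ p * wnorm n ?d p (vec_index (u 0))"
        proof (rule CC[where x = ?x and B = ?B and v = V])
          show "weighted ?d" by (rule weighted_kinetic[OF \<gamma>])
          show "flow_on n ?x ?B {0..} (\<lambda>t. vec_index (u t))" by (rule flow_on_discretized_solution[OF u n \<gamma>])
        qed (use B dt m d_nonneg in \<open>simp_all add: V_def norm_mult\<close>)
        moreover have "vnorm (u t - ?w) = wnorm n ?d 0 (vec_index (u t) - V m)"
        proof -
          have "vnorm (u t - ?w) = wnorm n ?d 0 (vec_index (u t - ?w))" by (rule vnorm_eq_wnorm) (use w in simp)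
          also have "\<dots> = wnorm n ?d 0 (vec_index (u t) - V m)"
            by (rule wnorm_cong) (use w ut[OF t] in \<open>simp add: minus_apply\<close>)
          finally show ?thesis .
        qed
        moreover have "vnorm (u 0 - ua0) = wnorm n ?d 0 (vec_index (u 0) - V 0)"
        proof -
          have "vnorm (u 0 - ua0) = wnorm n ?d 0 (vec_index (u 0 - ua0))" by (rule vnorm_eq_wnorm) (use ua0 in simp)
          also have "\<dots> = wnorm n ?d 0 (vec_index (u 0) - V 0)"
            by (rule wnorm_cong) (use ua0 ut[of 0] in \<open>simp add: minus_apply V_def\<close>)
          finally show ?thesis .
        qed
        moreover have "vnorm (((scaled_D \<gamma> n h + 1\<^sub>m n) ^\<^sub>m p) *\<^sub>v u 0) = wnorm n ?d p (vec_index (u 0))"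
          by (rule vnorm_scaled_D_plus_one_pow[OF ut \<gamma>]) simp
        ultimately show "vnorm (u t - ?w)
            \<le> C * vnorm (u 0 - ua0) + C' * dt ^ p * vnorm (((scaled_D \<gamma> n h + 1\<^sub>m n) ^\<^sub>m p) *\<^sub>v u 0)"
          by simp
      qed
    qed
  qed
qed

end
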